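(* Let $p\in(0,1)$ and $q=p$, let $(z_1,z_2)\in\mathbb D^2$ be in Region 2, and let $u=e^{i\theta}\in\mathbb T$ (Region 2, $A(u)$, $\phi_z$, $S(u)$ as in the context, with $q=p$). (a) $(z_1,z_2)\in S(u)$ if there is $z\in\mathbb D$ such that $$\overline zpu^4-\overline zu^3-pu^3+pu-pz+uz=0,$$ $$\max\{p^2,|z|^2\}<\frac{pu^2z-pu+pz-uz}{u(pu^2-2u+z)}<1,\qquad 0<\frac{(u-z)(p-u)}{u(pu^2+p-2u)}<1,$$ and $z=A/B$, where \begin{align*} A={}&-u\Big(p^2u^4z_1z_2+u^3\big(-p^2z_1z_2(z_1+z_2)-p^2(z_1+z_2)+p[(z_1+z_2)^2-4z_1z_2]\big)\\&+u^2\big(p^2(z_1z_2)^2-[(z_1+z_2)^2-4z_1z_2]+3p^2z_1z_2+p(z_1+z_2)\big)-4puz_1z_2+pz_1z_2(z_1+z_2)-p^2(z_1z_2)^2\Big),\\ B={}&u^4\big(p^2-p(z_1+z_2)\big)+u^3\big(3pz_1z_2-p+(z_1+z_2)\big)-u^2\big(4z_1z_2+2p^2z_1z_2\big)\\&+u\big(3pz_1z_2-p(z_1z_2)^2+z_1z_2(z_1+z_2)\big)+p^2(z_1z_2)^2-pz_1z_2(z_1+z_2). \end{align*} (b) If $(z_1,z_2)\in S(u)$, then $$g_{\mathbb D^2}((z_1,z_2),(p,0),(0,p))=\log\left|\frac{pu^2-pz_1z_2-u^2(z_1+z_2)+2uz_1z_2}{pu^2-pz_1z_2-2u+z_1+z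_2}\right|.$$
   Context: $\mathbb D$ is the unit disk in $\mathbb C$, $\mathbb T$ the unit circle, $m_a(\lambda)=\frac{a-\lambda}{1-\overline a\lambda}$ for $a\in\mathbb D$. Green function: for distinct $P,Q\in\mathbb D^2$, $g_{\mathbb D^2}(x,P,Q)$ is the supremum of $f(x)$ over all negative plurisubharmonic $f$ on $\mathbb D^2$ (values in $[-\infty,0)$) with logarithmic poles of weight $1$ at $P$ and $Q$, i.e. $f(y)-\log|y-a|\le O(1)$ as $y\to a$ for $a\in\{P,Q\}$. Regions (for fixed $p,q\in(0,1)$; here $q=p$). Region 1: the set of $(z_1,z_2)\in\mathbb D^2$ such that (i) $|z_2|<|m_{z_1}(p)|$, $|m_{z_2}(q)|<|z_1|$ and $\big|m_{m_{z_2}(q)/z_1}(z_2/m_{z_1}(p))\big|\le p$; or (ii) $|m_{z_1}(p)|<|z_2|$, $|z_1|<|m_{z_2}(q)|$ and $\big|m_{z_1/m_{z_2}(q)}(m_{z_1}(p)/z_2)\big|\le q$; or (iii) $z_2=\omega m_{z_1}(p)$ and $m_{z_2}(q)=\omega z_1$ for some $|\omega|=1$. Region 3: the set where $|m_{z_1}(p)|=|z_2|$ or $|z_1|=|m_{z_2}(q)|$. Region 2: all points of $\mathbb D^2$ in neither Region 1 nor Region 3. Sets $A(u)$, $u\in\mathbb T$: $A(1)=\{x\in(-1,1):-p<x<\min\{1,p/q\}\}$, $A(-1)=\{x\in(-1,1):\max\{-1,-p/q\}<x<-p\}$; for $u\ne\pm1$, $A(u)$ is the set of $z\in\mathbb D\setminus(-1,1)$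 with $|z|<p/q$ such that $$(u-z)(\overline zu-1)(u^2-1)^2p^2-(u-q)(\overline zu^2-z)^2(qu-1)=0,\qquad 0<T<1,\qquad \max\{|z|^2,p^2\}<R<1,$$ where $$R=\frac{(u-q)(\overline z-z)(\overline zu^2-z)(uq-1)}{(\overline zq^2u^2-|z|^2qu^2+\overline zu^2-qu^2-2\overline zqu+2quz+q|z|^2-q^2z+q-z)(u^2-1)},$$ $$T=\frac{q(\overline zqu^2-u^2-\overline zu+uz-qz+1)(\overline zu-1)(u-z)}{Q},$$ $Q=u^4\overline z^2q^2-u^4\overline z|z|^2q-u^3\overline z^2q+u^3\overline z|z|^2-2u^3\overline zq^2+2u^3|z|^2q-\overline zu^3+u^3q+3u^2\overline zq-3u^2qz-2|z|^2uq-|z|^2uz+2uq^2z+uqz^2+|z|^2qz-uq+uz-q^2z^2$. Disks: for $z\in A(u)$, $\phi_z(\lambda)=(\lambda m_\alpha(\lambda),\omega\lambda m_\beta(\lambda))$, where $\alpha,\beta,c\in\mathbb D$, $\omega\in\mathbb T$, $t\in(0,1)$ are such that, with $\gamma=t\alpha+(1-t)\beta$, one has $\alpha=m_\gamma(c)$, $cm_\alpha(c)=p$, $\omega cm_\beta(c)=z$, $\omega\alpha m_\beta(\alpha)=m_z(q)$, and, writing $c=rv$ with $r>0,|v|=1$, $\omega v^2=u$; these parameters are determined up to replacing $(\alpha,\beta,c)$ by $(-\alpha,-\beta,-c)$, which does not change $\phi_z(\mathbb D)$. Hypersurfaces: $G_z(\lambda_1,\lambda_2)=(\lambda_1,m_z(\lambda_2))$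 and $S(u)=\bigcup_{z\in A(u)}G_z(\phi_z(\mathbb D))$ whenever $A(u)\neq\emptyset$.
   Formalization: In the definition of T (used in A(u)), the first term of the factor (z̄qu − u² − z̄u + uz − qz + 1) is corrected to z̄qu²; as printed, T is generally not real and (a) fails, e.g. p=0.4, u=i, z=−0.2+0.5i, (z₁,z₂)=(0,z). *)

theory Defs
  imports "HOL-Analysis.Analysis"
begin

section \<open>Plurisubharmonic functions and the Green function of the bidisk\<close>

definition bidisk :: "(complex \<times> complex) set" where
  "bidisk = ball 0 1 \<times> ball 0 1"

text \<open>
  The mean of an extended-real function over \<open>[0, 2 * pi]\<close>, as the integral of the positive part
  minus the integral of the negative part (\<open>e2ennreal\<close> sends negative values to \<open>0\<close>).
  For an upper semicontinuous function with values in \<open>[-\<infinity>, \<infinity>)\<close> the first integral is finite,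
  so the difference is meaningful; it may be \<open>-\<infinity>\<close>.
\<close>

definition circle_mean :: "(real \<Rightarrow> ereal) \<Rightarrow> ereal" where
  "circle_mean g =
     (enn2ereal (\<integral>\<^sup>+\<theta>\<in>{0..2*pi}. e2ennreal (g \<theta>) \<partial>lborel)
      - enn2ereal (\<integral>\<^sup>+\<theta>\<in>{0..2*pi}. e2ennreal (- g \<theta>) \<partial>lborel)) / ereal (2*pi)"

text \<open>
  Values outside the open set \<open>\<Omega>\<close> are irrelevant. The sub-mean value inequality is required for
  every closed affine complex disk \<open>{a + \<zeta> b : |\<zeta>| \<le> 1}\<close> contained in \<open>\<Omega>\<close>.
  The constant \<open>-\<infinity>\<close> is allowed; this does not affect suprema such as the Green function.
\<close>

definition plurisubharmonic_on ::
    "(complex \<times> complex) set \<Rightarrow> (complex \<times> complex \<Rightarrow> ereal) \<Rightarrow> bool" where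
  "plurisubharmonic_on \<Omega> f \<longleftrightarrow>
     (\<forall>x\<in>\<Omega>. f x < \<infinity>) \<and>
     (\<forall>x\<in>\<Omega>. Limsup (at x within \<Omega>) f \<le> f x) \<and>
     (\<forall>a1 a2 b1 b2 :: complex.
        (\<forall>\<zeta>::complex. cmod \<zeta> \<le> 1 \<longrightarrow> (a1 + \<zeta> * b1, a2 + \<zeta> * b2) \<in> \<Omega>) \<longrightarrow>
        f (a1, a2) \<le> circle_mean (\<lambda>\<theta>. f (a1 + cis \<theta> * b1, a2 + cis \<theta> * b2)))"

definition log_pole :: "(complex \<times> complex \<Rightarrow> ereal) \<Rightarrow> complex \<times> complex \<Rightarrow> bool" where
  "log_pole f a \<longleftrightarrow> (\<exists>C::real. \<forall>\<^sub>F y in at a. f y \<le> ereal (ln (norm (y - a)) + C))"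

definition green_bidisk ::
    "complex \<times> complex \<Rightarrow> complex \<times> complex \<Rightarrow> complex \<times> complex \<Rightarrow> ereal" where
  "green_bidisk x P Q =
     Sup {f x | f. plurisubharmonic_on bidisk f \<and> (\<forall>y\<in>bidisk. f y < 0) \<and>
                   log_pole f P \<and> log_pole f Q}"

section \<open>The regions\<close>

definition disk_aut :: "complex \<Rightarrow> complex \<Rightarrow> complex" where
  "disk_aut a l = (a - l) / (1 - cnj a * l)"

definition region1 :: "real \<Rightarrow> real \<Rightarrow> (complex \<times> complex) set" where
  "region1 p q = {(z1, z2) \<in> bidisk.
     (cmod z2 < cmod (disk_aut z1 p) \<and> cmod (disk_aut z2 q) < cmod z1 \<and>
        cmod (disk_aut (disk_aut z2 q / z1) (z2 / disk_aut z1 p)) \<le> p) \<or>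
     (cmod (disk_aut z1 p) < cmod z2 \<and> cmod z1 < cmod (disk_aut z2 q) \<and>
        cmod (disk_aut (z1 / disk_aut z2 q) (disk_aut z1 p / z2)) \<le> q) \<or>
     (\<exists>\<omega>::complex. cmod \<omega> = 1 \<and> z2 = \<omega> * disk_aut z1 p \<and> disk_aut z2 q = \<omega> * z1)}"

definition region3 :: "real \<Rightarrow> real \<Rightarrow> (complex \<times> complex) set" where
  "region3 p q = {(z1, z2) \<in> bidisk.
     cmod (disk_aut z1 p) = cmod z2 \<or> cmod z1 = cmod (disk_aut z2 q)}"

definition region2 :: "real \<Rightarrow> real \<Rightarrow> (complex \<times> complex) set" where
  "region2 p q = bidisk - (region1 p q \<union> region3 p q)"

section \<open>The parameter sets \<open>A(u)\<close>\<close>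

definition R_expr :: "complex \<Rightarrow> complex \<Rightarrow> complex \<Rightarrow> complex" where
  "R_expr q u z = (let zb = cnj z; n = complex_of_real ((cmod z)^2) in
     ((u - q) * (zb - z) * (zb*u^2 - z) * (u*q - 1)) /
     ((zb*q^2*u^2 - n*q*u^2 + zb*u^2 - q*u^2 - 2*zb*q*u + 2*q*u*z + q*n - q^2*z + q - z)
        * (u^2 - 1)))"

definition Q_expr :: "complex \<Rightarrow> complex \<Rightarrow> complex \<Rightarrow> complex" where
  "Q_expr q u z = (let zb = cnj z; n = complex_of_real ((cmod z)^2) in
     u^4*zb^2*q^2 - u^4*zb*n*q - u^3*zb^2*q + u^3*zb*n - 2*u^3*zb*q^2 + 2*u^3*n*q
     - zb*u^3 + u^3*q + 3*u^2*zb*q - 3*u^2*q*z - 2*n*u*q - n*u*z + 2*u*q^2*z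
     + u*q*z^2 + n*q*z - u*q + u*z - q^2*z^2)"

text \<open>
  The first term of the second factor is \<open>zb * q * u\<^sup>2\<close>; the source prints \<open>zb * q * u\<close>, which
  is a misprint. With \<open>u\<^sup>2\<close> the quotient is real whenever \<open>|u| = 1\<close>; with \<open>u\<close> it is in general not.
  Moreover, for \<open>q = p\<close> and \<open>u \<noteq> \<plusminus>1\<close>, the corrected quotient agrees with
  \<open>(u - z) * (p - u) / (u * (p * u\<^sup>2 + p - 2 * u))\<close> on the line
  \<open>zb * p * u ^ 4 - zb * u ^ 3 - p * u ^ 3 + p * u - p * z + u * z = 0\<close>.
\<close>

definition T_expr :: "complex \<Rightarrow> complex \<Rightarrow> complex \<Rightarrow> complex" where
  "T_expr q u z = (let zb = cnj z in
     (q * (zb*q*u^2 - u^2 - zb*u + u*z - q*z + 1) * (zb*u - 1) * (u - z)) / Q_expr q u z)"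

text \<open>
  An inequality \<open>a < w < b\<close> for a complex expression \<open>w\<close> means that \<open>w\<close> is real and lies in
  \<open>(a, b)\<close>. A vanishing denominator would give \<open>w = 0\<close> (as \<open>x / 0 = 0\<close>), which the bounds exclude.
\<close>

definition A_set :: "real \<Rightarrow> real \<Rightarrow> complex \<Rightarrow> complex set" where
  "A_set p q u =
     (if u = 1 then
        complex_of_real ` {x. -1 < x \<and> x < 1 \<and> -p < x \<and> x < min 1 (p/q)}
      else if u = -1 then
        complex_of_real ` {x. -1 < x \<and> x < 1 \<and> max (-1) (-p/q) < x \<and> x < -p}
      else
        {z::complex. cmod z < 1 \<and> z \<notin> complex_of_real ` {-1<..<1} \<and> cmod z < p/q \<and>
            (u - z) * (cnj z * u - 1) * (u^2 - 1)^2 * (complex_of_real p)^2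
              - (u - complex_of_real q) * (cnj z * u^2 - z)^2 * (complex_of_real q * u - 1) = 0 \<and>
            T_expr (complex_of_real q) u z \<in> complex_of_real ` {0<..<1} \<and>
            R_expr (complex_of_real q) u z \<in> complex_of_real ` {max ((cmod z)^2) (p^2)<..<1}})"

section \<open>The disks and the hypersurfaces\<close>

definition phi_disk :: "complex \<Rightarrow> complex \<Rightarrow> complex \<Rightarrow> complex \<Rightarrow> complex \<times> complex" where
  "phi_disk \<alpha> \<beta> \<omega> l = (l * disk_aut \<alpha> l, \<omega> * l * disk_aut \<beta> l)"

definition disk_parameters ::
    "real \<Rightarrow> real \<Rightarrow> complex \<Rightarrow> complex \<Rightarrow>
     complex \<Rightarrow> complex \<Rightarrow> complex \<Rightarrow> complex \<Rightarrow> real \<Rightarrow> bool" where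
  "disk_parameters p q u z \<alpha> \<beta> c \<omega> t \<longleftrightarrow>
     cmod \<alpha> < 1 \<and> cmod \<beta> < 1 \<and> cmod c < 1 \<and> cmod \<omega> = 1 \<and> 0 < t \<and> t < 1 \<and>
     (let \<gamma> = complex_of_real t * \<alpha> + (1 - complex_of_real t) * \<beta> in \<alpha> = disk_aut \<gamma> c) \<and>
     c * disk_aut \<alpha> c = complex_of_real p \<and>
     \<omega> * c * disk_aut \<beta> c = z \<and>
     \<omega> * \<alpha> * disk_aut \<beta> \<alpha> = disk_aut z (complex_of_real q) \<and>
     (\<exists>(r::real) (v::complex). r > 0 \<and> cmod v = 1 \<and> c = complex_of_real r * v \<and> \<omega> * v^2 = u)"

definition G_map :: "complex \<Rightarrow> complex \<times> complex \<Rightarrow> complex \<times> complex" where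
  "G_map z = (\<lambda>(l1, l2). (l1, disk_aut z l2))"

text \<open>
  The image of the disk \<open>\<phi>\<^sub>z\<close> does not depend on the choice of its parameters, so the union over
  all admissible parameters is the union of the sets \<open>G\<^sub>z (\<phi>\<^sub>z (\<D>))\<close> over \<open>z \<in> A(u)\<close>.
  The union is empty if \<open>A(u)\<close> is empty.
\<close>

definition S_set :: "real \<Rightarrow> real \<Rightarrow> complex \<Rightarrow> (complex \<times> complex) set" where
  "S_set p q u =
     (\<Union>z\<in>A_set p q u. \<Union>{G_map z ` phi_disk \<alpha> \<beta> \<omega> ` ball 0 1 | \<alpha> \<beta> c \<omega> t.
                          disk_parameters p q u z \<alpha> \<beta> c \<omega> t})"

section \<open>Recovering \<open>z\<close> from a point of the hypersurface\<close>

definition A_num :: "complex \<Rightarrow> complex \<Rightarrow> complex \<Rightarrow> complex \<Rightarrow> complex" where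
  "A_num p u z1 z2 =
     - u * (p^2*u^4*z1*z2
       + u^3 * (- (p^2*z1*z2*(z1 + z2)) - p^2*(z1 + z2) + p*((z1 + z2)^2 - 4*z1*z2))
       + u^2 * (p^2*(z1*z2)^2 - ((z1 + z2)^2 - 4*z1*z2) + 3*p^2*z1*z2 + p*(z1 + z2))
       - 4*p*u*z1*z2 + p*z1*z2*(z1 + z2) - p^2*(z1*z2)^2)"

definition B_den :: "complex \<Rightarrow> complex \<Rightarrow> complex \<Rightarrow> complex \<Rightarrow> complex" where
  "B_den p u z1 z2 =
     u^4 * (p^2 - p*(z1 + z2))
     + u^3 * (3*p*z1*z2 - p + (z1 + z2))
     - u^2 * (4*z1*z2 + 2*p^2*z1*z2)
     + u * (3*p*z1*z2 - p*(z1*z2)^2 + z1*z2*(z1 + z2))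
     + p^2*(z1*z2)^2 - p*z1*z2*(z1 + z2)"

end

theory Submission
  imports Defs "HOL-Complex_Analysis.Complex_Analysis"
begin

text \<open>
  Write \<open>d = 1 - p u\<close>, \<open>D\<close> for its conjugate, and let \<open>F\<close> be the quotient in the Green function formula
  (\<open>extremal_fun\<close>).  The formula is a meeting of two bounds.

  Lower bound.  The function \<open>F\<close> is rational of degree one in each variable, maps the bidisk into the
  unit disk and vanishes at both poles, so \<open>log |F|\<close> is one of the functions over which the Green
  function takes the supremum (\<open>log_extremal_plurisubharmonic\<close>, \<open>log_extremal_poles\<close>).

  Upper bound.  A disk \<open>\<psi>\<close> of the hypersurface passes through the poles at the parameters \<open>c\<close> and
  \<open>\<alpha>\<close>.  A negative plurisubharmonic \<open>f\<close> with logarithmic poles there satisfies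
  \<open>f (\<psi> l) \<le> log |m\<^sub>c l * m\<^sub>\<alpha> l|\<close> (\<open>plurisubharmonic_disc_bound\<close>).  Plurisubharmonicity is only
  given on affine disks, and the passage to the analytic disk \<open>\<psi>\<close> is a viscosity argument: maximise
  \<open>f x - h l - K |x - \<psi> l|\<^sup>2\<close> over \<open>l\<close> and \<open>x\<close> together.  At a maximum the affine disk through \<open>x\<close>
  in direction \<open>\<psi>' l\<close> does not see the penalty to second order, so a strictly superharmonic \<open>h\<close>
  cannot touch (\<open>viscosity_touching\<close>); no regularisation of \<open>f\<close> is required.

  The two bounds agree because \<open>F \<circ> \<psi> = - u m\<^sub>c m\<^sub>\<alpha>\<close> (\<open>extremal_fun_along_disc\<close>).  Since \<open>F\<close> has
  degree one in each variable and both components of \<open>\<psi>\<close> have degree two, this composition should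
  have degree four.  It has degree two because \<open>\<psi>\<close> passes twice through the boundary point
  \<open>(u, u)\<close>, where numerator and denominator of \<open>F\<close> both vanish.  The poles themselves lie in Region 3,
  which is why \<open>F\<close> does not vanish at the given point.

  All of this becomes computable after a change of parameters.  When \<open>q = p\<close> the conditions defining
  a disk can be solved: up to a rotation by \<open>v\<close>, the disk is determined by \<open>p\<close>, \<open>u\<close> and one real
  number \<open>s > 0\<close>, namely the position of \<open>z = u + s (p u\<^sup>2 - u)\<close> on the line through \<open>u\<close> and \<open>p u\<^sup>2\<close>
  (\<open>normal_form\<close>, \<open>disk_parameters_normal_form\<close>).

  For the membership criterion, the linear equation in \<open>z\<close> says exactly that \<open>z\<close> lies on this line
  (\<open>line_parameter\<close>), and the quotient bounded by \<open>max (p\<^sup>2) (|z|\<^sup>2)\<close> and \<open>1\<close> is the value of \<open>|c|\<^sup>2\<close>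
  (\<open>radius_on_line\<close>).  The bounds produce the disk (\<open>normal_form_exists\<close>,
  \<open>normal_form_disk_parameters\<close>) and put \<open>z\<close> into \<open>A(u)\<close> (\<open>point_on_line_in_A_set\<close>).  Each
  coordinate of the disk prescribes its parameter through a quadratic equation, and \<open>z = A / B\<close> is
  the vanishing of the resultant of the two quadratics (\<open>resultant_identity\<close>); a common root is the
  parameter of the given point (\<open>point_in_disc_of_conic\<close>).
\<close>

section \<open>Means over circles\<close>

lemma circle_mean_mono:
  assumes "\<And>\<theta>. \<theta> \<in> {0..2*pi} \<Longrightarrow> g \<theta> \<le> G \<theta>"
  shows "circle_mean g \<le> circle_mean G"
proof -
  have "(\<integral>\<^sup>+\<theta>\<in>{0..2*pi}. e2ennreal (g \<theta>) \<partial>lborel) \<le> (\<integral>\<^sup>+\<theta>\<in>{0..2*pi}. e2ennreal (G \<theta>) \<partial>lborel)"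
    by (intro nn_integral_mono) (auto simp: indicator_def intro!: e2ennreal_mono assms)
  moreover have "(\<integral>\<^sup>+\<theta>\<in>{0..2*pi}. e2ennreal (- G \<theta>) \<partial>lborel) \<le> (\<integral>\<^sup>+\<theta>\<in>{0..2*pi}. e2ennreal (- g \<theta>) \<partial>lborel)"
    by (intro nn_integral_mono) (auto simp: indicator_def intro!: e2ennreal_mono assms)
  ultimately show ?thesis
    unfolding circle_mean_def
    by (intro ereal_divide_right_mono ereal_minus_mono) (auto simp: less_eq_ennreal.rep_eq)
qed

text \<open>
  Both integrals in the definition are finite for a continuous function, so their difference is the
  ordinary integral.  Comparison functions are therefore handled with Cauchy's formula.
\<close>

lemma circle_mean_of_continuous:
  assumes "continuous_on {0..2*pi} G" and "(G has_integral I) {0..2*pi}"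
  shows "circle_mean (\<lambda>\<theta>. ereal (G \<theta>)) = ereal (I / (2*pi))"
proof -
  define Gp Gm where "Gp = (\<lambda>t. max 0 (G t))" and "Gm = (\<lambda>t. max 0 (- G t))"
  have "continuous_on {0..2*pi} Gp" "continuous_on {0..2*pi} Gm"
    unfolding Gp_def Gm_def by (intro continuous_intros assms)+
  then obtain Ip Im where I: "(Gp has_integral Ip) {0..2*pi}" "(Gm has_integral Im) {0..2*pi}"
    using integrable_continuous_real unfolding integrable_on_def by metis
  have nonneg: "0 \<le> Ip" "0 \<le> Im"
    using has_integral_nonneg[OF I(1)] has_integral_nonneg[OF I(2)] by (auto simp: Gp_def Gm_def)
  have "((\<lambda>t. Gp t - Gm t) has_integral (Ip - Im)) {0..2*pi}"
    using I by (rule has_integral_diff)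
  moreover have "(\<lambda>t. Gp t - Gm t) = G" by (auto simp: Gp_def Gm_def)
  ultimately have "I = Ip - Im" using assms(2) has_integral_unique by metis
  have eG: "ennreal (max 0 x) = ennreal x" for x :: real
    by (simp add: max_def ennreal_neg)
  have "(\<integral>\<^sup>+t\<in>{0..2*pi}. e2ennreal (ereal (G t)) \<partial>lborel) = ennreal Ip"
    using nn_integral_has_integral_lebesgue'[OF _ I(1)] by (simp add: eG Gp_def)
  moreover have "(\<integral>\<^sup>+t\<in>{0..2*pi}. e2ennreal (- ereal (G t)) \<partial>lborel) = ennreal Im"
    using nn_integral_has_integral_lebesgue'[OF _ I(2)] by (simp add: eG Gm_def)
  ultimately show ?thesis
    unfolding circle_mean_def using nonneg \<open>I = Ip - Im\<close> by simp
qed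

lemma holomorphic_circle_mean:
  assumes "continuous_on (cball 0 r) H" "H holomorphic_on ball 0 r" "0 < r"
  shows "((\<lambda>t. H (of_real r * cis t)) has_integral (2 * of_real pi * H 0)) {0..2*pi}"
proof -
  have "((\<lambda>u. H u / (u - 0)) has_contour_integral (2 * of_real pi * \<i> * H 0)) (circlepath 0 r)"
    by (rule Cauchy_integral_circlepath) (use assms in auto)
  then have "((\<lambda>t. H (0 + r * cis t) / (0 + r * cis t - 0) * r * \<i> * cis t) has_integral
               (2 * of_real pi * \<i> * H 0)) {0..2*pi}"
    unfolding circlepath_def by (subst (asm) has_contour_integral_part_circlepath_iff) auto
  then have "((\<lambda>t. -\<i> * (H (0 + r * cis t) / (0 + r * cis t - 0) * r * \<i> * cis t)) has_integral
               -\<i> * (2 * of_real pi * \<i> * H 0)) {0..2*pi}"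
    by (rule has_integral_mult_right)
  then show ?thesis
    using assms(3) by (simp add: field_simps cis_neq_zero)
qed

lemma Re_holomorphic_circle_mean:
  assumes "continuous_on (cball 0 r) H" "H holomorphic_on ball 0 r" "0 < r"
  shows "((\<lambda>t. Re (H (of_real r * cis t))) has_integral (2 * pi * Re (H 0))) {0..2*pi}"
  using has_integral_Re[OF holomorphic_circle_mean[OF assms]] by (simp add: o_def)

section \<open>Plurisubharmonic functions on affine disks\<close>

text \<open>
  The real part of a holomorphic function equals its mean, so a boundary bound by \<open>Re H\<close> propagates to
  the center.  Every consequence of the sub-mean value inequality for an arbitrary \<open>f\<close> is drawn in
  this form.
\<close>

lemma plurisubharmonic_le_Re_center:
  assumes psh: "plurisubharmonic_on \<Omega> f"
    and disc: "\<And>\<zeta>. cmod \<zeta> \<le> 1 \<Longrightarrow> (a1 + \<zeta> * b1, a2 + \<zeta> * b2) \<in> \<Omega>"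
    and H: "continuous_on (cball 0 1) H" "H holomorphic_on ball 0 1"
    and bound: "\<And>\<zeta>. cmod \<zeta> = 1 \<Longrightarrow> f (a1 + \<zeta> * b1, a2 + \<zeta> * b2) \<le> ereal (Re (H \<zeta>))"
  shows "f (a1, a2) \<le> ereal (Re (H 0))"
proof -
  have "f (a1, a2) \<le> circle_mean (\<lambda>\<theta>. f (a1 + cis \<theta> * b1, a2 + cis \<theta> * b2))"
    using psh disc unfolding plurisubharmonic_on_def by blast
  also have "\<dots> \<le> circle_mean (\<lambda>\<theta>. ereal (Re (H (cis \<theta>))))"
    by (intro circle_mean_mono bound) auto
  also have "\<dots> = ereal (2 * pi * Re (H 0) / (2 * pi))"
  proof (rule circle_mean_of_continuous)
    show "continuous_on {0..2*pi} (\<lambda>\<theta>. Re (H (cis \<theta>)))"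
      by (intro continuous_intros continuous_on_compose2[OF H(1)]) auto
    show "((\<lambda>\<theta>. Re (H (cis \<theta>))) has_integral 2 * pi * Re (H 0)) {0..2*pi}"
      using Re_holomorphic_circle_mean[OF H] by simp
  qed
  finally show ?thesis by simp
qed

lemma bidisk_open: "open bidisk"
  unfolding bidisk_def by (intro open_Times) auto

text \<open>
  A logarithmic pole bounds \<open>f\<close> only on a punctured neighbourhood.  The sub-mean value inequality on
  circles of radius \<open>\<rho>\<close> around the pole supplies the missing value, so that the bound \<open>ln \<rho> + C\<close>
  holds on the whole ball.
\<close>

lemma log_pole_bound_ball:
  assumes psh: "plurisubharmonic_on bidisk f" and pole: "log_pole f P" and P: "P \<in> bidisk"
  obtains r C where "0 < r"
    "\<And>\<rho> x. \<lbrakk>0 < \<rho>; \<rho> \<le> r; dist x P \<le> \<rho>\<rbrakk> \<Longrightarrow> f x \<le> ereal (ln \<rho> + C)"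
proof -
  obtain C e where e: "0 < e"
    and C: "\<And>y. y \<noteq> P \<Longrightarrow> dist y P < e \<Longrightarrow> f y \<le> ereal (ln (norm (y - P)) + C)"
    using pole unfolding log_pole_def eventually_at by auto
  obtain e' where e': "0 < e'" "ball P e' \<subseteq> bidisk"
    using bidisk_open P open_contains_ball by metis
  obtain p1 p2 where Pp: "P = (p1, p2)" by (cases P)
  show thesis
  proof (rule that)
    show "0 < min e e' / 2" using e e' by auto
    fix \<rho> x assume \<rho>: "0 < \<rho>" "\<rho> \<le> min e e' / 2" and x: "dist x P \<le> \<rho>"
    show "f x \<le> ereal (ln \<rho> + C)"
    proof (cases "x = P")
      case False
      then have "f x \<le> ereal (ln (norm (x - P)) + C)"
        using C[of x] x \<rho> by (auto simp: min_def split: if_splits)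
      also have "\<dots> \<le> ereal (ln \<rho> + C)"
        using False x \<rho> by (auto simp: dist_norm intro!: ln_mono)
      finally show ?thesis .
    next
      case True
      have d: "dist (p1 + \<zeta> * of_real \<rho>, p2 + \<zeta> * 0) P = cmod \<zeta> * \<rho>" for \<zeta> :: complex
        using \<rho>(1) by (simp add: Pp dist_Pair_Pair dist_norm norm_mult)
      have "f (p1, p2) \<le> ereal (Re (complex_of_real (ln \<rho> + C)))"
      proof (rule plurisubharmonic_le_Re_center[OF psh, where ?b1.0 = "of_real \<rho>" and ?b2.0 = 0
             and H = "\<lambda>_. complex_of_real (ln \<rho> + C)"])
        fix \<zeta> :: complex assume "cmod \<zeta> \<le> 1"
        then have "cmod \<zeta> * \<rho> < e'" using \<rho> e'
          by (smt (verit, best) mult_left_le_one_le norm_ge_zero min_def field_sum_of_halves)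
        then show "(p1 + \<zeta> * of_real \<rho>, p2 + \<zeta> * 0) \<in> bidisk"
          using d[of \<zeta>] e'(2) by (metis dist_commute in_mono mem_ball)
      next
        fix \<zeta> :: complex assume z: "cmod \<zeta> = 1"
        let ?y = "(p1 + \<zeta> * of_real \<rho>, p2 + \<zeta> * 0)"
        have dy: "dist ?y P = \<rho>" using d[of \<zeta>] z by simp
        then have "?y \<noteq> P" using \<rho>(1) by (metis dist_self less_irrefl)
        moreover have "dist ?y P < e" using dy \<rho> e by (simp add: min_def split: if_splits)
        ultimately show "f ?y \<le> ereal (Re (complex_of_real (ln \<rho> + C)))"
          using C[of ?y] dy by (simp add: dist_norm)
      qed auto
      then show ?thesis using True Pp by simp
    qed
  qed
qed

text \<open>
  If no maximum existed, each point would have a neighbourhood on which \<open>\<phi>\<close> stays below a larger value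
  of \<open>\<phi>\<close>; the largest of finitely many such values would then be smaller than itself.
\<close>

lemma upper_semicontinuous_attains_max:
  fixes \<phi> :: "'a::topological_space \<Rightarrow> 'b::linorder"
  assumes S: "compact S" "S \<noteq> {}"
    and usc: "\<And>x t. x \<in> S \<Longrightarrow> \<phi> x < t \<Longrightarrow> \<exists>U. open U \<and> x \<in> U \<and> (\<forall>y\<in>U \<inter> S. \<phi> y < t)"
  obtains x where "x \<in> S" "\<And>y. y \<in> S \<Longrightarrow> \<phi> y \<le> \<phi> x"
proof -
  have "\<exists>x\<in>S. \<forall>y\<in>S. \<phi> y \<le> \<phi> x"
  proof (rule ccontr)
    assume "\<not> ?thesis"
    then have "\<forall>x\<in>S. \<exists>y\<in>S. \<phi> x < \<phi> y" by (meson not_le)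
    then obtain g where g: "\<And>x. x \<in> S \<Longrightarrow> g x \<in> S" "\<And>x. x \<in> S \<Longrightarrow> \<phi> x < \<phi> (g x)" by metis
    then have "\<forall>x\<in>S. \<exists>U. open U \<and> x \<in> U \<and> (\<forall>y\<in>U \<inter> S. \<phi> y < \<phi> (g x))"
      using usc by blast
    then obtain U where U: "\<And>x. x \<in> S \<Longrightarrow> open (U x)" "\<And>x. x \<in> S \<Longrightarrow> x \<in> U x"
      "\<And>x y. x \<in> S \<Longrightarrow> y \<in> U x \<inter> S \<Longrightarrow> \<phi> y < \<phi> (g x)" by metis
    have cov: "S \<subseteq> (\<Union>x\<in>S. U x)" using U(2) by blast
    obtain T where T: "T \<subseteq> S" "finite T" "S \<subseteq> (\<Union>x\<in>T. U x)"
      by (rule compactE_image[OF S(1), of S U, OF U(1) cov]) blast+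
    have fin: "finite ((\<lambda>x. \<phi> (g x)) ` T)" and ne: "(\<lambda>x. \<phi> (g x)) ` T \<noteq> {}"
      using T S by auto
    obtain x where x: "x \<in> T" "Max ((\<lambda>x. \<phi> (g x)) ` T) = \<phi> (g x)"
      using Max_in[OF fin ne] by auto
    then obtain x' where x': "x' \<in> T" "g x \<in> U x'" using T g by blast
    then have "\<phi> (g x) < \<phi> (g x')" using U(3) T g x by blast
    moreover have "\<phi> (g x') \<le> \<phi> (g x)" using x' fin x(2) by (metis Max_ge imageI)
    ultimately show False by simp
  qed
  then show thesis using that by blast
qed

lemma usc_minus_continuous:
  fixes f :: "complex \<times> complex \<Rightarrow> ereal" and k :: "'a::metric_space \<Rightarrow> real"
  assumes psh: "plurisubharmonic_on \<Omega> f" and O: "open \<Omega>" 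
    and X: "continuous_on S X" "\<And>y. y \<in> S \<Longrightarrow> X y \<in> \<Omega>" and k: "continuous_on S k"
    and x: "x \<in> S" "f (X x) - ereal (k x) < t"
  shows "\<exists>U. open U \<and> x \<in> U \<and> (\<forall>y\<in>U \<inter> S. f (X y) - ereal (k y) < t)"
proof -
  have "f (X x) < t + ereal (k x)"
    using x(2) by (simp add: ereal_minus_less)
  then obtain \<tau> where \<tau>: "f (X x) < ereal \<tau>" "ereal \<tau> < t + ereal (k x)"
    using ereal_dense2 by blast
  then have "ereal (\<tau> - k x) < t" by (cases t) auto
  then obtain \<sigma> where \<sigma>: "ereal (\<tau> - k x) < ereal \<sigma>" "ereal \<sigma> < t"
    using ereal_dense2 by blast
  have "Limsup (at (X x) within \<Omega>) f < ereal \<tau>"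
    using psh X(2)[OF x(1)] \<tau>(1) unfolding plurisubharmonic_on_def
    by (metis order_le_less_trans)
  then have "\<forall>\<^sub>F y in at (X x) within \<Omega>. f y < ereal \<tau>"
    by (simp add: Limsup_lessD)
  then obtain e where e: "0 < e" "\<And>y. y \<in> \<Omega> \<Longrightarrow> y \<noteq> X x \<Longrightarrow> dist y (X x) < e \<Longrightarrow> f y < ereal \<tau>"
    unfolding eventually_at by auto
  obtain e1 where e1: "0 < e1" "\<And>y. y \<in> S \<Longrightarrow> dist y x < e1 \<Longrightarrow> dist (X y) (X x) < e"
    using X(1) x(1) e(1) unfolding continuous_on_iff by metis
  have "0 < \<sigma> - (\<tau> - k x)" using \<sigma>(1) by simp
  then obtain e2 where e2: "0 < e2"
      "\<And>y. y \<in> S \<Longrightarrow> dist y x < e2 \<Longrightarrow> dist (k y) (k x) < \<sigma> - (\<tau> - k x)"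
    using k x(1) unfolding continuous_on_iff by metis
  show ?thesis
  proof (intro exI[of _ "ball x (min e1 e2)"] conjI ballI)
    fix y assume y: "y \<in> ball x (min e1 e2) \<inter> S"
    have "f (X y) < ereal \<tau>"
      using e1(2)[of y] e(2)[of "X y"] X(2)[of y] y \<tau>(1) by (cases "X y = X x") (auto simp: dist_commute)
    then have "f (X y) - ereal (k y) < ereal (\<tau> - k y)"
      by (cases "f (X y)") auto
    also have "\<tau> - k y < \<sigma>"
      using e2(2)[of y] y by (auto simp: dist_real_def dist_commute)
    then have "ereal (\<tau> - k y) < ereal \<sigma>" by simp
    finally show "f (X y) - ereal (k y) < t" using \<sigma>(2) by simp
  qed (use e1 e2 in auto)
qed

section \<open>Automorphisms of the unit disk\<close>

text \<open>
  The difference is positive when \<open>a\<close> and \<open>l\<close> lie in the disk and vanishes when \<open>l\<close> lies on the unit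
  circle; this is why \<open>disk_aut a\<close> preserves both.
\<close>

lemma disk_aut_cmod_sq_diff:
  "(cmod (1 - cnj a * l))\<^sup>2 - (cmod (a - l))\<^sup>2 = (1 - (cmod a)\<^sup>2) * (1 - (cmod l)\<^sup>2)"
  unfolding cmod_power2 by (simp add: power2_eq_square algebra_simps)

lemma disk_aut_denominator_nz:
  assumes "cmod a < 1" "cmod l \<le> 1"
  shows "1 - cnj a * l \<noteq> 0"
proof
  assume "1 - cnj a * l = 0"
  then have "cmod a * cmod l = 1"
    by (metis complex_mod_cnj eq_iff_diff_eq_0 norm_mult norm_one)
  moreover have "cmod a * cmod l \<le> cmod a * 1" using assms by (intro mult_left_mono) auto
  ultimately show False using assms by linarith
qed

lemma cmod_disk_aut_less_1:
  assumes "cmod a < 1" "cmod l < 1" shows "cmod (disk_aut a l) < 1"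
proof -
  have "0 < (1 - (cmod a)\<^sup>2) * (1 - (cmod l)\<^sup>2)"
    using assms by (simp add: power_less_one_iff)
  then have "(cmod (a - l))\<^sup>2 < (cmod (1 - cnj a * l))\<^sup>2"
    using disk_aut_cmod_sq_diff[of a l] by linarith
  then have "cmod (a - l) < cmod (1 - cnj a * l)" by (rule power_less_imp_less_base) simp
  then show ?thesis unfolding disk_aut_def norm_divide
    using le_less_trans[OF norm_ge_zero] by (subst divide_less_eq_1_pos) blast+
qed

lemma cmod_disk_aut_eq_1:
  assumes "cmod a < 1" "cmod l = 1" shows "cmod (disk_aut a l) = 1"
proof -
  have "(cmod (a - l))\<^sup>2 = (cmod (1 - cnj a * l))\<^sup>2"
    using disk_aut_cmod_sq_diff[of a l] assms by simp
  then have "cmod (a - l) = cmod (1 - cnj a * l)" by simp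
  then show ?thesis using disk_aut_denominator_nz[of a l] assms by (simp add: disk_aut_def norm_divide)
qed

lemma disk_aut_holomorphic: "cmod a < 1 \<Longrightarrow> disk_aut a holomorphic_on cball 0 1"
  unfolding disk_aut_def
  by (intro holomorphic_intros) (use disk_aut_denominator_nz in auto)

lemma disk_aut_eq_0_iff: "cmod a < 1 \<Longrightarrow> cmod l \<le> 1 \<Longrightarrow> disk_aut a l = 0 \<longleftrightarrow> l = a"
  using disk_aut_denominator_nz[of a l] by (auto simp: disk_aut_def)

text \<open>
  Small values of \<open>disk_aut a\<close> occur only near \<open>a\<close>: the denominator is at most \<open>2\<close> in modulus.
\<close>

lemma dist_le_disk_aut:
  assumes "cmod a < 1" "cmod l \<le> 1" shows "cmod (l - a) \<le> 2 * cmod (disk_aut a l)"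
proof -
  have nz: "1 - cnj a * l \<noteq> 0" using disk_aut_denominator_nz assms by blast
  have "cmod (1 - cnj a * l) \<le> 1 + cmod a * cmod l"
    by (metis complex_mod_cnj norm_mult norm_one norm_triangle_ineq4)
  also have "\<dots> \<le> 2" using mult_mono[of "cmod a" 1 "cmod l" 1] assms by simp
  finally have "cmod (1 - cnj a * l) \<le> 2" .
  then have "cmod (disk_aut a l) * cmod (1 - cnj a * l) \<le> cmod (disk_aut a l) * 2"
    by (rule mult_left_mono) auto
  moreover have "disk_aut a l * (1 - cnj a * l) = a - l" using nz by (simp add: disk_aut_def)
  ultimately show ?thesis by (metis mult.commute norm_minus_commute norm_mult)
qed

lemma disk_aut_involution:
  assumes "cmod z < 1" "cmod x \<le> 1"
  shows "disk_aut z (disk_aut z x) = x"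
proof -
  have nz: "1 - cnj z * x \<noteq> 0" using disk_aut_denominator_nz assms by blast
  have zz: "1 - cnj z * z \<noteq> 0" using disk_aut_denominator_nz[of z z] assms by simp
  define y where "y = disk_aut z x"
  have y: "y * (1 - cnj z * x) = z - x" using nz by (simp add: y_def disk_aut_def)
  have n1: "(1 - cnj z * x) * (z - y) = (1 - cnj z * z) * x" using y by algebra
  have n2: "(1 - cnj z * x) * (1 - cnj z * y) = 1 - cnj z * z" using y by algebra
  have "disk_aut z y = ((1 - cnj z * x) * (z - y)) / ((1 - cnj z * x) * (1 - cnj z * y))"
    unfolding disk_aut_def using nz by simp
  also have "\<dots> = x" unfolding n1 n2 using zz by simp
  finally show ?thesis by (simp add: y_def)
qed

section \<open>Plurisubharmonic functions on analytic disks\<close>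

text \<open>
  Heart of the passage from affine to analytic disks.  The test function is
  \<open>h l + K |x - \<psi> l|\<^sup>2\<close> with \<open>h = Re H - \<epsilon> |l|\<^sup>2\<close>, and it touches \<open>f\<close> from above at \<open>x\<close> along the
  motion \<open>x + \<zeta> \<psi>' l0\<close>, \<open>l0 + \<zeta>\<close>.  Expanding the square, the cross term is the real part of a
  holomorphic function that vanishes at \<open>0\<close>, and the remaining term \<open>|k \<zeta>|\<^sup>2\<close> is \<open>o(|\<zeta>|\<^sup>2)\<close> because
  \<open>\<psi>\<close> is differentiable.  So the mean of the test function over a small circle is below its center
  value by about \<open>\<epsilon> r\<^sup>2\<close>, contradicting the sub-mean value inequality for \<open>f\<close>.
\<close>

lemma viscosity_touching:
  assumes psh: "plurisubharmonic_on \<Omega> f" and \<Omega>: "open \<Omega>" "(x1, x2) \<in> \<Omega>"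
    and \<rho>: "0 < \<rho>" and hol: "\<psi>1 holomorphic_on ball l0 \<rho>" "\<psi>2 holomorphic_on ball l0 \<rho>"
      "H holomorphic_on ball l0 \<rho>"
    and pos: "0 < \<epsilon>" "0 < K"
    and touch0: "f (x1, x2) = ereal (Re (H l0) - \<epsilon> * (cmod l0)\<^sup>2
       + K * ((cmod (x1 - \<psi>1 l0))\<^sup>2 + (cmod (x2 - \<psi>2 l0))\<^sup>2))"
    and touch: "\<And>\<zeta>. cmod \<zeta> < \<rho> \<Longrightarrow>
       f (x1 + \<zeta> * deriv \<psi>1 l0, x2 + \<zeta> * deriv \<psi>2 l0) \<le>
         ereal (Re (H (l0 + \<zeta>)) - \<epsilon> * (cmod (l0 + \<zeta>))\<^sup>2
           + K * ((cmod (x1 + \<zeta> * deriv \<psi>1 l0 - \<psi>1 (l0 + \<zeta>)))\<^sup>2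
                + (cmod (x2 + \<zeta> * deriv \<psi>2 l0 - \<psi>2 (l0 + \<zeta>)))\<^sup>2))"
  shows False
proof -
  define k1 where "k1 = (\<lambda>\<zeta>. \<psi>1 (l0 + \<zeta>) - \<psi>1 l0 - \<zeta> * deriv \<psi>1 l0)"
  define k2 where "k2 = (\<lambda>\<zeta>. \<psi>2 (l0 + \<zeta>) - \<psi>2 l0 - \<zeta> * deriv \<psi>2 l0)"
  define d1 where "d1 = x1 - \<psi>1 l0"
  define d2 where "d2 = x2 - \<psi>2 l0"
  \<comment> \<open>chosen so that the two remainders cost only half of the gain: \<open>2 K \<eta>\<^sup>2 = \<epsilon> / 2\<close>\<close>
  define \<eta> where "\<eta> = sqrt (\<epsilon> / (4 * K))"
  have \<eta>: "0 < \<eta>" "\<eta>\<^sup>2 = \<epsilon> / (4 * K)" using pos by (auto simp: \<eta>_def)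
  have small: "\<exists>\<delta>>0. \<forall>\<zeta>. cmod \<zeta> < \<delta> \<longrightarrow> cmod (\<psi> (l0 + \<zeta>) - \<psi> l0 - \<zeta> * deriv \<psi> l0) \<le> \<eta> * cmod \<zeta>"
    if "\<psi> holomorphic_on ball l0 \<rho>" for \<psi>
  proof -
    have "(\<psi> has_field_derivative deriv \<psi> l0) (at l0)"
      using that \<rho> by (intro holomorphic_derivI[OF that]) auto
    then obtain \<delta> where "\<delta> > 0" "\<And>y. norm (y - l0) < \<delta> \<Longrightarrow>
         norm (\<psi> y - \<psi> l0 - deriv \<psi> l0 * (y - l0)) \<le> \<eta> * norm (y - l0)"
      using \<eta>(1) unfolding has_field_derivative_def has_derivative_at_alt by blast
    then show ?thesis
      by (intro exI[of _ \<delta>]) (metis add_diff_cancel_left' mult.commute)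
  qed
  obtain \<delta>1 where \<delta>1: "\<delta>1 > 0" "\<And>\<zeta>. cmod \<zeta> < \<delta>1 \<Longrightarrow> cmod (k1 \<zeta>) \<le> \<eta> * cmod \<zeta>"
    using small[OF hol(1)] unfolding k1_def by blast
  obtain \<delta>2 where \<delta>2: "\<delta>2 > 0" "\<And>\<zeta>. cmod \<zeta> < \<delta>2 \<Longrightarrow> cmod (k2 \<zeta>) \<le> \<eta> * cmod \<zeta>"
    using small[OF hol(2)] unfolding k2_def by blast
  obtain e where e: "e > 0" "ball (x1, x2) e \<subseteq> \<Omega>" using \<Omega> open_contains_ball by metis
  define b where "b = norm (deriv \<psi>1 l0, deriv \<psi>2 l0) + 1"
  have b: "b > 0" unfolding b_def by (simp add: add_nonneg_pos)
  define m where "m = min (min \<delta>1 \<delta>2) (min \<rho> (e / b))"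
  define r where "r = m / 2"
  have "0 < m" "m \<le> \<delta>1" "m \<le> \<delta>2" "m \<le> \<rho>" "m \<le> e / b"
    using \<delta>1(1) \<delta>2(1) \<rho> e(1) b by (auto simp: m_def)
  then have r: "0 < r" "r < \<delta>1" "r < \<delta>2" "r < \<rho>" "r < e / b"
    unfolding r_def by linarith+
  have rb: "r * b < e" using r(5) b by (simp add: field_simps)
  \<comment> \<open>rescaled to the unit disk; its real part is the test function with the remainders replaced by their bound\<close>
  define Hh where "Hh = (\<lambda>\<zeta>::complex. H (l0 + of_real r * \<zeta>) - 2 * \<epsilon> * cnj l0 * (r * \<zeta>)
     - 2 * K * (cnj d1 * k1 (r * \<zeta>) + cnj d2 * k2 (r * \<zeta>))
     + of_real (- \<epsilon> * (cmod l0)\<^sup>2 + K * ((cmod d1)\<^sup>2 + (cmod d2)\<^sup>2) - \<epsilon> * r\<^sup>2 / 2))"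
  have img: "l0 + of_real r * \<zeta> \<in> ball l0 \<rho>" if "\<zeta> \<in> cball 0 1" for \<zeta>
  proof -
    have "r * cmod \<zeta> \<le> r" using that r(1) by (simp add: mult_left_le)
    then have "r * cmod \<zeta> < \<rho>" using r(4) by linarith
    then show ?thesis using r(1) by (simp add: dist_norm norm_mult)
  qed
  have comp: "(\<lambda>\<zeta>. g (l0 + of_real r * \<zeta>)) holomorphic_on cball 0 1" if "g holomorphic_on ball l0 \<rho>" for g
    using img by (intro holomorphic_on_compose_gen[OF _ that, unfolded o_def]) (auto intro!: holomorphic_intros)
  have Hh: "Hh holomorphic_on cball 0 1"
    unfolding Hh_def k1_def k2_def by (intro holomorphic_intros comp hol)
  have "f (x1, x2) \<le> ereal (Re (Hh 0))"
  proof (rule plurisubharmonic_le_Re_center[OF psh, where ?b1.0 = "r * deriv \<psi>1 l0" and ?b2.0 = "r * deriv \<psi>2 l0"])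
    fix \<zeta> :: complex assume z: "cmod \<zeta> \<le> 1"
    have "dist (x1, x2) (x1 + \<zeta> * (r * deriv \<psi>1 l0), x2 + \<zeta> * (r * deriv \<psi>2 l0))
       = norm ((r * \<zeta>) * deriv \<psi>1 l0, (r * \<zeta>) * deriv \<psi>2 l0)"
      by (simp add: dist_norm norm_Pair algebra_simps norm_minus_commute norm_mult)
    also have "\<dots> = cmod (r * \<zeta>) * norm (deriv \<psi>1 l0, deriv \<psi>2 l0)"
      by (simp add: norm_Pair norm_mult power_mult_distrib real_sqrt_mult flip: distrib_left)
    also have "\<dots> \<le> r * b" using r z unfolding b_def norm_mult
      by (intro mult_mono) (auto simp: mult_left_le)
    finally have "dist (x1, x2) (x1 + \<zeta> * (r * deriv \<psi>1 l0), x2 + \<zeta> * (r * deriv \<psi>2 l0)) < e"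
      using rb by simp
    then show "(x1 + \<zeta> * (r * deriv \<psi>1 l0), x2 + \<zeta> * (r * deriv \<psi>2 l0)) \<in> \<Omega>"
      using e(2) by (meson mem_ball subsetD)
  next
    show "continuous_on (cball 0 1) Hh" using Hh by (rule holomorphic_on_imp_continuous_on)
    show "Hh holomorphic_on ball 0 1" using Hh by (rule holomorphic_on_subset) auto
  next
    fix \<zeta> :: complex assume z: "cmod \<zeta> = 1"
    define w where "w = r * \<zeta>"
    have w: "cmod w = r" using z r by (simp add: w_def norm_mult)
    have sq: "(cmod (x - k))\<^sup>2 = (cmod x)\<^sup>2 - 2 * Re (cnj x * k) + (cmod k)\<^sup>2" for x k
      unfolding cmod_power2 by (simp add: power2_eq_square algebra_simps)
    have sq': "(cmod (l0 + w))\<^sup>2 = (cmod l0)\<^sup>2 + 2 * Re (cnj l0 * w) + r\<^sup>2"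
      using sq[of l0 "-w"] w by simp
    have "x1 + w * deriv \<psi>1 l0 - \<psi>1 (l0 + w) = d1 - k1 w" "x2 + w * deriv \<psi>2 l0 - \<psi>2 (l0 + w) = d2 - k2 w"
      by (auto simp: d1_def k1_def d2_def k2_def)
    then have "f (x1 + w * deriv \<psi>1 l0, x2 + w * deriv \<psi>2 l0) \<le>
       ereal (Re (H (l0 + w)) - \<epsilon> * (cmod (l0 + w))\<^sup>2 + K * ((cmod (d1 - k1 w))\<^sup>2 + (cmod (d2 - k2 w))\<^sup>2))"
      using touch[of w] w r by simp
    also have "\<dots> \<le> ereal (Re (Hh \<zeta>))"
    proof -
      have "(cmod (k1 w))\<^sup>2 \<le> (\<eta> * r)\<^sup>2" "(cmod (k2 w))\<^sup>2 \<le> (\<eta> * r)\<^sup>2"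
        using \<delta>1(2)[of w] \<delta>2(2)[of w] w r by (auto intro!: power_mono)
      then have "K * ((cmod (k1 w))\<^sup>2 + (cmod (k2 w))\<^sup>2) \<le> K * (2 * (\<eta> * r)\<^sup>2)"
        using pos by (intro mult_left_mono) auto
      also have "\<dots> = \<epsilon> * r\<^sup>2 / 2" using \<eta>(2) pos by (simp add: power_mult_distrib)
      finally have k: "K * ((cmod (k1 w))\<^sup>2 + (cmod (k2 w))\<^sup>2) \<le> \<epsilon> * r\<^sup>2 / 2" .
      have "Re (Hh \<zeta>) = Re (H (l0 + w)) - 2 * \<epsilon> * Re (cnj l0 * w) - 2 * K * (Re (cnj d1 * k1 w) + Re (cnj d2 * k2 w))
         - \<epsilon> * (cmod l0)\<^sup>2 + K * ((cmod d1)\<^sup>2 + (cmod d2)\<^sup>2) - \<epsilon> * r\<^sup>2 / 2"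
        unfolding Hh_def w_def[symmetric] by (simp add: algebra_simps)
      then show ?thesis
        using k unfolding sq sq' by (simp add: algebra_simps)
    qed
    finally show "f (x1 + \<zeta> * (r * deriv \<psi>1 l0), x2 + \<zeta> * (r * deriv \<psi>2 l0)) \<le> ereal (Re (Hh \<zeta>))"
      by (simp add: w_def algebra_simps)
  qed
  moreover have "Re (Hh 0) = Re (H l0) - \<epsilon> * (cmod l0)\<^sup>2 + K * ((cmod d1)\<^sup>2 + (cmod d2)\<^sup>2) - \<epsilon> * r\<^sup>2 / 2"
    by (simp add: Hh_def k1_def k2_def)
  moreover have "\<epsilon> * r\<^sup>2 > 0" using pos r by simp
  ultimately show False using touch0 by (simp add: d1_def d2_def)
qed

lemma holomorphic_locally_lipschitz:
  assumes "\<psi> holomorphic_on ball 0 1" "c \<in> ball 0 1"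
  obtains L \<delta> where "L \<ge> 0" "\<delta> > 0" "\<And>l. cmod (l - c) < \<delta> \<Longrightarrow> cmod (\<psi> l - \<psi> c) \<le> L * cmod (l - c)"
proof -
  have "(\<psi> has_field_derivative deriv \<psi> c) (at c)"
    using assms by (intro holomorphic_derivI[OF assms(1)]) auto
  then obtain \<delta> where \<delta>: "\<delta> > 0" "\<And>y. norm (y - c) < \<delta> \<Longrightarrow>
       norm (\<psi> y - \<psi> c - deriv \<psi> c * (y - c)) \<le> 1 * norm (y - c)"
    using zero_less_one[where 'a=real] unfolding has_field_derivative_def has_derivative_at_alt by blast
  show thesis
  proof (rule that[of "cmod (deriv \<psi> c) + 1" \<delta>])
    fix l assume l: "cmod (l - c) < \<delta>"
    have "cmod (\<psi> l - \<psi> c) \<le> cmod (\<psi> l - \<psi> c - deriv \<psi> c * (l - c)) + cmod (deriv \<psi> c * (l - c))"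
      by (metis diff_add_cancel norm_triangle_ineq)
    also have "\<dots> \<le> 1 * cmod (l - c) + cmod (deriv \<psi> c) * cmod (l - c)"
      using \<delta>(2)[OF l] by (simp add: norm_mult)
    finally show "cmod (\<psi> l - \<psi> c) \<le> (cmod (deriv \<psi> c) + 1) * cmod (l - c)"
      by (simp add: algebra_simps)
  qed (use \<delta> in auto)
qed

text \<open>
  Transports the pole estimate to the neighbourhood of an analytic disk: for \<open>l\<close> within \<open>k m\<close> of the
  preimage of the pole, a perturbation of size \<open>m\<close> changes the bound \<open>ln m\<close> only by a constant.
\<close>

lemma pole_estimate_along_disc:
  assumes psh: "plurisubharmonic_on bidisk f" and pole: "log_pole f P" and P: "P \<in> bidisk"
    and hol: "\<psi>1 holomorphic_on ball 0 1" "\<psi>2 holomorphic_on ball 0 1"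
    and c: "c \<in> ball 0 1" "P = (\<psi>1 c, \<psi>2 c)"
  obtains \<delta> C where "\<delta> > 0"
    "\<And>m l d. \<lbrakk>0 < m; m < \<delta>; cmod (l - c) \<le> k * m; norm d \<le> m\<rbrakk> \<Longrightarrow>
        f ((\<psi>1 l, \<psi>2 l) + d) \<le> ereal (ln m + C)"
proof -
  obtain r C where C: "0 < r" "\<And>\<rho> x. \<lbrakk>0 < \<rho>; \<rho> \<le> r; dist x P \<le> \<rho>\<rbrakk> \<Longrightarrow> f x \<le> ereal (ln \<rho> + C)"
    by (rule log_pole_bound_ball[OF psh pole P]) blast
  obtain L1 \<delta>1 where 1: "L1 \<ge> 0" "\<delta>1 > 0"
    "\<And>l. cmod (l - c) < \<delta>1 \<Longrightarrow> cmod (\<psi>1 l - \<psi>1 c) \<le> L1 * cmod (l - c)"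
    by (rule holomorphic_locally_lipschitz[OF hol(1) c(1)]) blast
  obtain L2 \<delta>2 where 2: "L2 \<ge> 0" "\<delta>2 > 0" "\<And>l. cmod (l - c) < \<delta>2 \<Longrightarrow> cmod (\<psi>2 l - \<psi>2 c) \<le> L2 * cmod (l - c)"
    by (rule holomorphic_locally_lipschitz[OF hol(2) c(1)]) blast
  define A where "A = (L1 + L2) * \<bar>k\<bar> + 1"
  have A: "A > 0" using 1 2 by (simp add: A_def add_nonneg_pos)
  define \<delta> where "\<delta> = min (r / A) (min (\<delta>1 / (\<bar>k\<bar> + 1)) (\<delta>2 / (\<bar>k\<bar> + 1)))"
  show thesis
  proof (rule that)
    show "\<delta> > 0" using C(1) A 1 2 by (auto simp: \<delta>_def)
    fix m l and d :: "complex \<times> complex"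
    assume m: "0 < m" "m < \<delta>" and l: "cmod (l - c) \<le> k * m" and d: "norm d \<le> m"
    have "m < r / A" "m < \<delta>1 / (\<bar>k\<bar> + 1)" "m < \<delta>2 / (\<bar>k\<bar> + 1)"
      using m by (auto simp: \<delta>_def)
    then have mA: "m * A < r" and m1: "m * (\<bar>k\<bar> + 1) < \<delta>1" and m2: "m * (\<bar>k\<bar> + 1) < \<delta>2"
      using A by (auto simp: field_simps)
    have kk: "k * m \<le> \<bar>k\<bar> * m" using m by (intro mult_right_mono) auto
    have "m * (\<bar>k\<bar> + 1) = \<bar>k\<bar> * m + m" by (simp add: algebra_simps)
    then have "cmod (l - c) < \<delta>1" and "cmod (l - c) < \<delta>2"
      using kk l m1 m2 m(1) by (simp_all only:)
    then have "cmod (\<psi>1 l - \<psi>1 c) \<le> L1 * (\<bar>k\<bar> * m)" "cmod (\<psi>2 l - \<psi>2 c) \<le> L2 * (\<bar>k\<bar> * m)"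
      using 1 2 l kk by (meson mult_left_mono order_trans)+
    moreover have "dist ((\<psi>1 l, \<psi>2 l) + d) P \<le> norm (\<psi>1 l - \<psi>1 c, \<psi>2 l - \<psi>2 c) + norm d"
    proof -
      have "(\<psi>1 l, \<psi>2 l) + d - P = (\<psi>1 l - \<psi>1 c, \<psi>2 l - \<psi>2 c) + d"
        by (simp add: c(2) prod_eq_iff)
      then show ?thesis unfolding dist_norm by (metis norm_triangle_ineq)
    qed
    moreover have "norm (\<psi>1 l - \<psi>1 c, \<psi>2 l - \<psi>2 c) \<le> cmod (\<psi>1 l - \<psi>1 c) + cmod (\<psi>2 l - \<psi>2 c)"
      using sqrt_sum_squares_le_sum[of "cmod (\<psi>1 l - \<psi>1 c)" "cmod (\<psi>2 l - \<psi>2 c)"]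
      by (simp add: norm_Pair)
    ultimately have "dist ((\<psi>1 l, \<psi>2 l) + d) P \<le> m * A"
      using d by (simp add: A_def algebra_simps)
    then have "f ((\<psi>1 l, \<psi>2 l) + d) \<le> ereal (ln (m * A) + C)"
      using C(2)[of "m * A"] mA m A by simp
    then show "f ((\<psi>1 l, \<psi>2 l) + d) \<le> ereal (ln m + (ln A + C))"
      using m A by (simp add: ln_mult add.assoc)
  qed
qed

text \<open>
  Suppose the bound fails at \<open>l\<close>.  Replacing \<open>ln |G|\<close>, \<open>G\<close> the Blaschke product with zeros \<open>c\<close> and \<open>a\<close>,
  by \<open>h = \<delta> ln |G| + \<epsilon> (1 - |l|\<^sup>2)\<close> with \<open>\<delta> < 1\<close> and a small \<open>\<epsilon> > 0\<close> keeps the failure, makes \<open>h\<close>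
  strictly superharmonic off the zeros and lets the poles of \<open>f\<close> dominate \<open>h\<close> there.  The parameters
  are restricted to the compact set \<open>m \<le> |G| \<le> \<kappa>\<close>, and points are written \<open>\<psi> l + d\<close> with
  \<open>|d| \<le> \<eta>\<close>.  The maximum of \<open>f - h - K |d|\<^sup>2\<close> is positive, and it is not attained on the boundary:
  near \<open>|G| = m\<close> the poles make \<open>f - h\<close> nonpositive, near \<open>|G| = \<kappa>\<close> it is too small since \<open>f < 0\<close> and
  \<open>h\<close> is close to \<open>0\<close>, and for \<open>|d| = \<eta>\<close> the penalty \<open>K\<close> prevails.  An interior maximum is excluded by
  \<open>viscosity_touching\<close>.
\<close>

lemma plurisubharmonic_disc_bound:
  assumes psh: "plurisubharmonic_on bidisk f" and neg: "\<And>y. y \<in> bidisk \<Longrightarrow> f y < 0"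
    and poles: "log_pole f P" "log_pole f Q"
    and hol: "\<psi>1 holomorphic_on ball 0 1" "\<psi>2 holomorphic_on ball 0 1"
    and into: "\<And>l. cmod l < 1 \<Longrightarrow> (\<psi>1 l, \<psi>2 l) \<in> bidisk"
    and ca: "cmod c < 1" "cmod a < 1" "c \<noteq> a" "P = (\<psi>1 c, \<psi>2 c)" "Q = (\<psi>1 a, \<psi>2 a)"
    and l: "cmod l < 1" "l \<noteq> c" "l \<noteq> a"
  shows "f (\<psi>1 l, \<psi>2 l) \<le> ereal (ln (cmod (disk_aut c l * disk_aut a l)))"
proof (rule ccontr)
  define G where "G = (\<lambda>l. disk_aut c l * disk_aut a l)"
  assume "\<not> ?thesis"
  then have gt: "ereal (ln (cmod (G l))) < f (\<psi>1 l, \<psi>2 l)" by (simp add: G_def not_le)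
  have "f (\<psi>1 l, \<psi>2 l) < 0" using neg into l by blast
  then obtain v where v: "f (\<psi>1 l, \<psi>2 l) = ereal v" "v < 0"
    using gt by (cases "f (\<psi>1 l, \<psi>2 l)") auto
  have Gl: "G l \<noteq> 0" "cmod (G l) < 1"
    using l ca cmod_disk_aut_less_1[of c l] cmod_disk_aut_less_1[of a l]
    by (auto simp: G_def disk_aut_eq_0_iff norm_mult intro: mult_le_less_imp_less[of _ 1 _ 1, simplified]
        mult_less_le_imp_less) (metis less_eq_real_def mult_left_le mult_less_cancel_right2 norm_ge_zero order_le_less_trans)
  define \<Lambda> where "\<Lambda> = ln (cmod (G l))"
  have \<Lambda>: "\<Lambda> < v" "\<Lambda> < 0" using gt v by (auto simp: \<Lambda>_def)
  define q where "q = v / \<Lambda>"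
  \<comment> \<open>strictly between \<open>v / \<Lambda>\<close> and \<open>1\<close>, so that \<open>\<delta> \<Lambda> < v\<close> still holds\<close>
  define \<delta> where "\<delta> = (q + 1) / 2"
  have q: "q < 1" "0 < q" using \<Lambda> v(2) by (auto simp: q_def divide_less_eq zero_less_divide_iff)
  have \<delta>: "0 < \<delta>" "\<delta> < 1" "q < \<delta>" using q by (auto simp: \<delta>_def)
  have M0: "0 < v - \<delta> * \<Lambda>" using \<delta>(3) \<Lambda> by (simp add: q_def divide_less_eq)
  define \<epsilon> where "\<epsilon> = (v - \<delta> * \<Lambda>) / 2"
  define M where "M = \<epsilon>"
  have \<epsilon>: "0 < \<epsilon>" using M0 by (simp add: \<epsilon>_def)
  define h where "h = (\<lambda>l. \<delta> * ln (cmod (G l)) + \<epsilon> * (1 - (cmod l)\<^sup>2))"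
  have M: "M \<le> v - h l"
  proof -
    have "\<epsilon> * (1 - (cmod l)\<^sup>2) \<le> \<epsilon> * 1" using \<epsilon> by (intro mult_left_mono) auto
    then have "h l \<le> \<delta> * \<Lambda> + \<epsilon>" by (simp add: h_def \<Lambda>_def)
    moreover have "v - \<delta> * \<Lambda> = 2 * \<epsilon>" by (simp add: \<epsilon>_def)
    ultimately show ?thesis unfolding M_def by linarith
  qed
  have P: "P \<in> bidisk" and Q: "Q \<in> bidisk" using ca into by auto
  \<comment> \<open>\<open>|G x| = m\<close> gives \<open>|x - c| |x - a| \<le> 4 m\<close>, and the larger factor is at least \<open>|c - a| / 2\<close>\<close>
  define k where "k = 8 / cmod (c - a)"
  obtain \<delta>1 C1 where 1: "\<delta>1 > 0"
    "\<And>m l d. \<lbrakk>0 < m; m < \<delta>1; cmod (l - c) \<le> k * m; norm d \<le> m\<rbrakk> \<Longrightarrow>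
        f ((\<psi>1 l, \<psi>2 l) + d) \<le> ereal (ln m + C1)"
    by (rule pole_estimate_along_disc[OF psh poles(1) P hol _ ca(4)]) (use ca in simp, blast)
  obtain \<delta>2 C2 where 2: "\<delta>2 > 0"
    "\<And>m l d. \<lbrakk>0 < m; m < \<delta>2; cmod (l - a) \<le> k * m; norm d \<le> m\<rbrakk> \<Longrightarrow>
        f ((\<psi>1 l, \<psi>2 l) + d) \<le> ereal (ln m + C2)"
    by (rule pole_estimate_along_disc[OF psh poles(2) Q hol _ ca(5)]) (use ca in simp, blast)
  define C where "C = max C1 C2"
  \<comment> \<open>the last entry makes \<open>(1 - \<delta>) ln m + C \<le> 0\<close>; the entry \<open>|G l|\<close> keeps \<open>l\<close> inside the compact set\<close>
  define m where "m = min (min (\<delta>1 / 2) (\<delta>2 / 2)) (min (cmod (G l)) (exp (- \<bar>C\<bar> / (1 - \<delta>))))"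
  have m: "0 < m" "m < \<delta>1" "m < \<delta>2" "m \<le> cmod (G l)" "m \<le> exp (- \<bar>C\<bar> / (1 - \<delta>))"
    using 1(1) 2(1) Gl by (auto simp: m_def min_def)
  have m1: "m < 1" using m(4) Gl(2) by simp
  define \<kappa> where "\<kappa> = max (cmod (G l)) (exp (- M))"
  have \<kappa>: "0 < \<kappa>" "\<kappa> < 1" "cmod (G l) \<le> \<kappa>" "- ln \<kappa> \<le> M"
  proof -
    show "0 < \<kappa>" "\<kappa> < 1" "cmod (G l) \<le> \<kappa>" using Gl \<epsilon> by (auto simp: \<kappa>_def M_def less_max_iff_disj)
    have "ln (exp (- M)) \<le> ln \<kappa>" by (intro ln_mono) (auto simp: \<kappa>_def less_max_iff_disj)
    then show "- ln \<kappa> \<le> M" by simp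
  qed
  have contG: "continuous_on (cball 0 1) G"
    unfolding G_def using ca by (intro continuous_intros holomorphic_on_imp_continuous_on disk_aut_holomorphic)
  define T where "T = {x \<in> cball 0 1. cmod (G x) \<in> {m..\<kappa>}}"
  have "T = cball 0 1 \<inter> (\<lambda>x. cmod (G x)) -` {m..\<kappa>}" by (auto simp: T_def)
  then have "closed T"
    by (simp add: continuous_closed_preimage[OF continuous_on_norm[OF contG]])
  moreover have "bounded T" by (rule bounded_subset[of "cball 0 1"]) (auto simp: T_def)
  ultimately have T: "compact T" by (simp add: compact_eq_bounded_closed)
  have Tball: "T \<subseteq> ball 0 1"
  proof
    fix x assume x: "x \<in> T"
    have "cmod x \<noteq> 1"
    proof
      assume "cmod x = 1"
      then have "cmod (G x) = 1" using ca cmod_disk_aut_eq_1 by (simp add: G_def norm_mult)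
      then show False using x \<kappa>(2) by (simp add: T_def)
    qed
    then show "x \<in> ball 0 1" using x by (simp add: T_def)
  qed
  define \<Psi> where "\<Psi> = (\<lambda>l. (\<psi>1 l, \<psi>2 l))"
  have cont\<Psi>: "continuous_on (ball 0 1) \<Psi>"
    unfolding \<Psi>_def by (intro continuous_on_Pair holomorphic_on_imp_continuous_on hol)
  have cont\<Psi>T: "continuous_on T \<Psi>" using cont\<Psi> Tball by (rule continuous_on_subset)
  have "\<Psi> ` T \<subseteq> bidisk" using Tball into by (auto simp: \<Psi>_def)
  then obtain e where e: "0 < e" "(\<Union>x\<in>\<Psi> ` T. ball x e) \<subseteq> bidisk"
    using compact_subset_open_imp_ball_epsilon_subset[OF compact_continuous_image[OF cont\<Psi>T T] bidisk_open]
    by blast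
  define \<eta> where "\<eta> = min m (e / 2)"
  have \<eta>: "0 < \<eta>" "\<eta> \<le> m" "\<eta> < e" using m(1) e(1) by (auto simp: \<eta>_def)
  have in_bidisk: "\<Psi> x + d \<in> bidisk" if "x \<in> T" "norm d \<le> \<eta>" for x d
  proof -
    have "dist (\<Psi> x) (\<Psi> x + d) < e" using that \<eta> by (simp add: dist_norm)
    then have "\<Psi> x + d \<in> ball (\<Psi> x) e" unfolding mem_ball .
    then show ?thesis using e(2) that(1) by blast
  qed
  \<comment> \<open>the penalty at \<open>|d| = \<eta>\<close> is \<open>- ln m\<close>, which outweighs \<open>- h \<le> - ln m\<close>\<close>
  define K where "K = - ln m / \<eta>\<^sup>2"
  have "ln m < 0" using m m1 by simp
  then have K: "0 < K" "K * \<eta>\<^sup>2 = - ln m" using \<eta>(1) by (auto simp: K_def divide_neg_pos)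
  define S where "S = T \<times> cball (0 :: complex \<times> complex) \<eta>"
  define X where "X = (\<lambda>(x, d). \<Psi> x + d)"
  define kf where "kf = (\<lambda>(x, d :: complex \<times> complex). h x + K * (norm d)\<^sup>2)"
  have Gnz: "G x \<noteq> 0" if "x \<in> T" for x using that m(1) by (auto simp: T_def)
  have conth: "continuous_on T h"
  proof -
    have "continuous_on T G" by (rule continuous_on_subset[OF contG]) (auto simp: T_def)
    then show ?thesis unfolding h_def using Gnz by (intro continuous_intros) auto
  qed
  have contX: "continuous_on S X" unfolding S_def X_def case_prod_beta
    by (intro continuous_intros continuous_on_compose2[OF cont\<Psi>T]) auto
  have contk: "continuous_on S kf" unfolding S_def kf_def case_prod_beta
    by (intro continuous_intros continuous_on_compose2[OF conth]) auto
  have XS: "X y \<in> bidisk" if "y \<in> S" for y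
    using that in_bidisk by (auto simp: S_def X_def)
  have lS: "(l, 0) \<in> S" using l m \<kappa> \<eta> by (auto simp: S_def T_def)
  obtain y0 where y0: "y0 \<in> S" "\<And>y. y \<in> S \<Longrightarrow> f (X y) - ereal (kf y) \<le> f (X y0) - ereal (kf y0)"
  proof (rule upper_semicontinuous_attains_max[of S "\<lambda>y. f (X y) - ereal (kf y)"])
    show "compact S" unfolding S_def using T by (intro compact_Times) auto
    show "S \<noteq> {}" using lS by blast
    show "\<exists>U. open U \<and> x \<in> U \<and> (\<forall>y\<in>U \<inter> S. f (X y) - ereal (kf y) < t)"
      if "x \<in> S" "f (X x) - ereal (kf x) < t" for x t
      by (rule usc_minus_continuous[OF psh bidisk_open contX XS contk that])
  qed blast
  obtain l0 d0 where ld: "y0 = (l0, d0)" by (cases y0)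
  have l0: "l0 \<in> T" "norm d0 \<le> \<eta>" using y0(1) by (auto simp: ld S_def)
  have ge: "ereal (v - h l) \<le> f (\<Psi> l0 + d0) - ereal (kf y0)"
    using y0(2)[OF lS] by (simp add: X_def kf_def ld \<Psi>_def v)
  have "f (\<Psi> l0 + d0) < 0" using neg in_bidisk l0 by blast
  then obtain v0 where v0: "f (\<Psi> l0 + d0) = ereal v0" "v0 < 0"
    using ge by (cases "f (\<Psi> l0 + d0)") auto
  define V where "V = v0 - h l0 - K * (norm d0)\<^sup>2"
  have VM: "M \<le> V" using ge M by (simp add: v0 V_def kf_def ld)
  have V0: "0 < V" using VM \<epsilon> by (simp add: M_def)
  have hge: "\<delta> * ln (cmod (G l0)) \<le> h l0"
    using \<epsilon> l0(1) Tball by (auto simp: h_def power_le_one)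
  have Gl0: "m \<le> cmod (G l0)" "cmod (G l0) \<le> \<kappa>" using l0(1) by (auto simp: T_def)
  have \<delta>ln: "ln x \<le> \<delta> * ln x" if "0 < x" "x < 1" for x
    using mult_right_mono_neg[of \<delta> 1 "ln x"] \<delta> that by simp
  have lnG: "ln m \<le> ln (cmod (G l0))" using Gl0(1) m(1) by (intro ln_mono) auto
  have A1: "norm d0 < \<eta>"
  proof (rule ccontr)
    assume "\<not> norm d0 < \<eta>"
    then have "norm d0 = \<eta>" using l0(2) by simp
    then have "v0 = V + h l0 - ln m" using K by (simp add: V_def)
    moreover have "ln m \<le> h l0"
      using hge lnG \<delta>ln[OF m(1) m1] mult_left_mono[OF lnG, of \<delta>] \<delta>(1) by linarith
    ultimately show False using V0 v0(2) by linarith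
  qed
  have A2: "cmod (G l0) < \<kappa>"
  proof (rule ccontr)
    assume "\<not> cmod (G l0) < \<kappa>"
    then have "cmod (G l0) = \<kappa>" using Gl0 by simp
    then have "ln \<kappa> \<le> h l0" using hge \<delta>ln[OF \<kappa>(1,2)] by simp
    moreover have "0 \<le> K * (norm d0)\<^sup>2" using K by simp
    ultimately show False using VM v0(2) \<kappa>(4) V_def by linarith
  qed
  have A3: "m < cmod (G l0)"
  proof (rule ccontr)
    assume "\<not> m < cmod (G l0)"
    then have Gm: "cmod (G l0) = m" using Gl0 by simp
    have n0: "cmod l0 \<le> 1" using l0 by (simp add: T_def)
    have prod: "cmod (l0 - c) * cmod (l0 - a) \<le> 4 * m"
      using mult_mono[OF dist_le_disk_aut[OF ca(1) n0] dist_le_disk_aut[OF ca(2) n0]] Gm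
      by (simp add: G_def norm_mult)
    have tri: "cmod (c - a) \<le> cmod (l0 - c) + cmod (l0 - a)"
      by (metis norm_minus_commute norm_triangle_sub norm_triangle_ineq4 diff_diff_eq2 diff_add_cancel
            add.commute dist_norm dist_triangle2 dist_commute)
    have cpos: "0 < cmod (c - a)" using ca(3) by simp
    have near: "x \<le> k * m" if "x \<le> y" "x * y \<le> 4 * m" "cmod (c - a) \<le> x + y" "0 \<le> x" for x y
    proof -
      have "x * (cmod (c - a) / 2) \<le> x * y" using that by (intro mult_left_mono) auto
      then have "x * cmod (c - a) \<le> 8 * m" using that by simp
      then show ?thesis using cpos by (simp add: k_def field_simps)
    qed
    have "v0 \<le> ln m + C"
    proof (cases "cmod (l0 - c) \<le> cmod (l0 - a)")
      case True
      have "cmod (l0 - c) \<le> k * m" by (rule near[OF True prod tri]) simp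
      then have "f (\<Psi> l0 + d0) \<le> ereal (ln m + C1)"
        using 1(2)[of m l0 d0] m l0(2) \<eta> by (simp add: \<Psi>_def)
      then show ?thesis by (simp add: v0 C_def)
    next
      case False
      have "cmod (l0 - a) \<le> k * m" by (rule near[of _ "cmod (l0 - c)"]) (use False prod tri in \<open>auto simp: mult.commute\<close>)
      then have "f (\<Psi> l0 + d0) \<le> ereal (ln m + C2)"
        using 2(2)[of m l0 d0] m l0(2) \<eta> by (simp add: \<Psi>_def)
      then show ?thesis by (simp add: v0 C_def)
    qed
    moreover have "0 \<le> K * (norm d0)\<^sup>2" using K by simp
    moreover have "ln m \<le> - \<bar>C\<bar> / (1 - \<delta>)" using m(1,5) by (metis ln_exp ln_mono)
    then have "(1 - \<delta>) * ln m \<le> - \<bar>C\<bar>" 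
      using \<delta> pos_le_divide_eq[of "1 - \<delta>" "ln m" "- \<bar>C\<bar>"] by (simp only: mult.commute)
    then have "ln m - \<delta> * ln m \<le> - \<bar>C\<bar>" by (simp add: algebra_simps)
    ultimately show False using V0 hge unfolding V_def Gm by linarith
  qed
  define x1 where "x1 = fst (\<Psi> l0 + d0)"
  define x2 where "x2 = snd (\<Psi> l0 + d0)"
  have x: "\<Psi> l0 + d0 = (x1, x2)" unfolding x1_def x2_def by (rule prod.collapse[symmetric])
  define dd where "dd = (\<lambda>x. (x1 + (x - l0) * deriv \<psi>1 l0 - \<psi>1 x, x2 + (x - l0) * deriv \<psi>2 l0 - \<psi>2 x))"
  have contdd: "continuous_on (ball 0 1) (\<lambda>x. norm (dd x))"
    unfolding dd_def by (intro continuous_intros holomorphic_on_imp_continuous_on hol)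
  have contG': "continuous_on (ball 0 1) (\<lambda>x. cmod (G x))"
    by (intro continuous_on_norm continuous_on_subset[OF contG]) auto
  define U where "U = (ball 0 1 \<inter> (\<lambda>x. cmod (G x)) -` {m<..<\<kappa>}) \<inter> (ball 0 1 \<inter> (\<lambda>x. norm (dd x)) -` {..<\<eta>})"
  have "open U"
    unfolding U_def by (intro open_Int continuous_open_preimage contdd contG') auto
  have dd0: "dd l0 = d0" using x by (auto simp: dd_def \<Psi>_def prod_eq_iff)
  have "l0 \<in> U" using A1 A2 A3 l0 Tball dd0 by (auto simp: U_def)
  then obtain \<rho> where \<rho>: "0 < \<rho>" "ball l0 \<rho> \<subseteq> U" using \<open>open U\<close> open_contains_ball by metis
  have Uball: "U \<subseteq> ball 0 1" by (auto simp: U_def)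
  have holG: "G holomorphic_on ball l0 \<rho>"
    unfolding G_def using ca \<rho>(2) Uball
    by (intro holomorphic_intros holomorphic_on_subset[OF disk_aut_holomorphic]) auto
  have nzG: "G x \<noteq> 0" if "x \<in> ball l0 \<rho>" for x using that \<rho>(2) m(1) by (force simp: U_def)
  have l0b: "l0 \<in> ball l0 \<rho>" using \<rho>(1) by simp
  obtain Lg where Lg: "Lg holomorphic_on ball l0 \<rho>" "\<And>x. x \<in> ball l0 \<rho> \<Longrightarrow> exp (Lg x) = G x"
    by (rule holomorphic_logarithm_exists[OF convex_ball open_ball holG nzG l0b]) blast+
  have Re_Lg: "Re (Lg x) = ln (cmod (G x))" if "x \<in> ball l0 \<rho>" for x
    using Lg(2)[OF that] by (metis ln_exp norm_exp_eq_Re)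
  define H where "H = (\<lambda>x. of_real \<delta> * Lg x + of_real (\<epsilon> + V))"
  have ReH: "Re (H x) - \<epsilon> * (cmod x)\<^sup>2 = V + h x" if "x \<in> ball l0 \<rho>" for x
    using Re_Lg[OF that] by (simp add: H_def h_def algebra_simps)
  have nd: "(norm (dd x))\<^sup>2 = (cmod (x1 + (x - l0) * deriv \<psi>1 l0 - \<psi>1 x))\<^sup>2 + (cmod (x2 + (x - l0) * deriv \<psi>2 l0 - \<psi>2 x))\<^sup>2" for x
    by (simp add: dd_def norm_Pair)
  show False
  proof (rule viscosity_touching[OF psh bidisk_open _ \<rho>(1), of x1 x2 \<psi>1 l0 \<psi>2 H \<epsilon> K])
    show "(x1, x2) \<in> bidisk" using x in_bidisk l0 by metis
    show "\<psi>1 holomorphic_on ball l0 \<rho>" "\<psi>2 holomorphic_on ball l0 \<rho>"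
      using hol \<rho>(2) Uball by (meson holomorphic_on_subset order_trans)+
    show "H holomorphic_on ball l0 \<rho>" unfolding H_def by (intro holomorphic_intros Lg)
    show "0 < \<epsilon>" "0 < K" by fact+
    show "f (x1, x2) = ereal (Re (H l0) - \<epsilon> * (cmod l0)\<^sup>2 + K * ((cmod (x1 - \<psi>1 l0))\<^sup>2 + (cmod (x2 - \<psi>2 l0))\<^sup>2))"
      using ReH[of l0] \<rho>(1) nd[of l0] dd0 x v0 by (simp add: V_def)
    fix \<zeta> assume z: "cmod \<zeta> < \<rho>"
    define y where "y = l0 + \<zeta>"
    have y: "y \<in> ball l0 \<rho>" using z by (simp add: y_def dist_norm)
    then have "y \<in> U" using \<rho>(2) by blast
    then have "(y, dd y) \<in> S" by (auto simp: U_def S_def T_def)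
    from y0(2)[OF this] have "f (\<Psi> y + dd y) - ereal (h y + K * (norm (dd y))\<^sup>2) \<le> ereal V"
      by (simp add: X_def kf_def ld v0 V_def diff_diff_eq)
    then have "f (\<Psi> y + dd y) \<le> ereal (V + h y + K * (norm (dd y))\<^sup>2)"
      by (cases "f (\<Psi> y + dd y)") auto
    moreover have "\<Psi> y + dd y = (x1 + \<zeta> * deriv \<psi>1 l0, x2 + \<zeta> * deriv \<psi>2 l0)"
      by (simp add: \<Psi>_def dd_def y_def)
    ultimately show "f (x1 + \<zeta> * deriv \<psi>1 l0, x2 + \<zeta> * deriv \<psi>2 l0) \<le>
         ereal (Re (H (l0 + \<zeta>)) - \<epsilon> * (cmod (l0 + \<zeta>))\<^sup>2
           + K * ((cmod (x1 + \<zeta> * deriv \<psi>1 l0 - \<psi>1 (l0 + \<zeta>)))\<^sup>2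
                + (cmod (x2 + \<zeta> * deriv \<psi>2 l0 - \<psi>2 (l0 + \<zeta>)))\<^sup>2))"
      using ReH[OF y] nd[of y] by (simp add: y_def)
  qed
qed

section \<open>The logarithm of the modulus of a holomorphic function\<close>

text \<open>
  The logarithm with value \<open>-\<infinity>\<close> at \<open>0\<close>, where \<open>ln\<close> has the value \<open>0\<close>.
\<close>

definition elog :: "real \<Rightarrow> ereal" where
  "elog x = (if x \<le> 0 then -\<infinity> else ereal (ln x))"

lemma elog_less_iff: "elog x < ereal t \<longleftrightarrow> x < exp t"
proof (cases "x \<le> 0")
  case True
  then show ?thesis using le_less_trans[OF True exp_gt_zero] by (simp add: elog_def)
next
  case False
  then have "ln x < t \<longleftrightarrow> x < exp t" by (metis exp_less_cancel_iff exp_ln not_le)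
  then show ?thesis using False by (simp add: elog_def)
qed

lemma tendsto_elog:
  assumes "(X \<longlongrightarrow> x) F" "0 \<le> x" "\<And>y. 0 \<le> X y"
  shows "((\<lambda>y. elog (X y)) \<longlongrightarrow> elog x) F"
proof (rule order_tendstoI)
  fix a assume a: "a < elog x"
  then have x: "x > 0" by (auto simp: elog_def split: if_splits)
  then have "((\<lambda>y. ereal (ln (X y))) \<longlongrightarrow> ereal (ln x)) F"
    using assms(1) by (intro tendsto_intros) auto
  moreover have "a < ereal (ln x)" using a x by (simp add: elog_def)
  ultimately have "\<forall>\<^sub>F y in F. a < ereal (ln (X y))" by (rule order_tendstoD(1))
  moreover have "\<forall>\<^sub>F y in F. 0 < X y" using assms(1) x by (rule order_tendstoD(1))
  ultimately show "\<forall>\<^sub>F y in F. a < elog (X y)"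
    by eventually_elim (simp add: elog_def)
next
  fix a assume "elog x < a"
  then obtain t where t: "elog x < ereal t" "ereal t < a" using ereal_dense2 by blast
  then have "\<forall>\<^sub>F y in F. X y < exp t" using assms(1) by (intro order_tendstoD(2)) (auto simp: elog_less_iff)
  then show "\<forall>\<^sub>F y in F. elog (X y) < a"
    by eventually_elim (use t in \<open>auto simp: elog_less_iff[symmetric] intro: less_trans\<close>)
qed

text \<open>
  Multiplication by inverse Blaschke factors: a zero \<open>a\<close> of the disk is replaced by the zero
  \<open>1 / cnj a\<close>.  This does not change the modulus on the circle and can only increase it at \<open>0\<close>, so
  Jensen's inequality reduces to functions without zeros in the disk.
\<close>

lemma poly_reflect_zeros_out_of_disc:
  fixes N :: "complex poly"
  assumes "N \<noteq> 0"
  obtains G :: "complex poly" where "\<And>x. cmod x < 1 \<Longrightarrow> poly G x \<noteq> 0"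
    "\<And>x. cmod x = 1 \<Longrightarrow> cmod (poly G x) = cmod (poly N x)" "cmod (poly N 0) \<le> cmod (poly G 0)"
proof -
  have "\<exists>G. (\<forall>x. cmod x < 1 \<longrightarrow> poly G x \<noteq> 0) \<and> (\<forall>x. cmod x = 1 \<longrightarrow> cmod (poly G x) = cmod (poly N x))
     \<and> cmod (poly N 0) \<le> cmod (poly G 0)"
    using assms
  proof (induction "degree N" arbitrary: N rule: less_induct)
    case less
    show ?case
    proof (cases "\<exists>a. cmod a < 1 \<and> poly N a = 0")
      case False
      then show ?thesis by (intro exI[of _ N]) auto
    next
      case True
      then obtain a where a: "cmod a < 1" "poly N a = 0" by blast
      then have "[:- a, 1:] dvd N" by (simp add: poly_eq_0_iff_dvd)
      then obtain N' where N': "N = [:- a, 1:] * N'" by (rule dvdE)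
      have "N' \<noteq> 0" using less.prems N' by auto
      then have "degree N' < degree N" unfolding N' by (subst degree_mult_eq) auto
      then obtain G where G: "\<And>x. cmod x < 1 \<Longrightarrow> poly G x \<noteq> 0"
        "\<And>x. cmod x = 1 \<Longrightarrow> cmod (poly G x) = cmod (poly N' x)" "cmod (poly N' 0) \<le> cmod (poly G 0)"
        using less.hyps[OF _ \<open>N' \<noteq> 0\<close>] by blast
      show ?thesis
      proof (intro exI[of _ "[:1, - cnj a:] * G"] conjI allI impI)
        fix x assume "cmod x < 1"
        then show "poly ([:1, - cnj a:] * G) x \<noteq> 0"
          using G(1)[of x] disk_aut_denominator_nz[of a x] a by (auto simp: algebra_simps)
      next
        fix x assume x: "cmod x = 1"
        have "cmod (disk_aut a x) = 1" by (rule cmod_disk_aut_eq_1[OF a(1) x])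
        then have "cmod (a - x) = cmod (1 - cnj a * x)"
          by (auto simp: disk_aut_def norm_divide divide_eq_1_iff)
        then show "cmod (poly ([:1, - cnj a:] * G) x) = cmod (poly N x)"
        proof -
          have "poly ([:1, - cnj a:] * G) x = (1 - cnj a * x) * poly G x" by (simp add: algebra_simps)
          moreover have "poly ([:- a, 1:] * N') x = (x - a) * poly N' x" by (simp add: algebra_simps)
          ultimately show ?thesis
            using \<open>cmod (a - x) = cmod (1 - cnj a * x)\<close> G(2)[OF x] unfolding N'
            by (simp only: norm_mult norm_minus_commute[of x a])
        qed
      next
        have "cmod a * cmod (poly N' 0) \<le> 1 * cmod (poly G 0)"
          using a G(3) by (intro mult_mono) auto
        then show "cmod (poly N 0) \<le> cmod (poly ([:1, - cnj a:] * G) 0)"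
          unfolding N' by (simp add: norm_mult)
      qed
    qed
  qed
  then show thesis using that by blast
qed

text \<open>
  On circles of radius below \<open>1\<close> the mean value property of the real part of a logarithm of \<open>G\<close> gives
  equality.  Since \<open>- ln |G| \<ge> 0\<close>, Fatou's lemma yields the inequality in the limit, also when \<open>G\<close> has
  zeros on the unit circle.
\<close>

lemma elog_le_circle_mean_zero_free:
  assumes hol: "G holomorphic_on ball 0 1" and cont: "continuous_on (cball 0 1) G"
    and nz: "\<And>x. cmod x < 1 \<Longrightarrow> G x \<noteq> 0" and le: "\<And>x. cmod x = 1 \<Longrightarrow> cmod (G x) \<le> 1"
  shows "elog (cmod (G 0)) \<le> circle_mean (\<lambda>\<theta>. elog (cmod (G (cis \<theta>))))"
proof -
  have le1: "cmod (G x) \<le> 1" if "cmod x \<le> 1" for x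
  proof (rule maximum_modulus_frontier[of G "cball 0 1" 1 x])
    show "G holomorphic_on interior (cball 0 1)" using hol by simp
    show "continuous_on (closure (cball 0 1)) G" using cont by simp
    show "cmod (G z) \<le> 1" if "z \<in> frontier (cball 0 1)" for z using that le by simp
  qed (use that in auto)
  obtain L where L: "L holomorphic_on ball 0 1" "\<And>x. x \<in> ball 0 1 \<Longrightarrow> exp (L x) = G x"
    using holomorphic_logarithm_exists[OF convex_ball open_ball hol, of 0] nz by auto
  have ReL: "Re (L x) = ln (cmod (G x))" if "cmod x < 1" for x
    using L(2)[of x] that by (metis ln_exp norm_exp_eq_Re mem_ball_0)
  define r where "r = (\<lambda>n::nat. 1 - 1 / real (n + 2))"
  have r: "0 < r n" "r n < 1" for n by (auto simp: r_def field_simps)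
  have rlim: "r \<longlonglongrightarrow> 1"
    unfolding r_def by real_asymp
  define k where "k = (\<lambda>n t. ennreal (- Re (L (of_real (r n) * cis t))))"
  have img: "of_real (r n) * x \<in> ball 0 1" if "cmod x \<le> 1" for n x
    using r[of n] that by (auto simp: norm_mult intro: le_less_trans[OF mult_left_le])
  have I: "(\<integral>\<^sup>+t\<in>{0..2*pi}. k n t \<partial>lborel) = ennreal (- (2 * pi * Re (L 0)))" for n
  proof -
    have "(\<lambda>x. L (of_real (r n) * x)) holomorphic_on cball 0 1"
      using img by (intro holomorphic_on_compose_gen[OF _ L(1), unfolded o_def]) (auto intro!: holomorphic_intros)
    then have "((\<lambda>t. Re (L (of_real (r n) * (of_real 1 * cis t)))) has_integral 2 * pi * Re (L (of_real (r n) * 0))) {0..2*pi}"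
      by (intro Re_holomorphic_circle_mean) (auto intro: holomorphic_on_imp_continuous_on holomorphic_on_subset)
    then have "((\<lambda>t. - Re (L (of_real (r n) * cis t))) has_integral - (2 * pi * Re (L 0))) {0..2*pi}"
      by (intro has_integral_neg) simp
    moreover have "0 \<le> - Re (L (of_real (r n) * cis t))" for t
      using ReL[of "of_real (r n) * cis t"] img[of "cis t" n] le1[of "of_real (r n) * cis t"] nz[of "of_real (r n) * cis t"] by simp
    ultimately show ?thesis unfolding k_def
      by (intro nn_integral_has_integral_lebesgue') auto
  qed
  have lim: "(\<lambda>n. k n t) \<longlonglongrightarrow> e2ennreal (- elog (cmod (G (cis t))))" for t
  proof -
    have "(\<lambda>n. of_real (r n) * cis t) \<longlonglongrightarrow> of_real 1 * cis t"
      by (intro tendsto_intros rlim)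
    then have conv: "(\<lambda>n. of_real (r n) * cis t) \<longlonglongrightarrow> cis t" by simp
    have "of_real (r n) * cis t \<in> cball 0 1" for n
      using img[of "cis t" n] ball_subset_cball by (metis norm_cis order_refl subsetD)
    then have "(\<lambda>n. G (of_real (r n) * cis t)) \<longlonglongrightarrow> G (cis t)"
      by (intro continuous_on_tendsto_compose[OF cont conv]) (simp, intro always_eventually allI)
    then have "(\<lambda>n. elog (cmod (G (of_real (r n) * cis t)))) \<longlonglongrightarrow> elog (cmod (G (cis t)))"
      by (intro tendsto_elog tendsto_intros) auto
    then have "(\<lambda>n. - elog (cmod (G (of_real (r n) * cis t)))) \<longlonglongrightarrow> - elog (cmod (G (cis t)))"
      by (rule tendsto_uminus_ereal)
    then have "(\<lambda>n. e2ennreal (- elog (cmod (G (of_real (r n) * cis t))))) \<longlonglongrightarrow> e2ennreal (- elog (cmod (G (cis t))))"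
      by (intro continuous_on_tendsto_compose[OF continuous_on_e2ennreal[of UNIV]]) auto
    moreover have "e2ennreal (- elog (cmod (G (of_real (r n) * cis t)))) = k n t" for n
      using ReL[of "of_real (r n) * cis t"] img[of "cis t" n] nz[of "of_real (r n) * cis t"] by (simp add: k_def elog_def)
    ultimately show ?thesis by simp
  qed
  have contRe: "continuous_on UNIV (\<lambda>t. - Re (L (of_real (r n) * cis t)))" for n
    by (intro continuous_intros continuous_on_compose2[OF holomorphic_on_imp_continuous_on[OF L(1)]])
       (use img in auto)
  have "(\<integral>\<^sup>+t\<in>{0..2*pi}. e2ennreal (- elog (cmod (G (cis t)))) \<partial>lborel)
      = (\<integral>\<^sup>+t. liminf (\<lambda>n. k n t * indicator {0..2*pi} t) \<partial>lborel)"
  proof (rule nn_integral_cong)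
    fix t
    have "(\<lambda>n. k n t * indicator {0..2*pi} t) \<longlonglongrightarrow> e2ennreal (- elog (cmod (G (cis t)))) * indicator {0..2*pi} t"
      using lim[of t] by (cases "t \<in> {0..2*pi}") auto
    then show "e2ennreal (- elog (cmod (G (cis t)))) * indicator {0..2*pi} t = liminf (\<lambda>n. k n t * indicator {0..2*pi} t)"
      by (simp add: lim_imp_Liminf)
  qed
  also have "\<dots> \<le> liminf (\<lambda>n. \<integral>\<^sup>+t. k n t * indicator {0..2*pi} t \<partial>lborel)"
  proof (rule nn_integral_liminf)
    fix n
    have "(\<lambda>t. - Re (L (of_real (r n) * cis t))) \<in> borel_measurable borel"
      by (rule borel_measurable_continuous_onI[OF contRe])
    then show "(\<lambda>t. k n t * indicator {0..2*pi} t) \<in> borel_measurable lborel"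
      unfolding k_def by measurable
  qed
  also have "\<dots> = ennreal (- (2 * pi * Re (L 0)))" by (simp add: I Liminf_const)
  finally have fatou: "(\<integral>\<^sup>+t\<in>{0..2*pi}. e2ennreal (- elog (cmod (G (cis t)))) \<partial>lborel) \<le> ennreal (- (2 * pi * Re (L 0)))" .
  have ReL0: "Re (L 0) \<le> 0" using ReL[of 0] le1[of 0] nz[of 0] by simp
  have "e2ennreal (elog (cmod (G (cis t)))) = 0" for t
    using le[of "cis t"] by (auto simp: elog_def e2ennreal_neg)
  then have cm: "circle_mean (\<lambda>\<theta>. elog (cmod (G (cis \<theta>)))) =
     (- enn2ereal (\<integral>\<^sup>+t\<in>{0..2*pi}. e2ennreal (- elog (cmod (G (cis t)))) \<partial>lborel)) / ereal (2 * pi)"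
    unfolding circle_mean_def by (simp add: zero_ennreal.rep_eq minus_ereal_def)
  have "- enn2ereal (ennreal (- (2 * pi * Re (L 0)))) \<le>
     - enn2ereal (\<integral>\<^sup>+t\<in>{0..2*pi}. e2ennreal (- elog (cmod (G (cis t)))) \<partial>lborel)"
    using fatou by (simp add: less_eq_ennreal.rep_eq)
  moreover have "- enn2ereal (ennreal (- (2 * pi * Re (L 0)))) = ereal (2 * pi * Re (L 0))"
    using ReL0 by (simp add: mult_nonneg_nonpos)
  ultimately have "ereal (2 * pi * Re (L 0)) / ereal (2 * pi) \<le> circle_mean (\<lambda>\<theta>. elog (cmod (G (cis \<theta>))))"
    unfolding cm by (intro ereal_divide_right_mono) simp_all
  then show ?thesis using ReL[of 0] nz[of 0] by (simp add: elog_def)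
qed

section \<open>The extremal function\<close>

definition extremal_fun :: "real \<Rightarrow> complex \<Rightarrow> complex \<Rightarrow> complex \<Rightarrow> complex" where
  "extremal_fun p u z1 z2 =
     (of_real p * u^2 - of_real p * z1 * z2 - u^2 * (z1 + z2) + 2 * u * z1 * z2) /
     (of_real p * u^2 - of_real p * z1 * z2 - 2 * u + z1 + z2)"

text \<open>
  In the coordinates \<open>a = 1 - z1 / u\<close> and \<open>b = 1 - z2 / u\<close>, \<open>|1 - a| < 1\<close> means \<open>|a|\<^sup>2 < 2 Re a\<close>.
  Numerator and denominator are, up to unimodular factors, combinations of \<open>Y = a + b\<close> and
  \<open>s = a + b - 2 a b\<close>.  The inequality for \<open>a\<close> and \<open>b\<close> gives \<open>|s| < |Y|\<close>, and the difference of the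
  squared moduli is \<open>(1 - 2 Re k) (|Y|\<^sup>2 - |s|\<^sup>2)\<close> with \<open>k = p u / 2\<close>.
\<close>

lemma extremal_num_less_den:
  assumes p: "0 < p" "p < 1" and u: "cmod u = 1" and z: "(z1, z2) \<in> bidisk"
  shows "cmod (of_real p * u^2 - of_real p * z1 * z2 - u^2 * (z1 + z2) + 2 * u * z1 * z2)
       < cmod (of_real p * u^2 - of_real p * z1 * z2 - 2 * u + z1 + z2)"
proof -
  have uu: "u * cnj u = 1" using u complex_norm_square[of u] by auto
  define a where "a = 1 - cnj u * z1"
  define b where "b = 1 - cnj u * z2"
  define Y where "Y = a + b"
  define s where "s = a + b - 2 * a * b"
  define k where "k = of_real p * u / 2"
  have z': "cmod z1 < 1" "cmod z2 < 1" using z by (auto simp: bidisk_def)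
  have half: "(cmod x)\<^sup>2 < 2 * Re x" if "cmod (1 - x) < 1" for x
  proof -
    have "(cmod (1 - x))\<^sup>2 < 1" using that by (simp add: power_less_one_iff)
    then show ?thesis unfolding cmod_power2 by (simp add: power2_eq_square algebra_simps)
  qed
  have a: "(cmod a)\<^sup>2 < 2 * Re a" and b: "(cmod b)\<^sup>2 < 2 * Re b"
    using half[of a] half[of b] z' u by (simp_all add: a_def b_def norm_mult)
  have "cmod (cnj u * z1) < 1" using z' u by (simp add: norm_mult)
  then have "cnj u * z1 \<noteq> 1" by (metis less_irrefl norm_one)
  then have a0: "0 < (cmod a)\<^sup>2" by (simp add: a_def)
  have sq: "(cmod Y)\<^sup>2 - (cmod s)\<^sup>2 = 2 * ((cmod a)\<^sup>2 * (2 * Re b - (cmod b)\<^sup>2) + (cmod b)\<^sup>2 * (2 * Re a - (cmod a)\<^sup>2))"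
    unfolding Y_def s_def cmod_power2 by (simp add: power2_eq_square) algebra
  have "0 < (cmod a)\<^sup>2 * (2 * Re b - (cmod b)\<^sup>2)" using a0 b by simp
  moreover have "0 \<le> (cmod b)\<^sup>2 * (2 * Re a - (cmod a)\<^sup>2)" using a by simp
  ultimately have Ys: "0 < (cmod Y)\<^sup>2 - (cmod s)\<^sup>2" unfolding sq by simp
  have "cmod k < 1/2" using p u by (simp add: k_def norm_mult norm_divide)
  then have "Re k < 1/2" using complex_Re_le_cmod[of k] by linarith
  then have "0 < (1 - 2 * Re k) * ((cmod Y)\<^sup>2 - (cmod s)\<^sup>2)" using Ys by simp
  also have "\<dots> = (cmod ((1 - k) * Y - k * s))\<^sup>2 - (cmod (cnj k * Y - (1 - cnj k) * s))\<^sup>2"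
    unfolding cmod_power2 by (simp add: power2_eq_square) algebra
  finally have "(cmod (cnj k * Y - (1 - cnj k) * s))\<^sup>2 < (cmod ((1 - k) * Y - k * s))\<^sup>2" by simp
  then have lt: "cmod (cnj k * Y - (1 - cnj k) * s) < cmod ((1 - k) * Y - k * s)"
    by (rule power_less_imp_less_base) simp
  have zz: "z1 = u * (1 - a)" "z2 = u * (1 - b)" using uu by (simp_all add: a_def b_def)
  have "of_real p * u^2 - of_real p * z1 * z2 - u^2 * (z1 + z2) + 2 * u * z1 * z2 = u^3 * (cnj k * Y - (1 - cnj k) * s)"
  proof -
    have "of_real p = 2 * u * cnj k" using uu by (simp add: k_def)
    then show ?thesis unfolding zz Y_def s_def by algebra
  qed
  moreover have "of_real p * u^2 - of_real p * z1 * z2 - 2 * u + z1 + z2 = - u * ((1 - k) * Y - k * s)"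
  proof -
    have "of_real p * u = 2 * k" by (simp add: k_def)
    then show ?thesis unfolding zz Y_def s_def by algebra
  qed
  ultimately show ?thesis using lt u by (simp add: norm_mult norm_power)
qed

lemma extremal_fun_bidisk:
  assumes p: "0 < p" "p < 1" and u: "cmod u = 1" and z: "(z1, z2) \<in> bidisk"
  shows "of_real p * u^2 - of_real p * z1 * z2 - 2 * u + z1 + z2 \<noteq> 0" "cmod (extremal_fun p u z1 z2) < 1"
proof -
  note lt = extremal_num_less_den[OF assms]
  show nz: "of_real p * u^2 - of_real p * z1 * z2 - 2 * u + z1 + z2 \<noteq> 0"
    using le_less_trans[OF norm_ge_zero lt] by (simp only: zero_less_norm_iff not_False_eq_True)
  then show "cmod (extremal_fun p u z1 z2) < 1"
    unfolding extremal_fun_def norm_divide using lt by (subst divide_less_eq_1_pos) (simp_all only: zero_less_norm_iff not_False_eq_True)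
qed

text \<open>
  Along an affine disk the extremal function is a quotient of two polynomials, to which the reflection
  of zeros applies.
\<close>

lemma extremal_fun_affine_polys:
  obtains N Dn :: "complex poly" where
    "\<And>\<zeta>. poly N \<zeta> = of_real p * u^2 - of_real p * (a1 + \<zeta> * b1) * (a2 + \<zeta> * b2)
        - u^2 * ((a1 + \<zeta> * b1) + (a2 + \<zeta> * b2)) + 2 * u * (a1 + \<zeta> * b1) * (a2 + \<zeta> * b2)"
    "\<And>\<zeta>. poly Dn \<zeta> = of_real p * u^2 - of_real p * (a1 + \<zeta> * b1) * (a2 + \<zeta> * b2)
        - 2 * u + (a1 + \<zeta> * b1) + (a2 + \<zeta> * b2)"
proof -
  define N where "N = [:of_real p * u^2:] - smult (of_real p) ([:a1, b1:] * [:a2, b2:])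
     - smult (u^2) ([:a1, b1:] + [:a2, b2:]) + smult (2 * u) ([:a1, b1:] * [:a2, b2:])"
  define Dn where "Dn = [:of_real p * u^2 - 2 * u:] - smult (of_real p) ([:a1, b1:] * [:a2, b2:]) + [:a1, b1:] + [:a2, b2:]"
  show thesis
    by (rule that[of N Dn]) (simp_all add: N_def Dn_def algebra_simps)
qed

lemma log_extremal_plurisubharmonic:
  assumes p: "0 < p" "p < 1" and u: "cmod u = 1"
  shows "plurisubharmonic_on bidisk (\<lambda>(z1, z2). elog (cmod (extremal_fun p u z1 z2)))"
  unfolding plurisubharmonic_on_def
proof (intro conjI ballI allI impI)
  fix x show "(\<lambda>(z1, z2). elog (cmod (extremal_fun p u z1 z2))) x < \<infinity>"
    by (auto simp: elog_def split: prod.split)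
next
  fix x assume x: "x \<in> bidisk"
  obtain x1 x2 where xx: "x = (x1, x2)" by (cases x)
  have nz: "of_real p * u^2 - of_real p * x1 * x2 - 2 * u + x1 + x2 \<noteq> 0"
    using extremal_fun_bidisk(1)[OF p u] x xx by blast
  have lim: "((\<lambda>y. extremal_fun p u (fst y) (snd y)) \<longlongrightarrow> extremal_fun p u x1 x2) (at x within bidisk)"
  proof -
    have "fst x = x1" "snd x = x2" by (auto simp: xx)
    then show ?thesis
      unfolding extremal_fun_def using nz by (auto intro!: tendsto_eq_intros)
  qed
  have "((\<lambda>y. elog (cmod (extremal_fun p u (fst y) (snd y)))) \<longlongrightarrow> elog (cmod (extremal_fun p u x1 x2))) (at x within bidisk)"
    by (intro tendsto_elog tendsto_norm lim) auto
  then show "Limsup (at x within bidisk) (\<lambda>(z1, z2). elog (cmod (extremal_fun p u z1 z2)))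
        \<le> (\<lambda>(z1, z2). elog (cmod (extremal_fun p u z1 z2))) x"
    unfolding Limsup_le_iff by (auto simp: xx case_prod_beta dest: order_tendstoD(2))
next
  fix a1 a2 b1 b2 :: complex
  assume disc: "\<forall>\<zeta>. cmod \<zeta> \<le> 1 \<longrightarrow> (a1 + \<zeta> * b1, a2 + \<zeta> * b2) \<in> bidisk"
  obtain N Dn where N: "\<And>\<zeta>. poly N \<zeta> = of_real p * u^2 - of_real p * (a1 + \<zeta> * b1) * (a2 + \<zeta> * b2)
        - u^2 * ((a1 + \<zeta> * b1) + (a2 + \<zeta> * b2)) + 2 * u * (a1 + \<zeta> * b1) * (a2 + \<zeta> * b2)"
    and Dn: "\<And>\<zeta>. poly Dn \<zeta> = of_real p * u^2 - of_real p * (a1 + \<zeta> * b1) * (a2 + \<zeta> * b2)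
        - 2 * u + (a1 + \<zeta> * b1) + (a2 + \<zeta> * b2)"
    by (rule extremal_fun_affine_polys[of p u a1 b1 a2 b2]) blast
  have F: "extremal_fun p u (a1 + \<zeta> * b1) (a2 + \<zeta> * b2) = poly N \<zeta> / poly Dn \<zeta>" for \<zeta>
    unfolding extremal_fun_def N Dn ..
  have Dnz: "poly Dn \<zeta> \<noteq> 0" if "cmod \<zeta> \<le> 1" for \<zeta>
    unfolding Dn by (rule extremal_fun_bidisk(1)[OF p u]) (use disc that in blast)
  have F1: "cmod (poly N \<zeta> / poly Dn \<zeta>) < 1" if "cmod \<zeta> \<le> 1" for \<zeta>
    unfolding F[symmetric] by (rule extremal_fun_bidisk(2)[OF p u]) (use disc that in blast)
  have "elog (cmod (poly N 0 / poly Dn 0)) \<le> circle_mean (\<lambda>\<theta>. elog (cmod (poly N (cis \<theta>) / poly Dn (cis \<theta>))))"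
  proof (cases "poly N 0 = 0")
    case True
    then show ?thesis by (simp add: elog_def)
  next
    case False
    then have "N \<noteq> 0" by auto
    then obtain G where G: "\<And>x. cmod x < 1 \<Longrightarrow> poly G x \<noteq> 0"
      "\<And>x. cmod x = 1 \<Longrightarrow> cmod (poly G x) = cmod (poly N x)" "cmod (poly N 0) \<le> cmod (poly G 0)"
      by (rule poly_reflect_zeros_out_of_disc) blast
    have hol: "(\<lambda>x. poly G x / poly Dn x) holomorphic_on cball 0 1"
      using Dnz by (intro holomorphic_intros) auto
    have "cmod (poly N 0 / poly Dn 0) \<le> cmod (poly G 0 / poly Dn 0)"
      using G(3) by (simp add: norm_divide divide_right_mono)
    then have "elog (cmod (poly N 0 / poly Dn 0)) \<le> elog (cmod (poly G 0 / poly Dn 0))"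
      by (auto simp: elog_def ln_mono)
    also have "\<dots> \<le> circle_mean (\<lambda>\<theta>. elog (cmod (poly G (cis \<theta>) / poly Dn (cis \<theta>))))"
    proof (rule elog_le_circle_mean_zero_free)
      show "(\<lambda>x. poly G x / poly Dn x) holomorphic_on ball 0 1"
        using hol by (rule holomorphic_on_subset) auto
      show "continuous_on (cball 0 1) (\<lambda>x. poly G x / poly Dn x)"
        using hol by (rule holomorphic_on_imp_continuous_on)
      show "poly G x / poly Dn x \<noteq> 0" if "cmod x < 1" for x using G(1)[OF that] Dnz[of x] that by simp
      show "cmod (poly G x / poly Dn x) \<le> 1" if "cmod x = 1" for x
        using F1[of x] G(2)[OF that] that by (simp add: norm_divide)
    qed
    also have "\<dots> = circle_mean (\<lambda>\<theta>. elog (cmod (poly N (cis \<theta>) / poly Dn (cis \<theta>))))"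
      using G(2) by (simp add: norm_divide)
    finally show ?thesis .
  qed
  moreover have "extremal_fun p u a1 a2 = poly N 0 / poly Dn 0" using F[of 0] by (simp only: mult_zero_left add_0_right)
  ultimately show "(\<lambda>(z1, z2). elog (cmod (extremal_fun p u z1 z2))) (a1, a2)
     \<le> circle_mean (\<lambda>\<theta>. (\<lambda>(z1, z2). elog (cmod (extremal_fun p u z1 z2))) (a1 + cis \<theta> * b1, a2 + cis \<theta> * b2))"
    by (simp only: split_conv F)
qed

text \<open>
  Near a pole the denominator of the extremal function is bounded away from \<open>0\<close>, so a linear bound on
  the numerator suffices.
\<close>

lemma log_pole_of_linear_bound:
  assumes P: "P \<in> bidisk" and p: "0 < p" "p < 1" and u: "cmod u = 1"
    and num: "\<And>y. norm (y - P) < 1 \<Longrightarrow> 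
      cmod (of_real p * u^2 - of_real p * fst y * snd y - u^2 * (fst y + snd y) + 2 * u * fst y * snd y) \<le> 8 * norm (y - P)"
  shows "log_pole (\<lambda>(z1, z2). elog (cmod (extremal_fun p u z1 z2))) P"
proof -
  define den where "den = (\<lambda>y. of_real p * u^2 - of_real p * fst y * snd y - 2 * u + fst y + snd y)"
  have "(fst P, snd P) \<in> bidisk" using P by (simp only: prod.collapse)
  then have "den P \<noteq> 0" unfolding den_def by (rule extremal_fun_bidisk(1)[OF p u])
  then have m: "0 < cmod (den P)" by simp
  have "(den \<longlongrightarrow> den P) (at P)" unfolding den_def by (intro tendsto_intros)
  then have "((\<lambda>y. cmod (den y)) \<longlongrightarrow> cmod (den P)) (at P)" by (rule tendsto_norm)
  then have ev: "\<forall>\<^sub>F y in at P. cmod (den P) / 2 < cmod (den y)"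
    by (rule order_tendstoD(1)) (use m in simp)
  have ev1: "\<forall>\<^sub>F y in at P. dist y P < 1" unfolding eventually_at by (auto intro: exI[of _ 1])
  have ev2: "\<forall>\<^sub>F y in at P. y \<noteq> P" by (rule eventually_neq_at_within)
  show ?thesis unfolding log_pole_def
  proof (intro exI[of _ "ln (8 / (cmod (den P) / 2))"])
    show "\<forall>\<^sub>F y in at P. (\<lambda>(z1, z2). elog (cmod (extremal_fun p u z1 z2))) y
       \<le> ereal (ln (norm (y - P)) + ln (8 / (cmod (den P) / 2)))"
      using ev ev1 ev2
    proof eventually_elim
      case (elim y)
      define B where "B = norm (y - P) * (8 / (cmod (den P) / 2))"
      have "cmod (extremal_fun p u (fst y) (snd y)) \<le> 8 * norm (y - P) / (cmod (den P) / 2)"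
        unfolding extremal_fun_def norm_divide den_def[symmetric]
        using num[of y] elim m by (intro frac_le) (auto simp: dist_norm den_def)
      then have le: "cmod (extremal_fun p u (fst y) (snd y)) \<le> B" by (simp add: B_def mult.commute)
      have "elog (cmod (extremal_fun p u (fst y) (snd y))) \<le> ereal (ln B)"
        using le by (auto simp: elog_def ln_mono)
      also have "ln B = ln (norm (y - P)) + ln (8 / (cmod (den P) / 2))"
        unfolding B_def using elim m by (intro ln_mult_pos) auto
      finally show ?case by (simp add: case_prod_beta)
    qed
  qed
qed

lemma log_extremal_poles:
  assumes p: "0 < p" "p < 1" and u: "cmod u = 1"
  shows "log_pole (\<lambda>(z1, z2). elog (cmod (extremal_fun p u z1 z2))) (of_real p, 0)"
    and "log_pole (\<lambda>(z1, z2). elog (cmod (extremal_fun p u z1 z2))) (0, of_real p)"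
proof -
  have bound: "cmod (- (u^2) * (x + y) + (2 * u - of_real p) * ((of_real p + x) * y)) \<le> 8 * n"
    if "cmod x \<le> n" "cmod y \<le> n" "n \<le> 1" for x y :: complex and n
  proof -
    have n: "0 \<le> n" using that(1) norm_ge_zero order_trans by blast
    have "cmod (2 * u - of_real p) \<le> 3"
      using norm_triangle_ineq4[of "2 * u" "of_real p"] p u by (simp add: norm_mult)
    moreover have "cmod (of_real p + x) \<le> 2"
      using norm_triangle_ineq[of "of_real p" x] p that by simp
    ultimately have "cmod ((2 * u - of_real p) * ((of_real p + x) * y)) \<le> 3 * (2 * n)"
      unfolding norm_mult using that n by (intro mult_mono) auto
    moreover have "cmod (- (u^2) * (x + y)) \<le> 2 * n"
      using norm_triangle_ineq[of x y] that u by (simp add: norm_mult norm_power)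
    ultimately show ?thesis
      using norm_triangle_ineq[of "- (u^2) * (x + y)" "(2 * u - of_real p) * ((of_real p + x) * y)"] by linarith
  qed
  have in_bidisk: "(of_real p, 0) \<in> bidisk" "(0, of_real p) \<in> bidisk" using p by (auto simp: bidisk_def)
  show "log_pole (\<lambda>(z1, z2). elog (cmod (extremal_fun p u z1 z2))) (of_real p, 0)"
  proof (rule log_pole_of_linear_bound[OF in_bidisk(1) p u])
    fix y :: "complex \<times> complex" assume y: "norm (y - (of_real p, 0)) < 1"
    have eq: "of_real p * u^2 - of_real p * fst y * snd y - u^2 * (fst y + snd y) + 2 * u * fst y * snd y
       = - (u^2) * ((fst y - of_real p) + snd y) + (2 * u - of_real p) * ((of_real p + (fst y - of_real p)) * snd y)"
      by algebra
    have yp: "y - (of_real p, 0) = (fst y - of_real p, snd y)" by (simp add: prod_eq_iff)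
    show "cmod (of_real p * u^2 - of_real p * fst y * snd y - u^2 * (fst y + snd y) + 2 * u * fst y * snd y)
        \<le> 8 * norm (y - (of_real p, 0))"
      unfolding eq
    proof (rule bound)
      show "cmod (fst y - of_real p) \<le> norm (y - (of_real p, 0))" unfolding yp by (rule norm_fst_le)
      show "cmod (snd y) \<le> norm (y - (of_real p, 0))" unfolding yp by (rule norm_snd_le)
      show "norm (y - (of_real p, 0)) \<le> 1" using y by simp
    qed
  qed
  show "log_pole (\<lambda>(z1, z2). elog (cmod (extremal_fun p u z1 z2))) (0, of_real p)"
  proof (rule log_pole_of_linear_bound[OF in_bidisk(2) p u])
    fix y :: "complex \<times> complex" assume y: "norm (y - (0, of_real p)) < 1"
    have eq: "of_real p * u^2 - of_real p * fst y * snd y - u^2 * (fst y + snd y) + 2 * u * fst y * snd y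
       = - (u^2) * ((snd y - of_real p) + fst y) + (2 * u - of_real p) * ((of_real p + (snd y - of_real p)) * fst y)"
      by algebra
    have yp: "y - (0, of_real p) = (fst y, snd y - of_real p)" by (simp add: prod_eq_iff)
    show "cmod (of_real p * u^2 - of_real p * fst y * snd y - u^2 * (fst y + snd y) + 2 * u * fst y * snd y)
        \<le> 8 * norm (y - (0, of_real p))"
      unfolding eq
    proof (rule bound)
      show "cmod (snd y - of_real p) \<le> norm (y - (0, of_real p))" unfolding yp by (rule norm_snd_le)
      show "cmod (fst y) \<le> norm (y - (0, of_real p))" unfolding yp by (rule norm_fst_le)
      show "norm (y - (0, of_real p)) \<le> 1" using y by simp
    qed
  qed
qed

section \<open>Normal form of the disks\<close>

text \<open>
  Solved form of the conditions on the disk parameters, with \<open>c = r v\<close>, \<open>\<alpha> = v a\<close>, \<open>\<beta> = v b\<close> and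
  \<open>\<omega> v\<^sup>2 = u\<close>.  The equations for \<open>\<kappa>\<close>, \<open>a\<close>, \<open>b\<close>, \<open>v\<^sup>2\<close> and \<open>z\<close> express everything through
  \<open>d = 1 - p u\<close> and \<open>s\<close>.  They are kept free of divisions, so that they can serve as polynomial
  relations.
\<close>

definition normal_form :: "real \<Rightarrow> complex \<Rightarrow> real \<Rightarrow> complex \<Rightarrow> real \<Rightarrow> complex \<Rightarrow> complex \<Rightarrow> complex \<Rightarrow> bool" where
  "normal_form p u s z r v a b \<longleftrightarrow>
     (let d = 1 - of_real p * u; D = cnj d; \<kappa> = of_real (1 - r\<^sup>2); g = d + D - of_real s * d * D in
        0 < r \<and> r < 1 \<and> 0 < s \<and> cmod v = 1 \<and> cmod a < 1 \<and> cmod b < 1 \<and>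
        \<kappa> * of_real (1 + s) = of_real s * (d + D) \<and>
        (1 - of_real r * a) * D = \<kappa> \<and> g \<noteq> 0 \<and> (1 - of_real r * b) * g = \<kappa> * d \<and>
        v\<^sup>2 * d = - (u * D) \<and> z = u * (1 - of_real s * d))"

text \<open>
  After division by \<open>v\<close>, write \<open>N = b - a\<close> and \<open>M = 1 - cnj b * a\<close>.  The condition \<open>\<alpha> = m\<^sub>\<gamma> c\<close> says
  that \<open>N + a r cnj N\<close> is a positive real number; hence \<open>N\<close> is a positive multiple of \<open>A = 1 - r a\<close>.
  The three incidence conditions, after removal of the common factors \<open>1 - r b\<close> and \<open>a - r\<close>, become
  \<open>r v\<^sup>2 (M - r N) = - u (N - r M)\<close>.  Here \<open>N - r M\<close> is real by the first condition, which gives the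
  argument of \<open>A\<close>, and together with \<open>c m\<^sub>\<alpha> c = p\<close> the equation \<open>A D = \<kappa>\<close>.  The same relation
  then fixes the factor \<open>\<tau>\<close> in \<open>N = \<tau> A\<close>, hence \<open>1 - r b = A (1 - r \<tau>)\<close>.
\<close>

lemma disk_parameters_normal_form:
  assumes p: "0 < p" "p < 1" and u: "cmod u = 1"
    and par: "disk_parameters p p u z \<alpha> \<beta> c \<omega> t"
  obtains s r v a b where "normal_form p u s z r v a b"
    "c = of_real r * v" "\<alpha> = v * a" "\<beta> = v * b" "\<omega> * v\<^sup>2 = u"
proof -
  define \<gamma> where "\<gamma> = complex_of_real t * \<alpha> + (1 - complex_of_real t) * \<beta>"
  obtain r v where m: "cmod \<alpha> < 1" "cmod \<beta> < 1" "cmod c < 1" "cmod \<omega> = 1" "0 < t" "t < 1"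
    and \<gamma>: "\<alpha> = disk_aut \<gamma> c" and e: "c * disk_aut \<alpha> c = of_real p" "\<omega> * c * disk_aut \<beta> c = z"
      "\<omega> * \<alpha> * disk_aut \<beta> \<alpha> = disk_aut z p"
    and rv: "0 < r" "cmod v = 1" "c = of_real r * v" "\<omega> * v\<^sup>2 = u"
    using par unfolding disk_parameters_def Let_def \<gamma>_def by auto
  have r1: "r < 1" using m(3) rv by (simp add: norm_mult)
  have vv: "v * cnj v = 1" using rv(2) by (simp add: complex_norm_square[symmetric])
  define a where "a = cnj v * \<alpha>"
  define b where "b = cnj v * \<beta>"
  have \<alpha>: "\<alpha> = v * a" and \<beta>: "\<beta> = v * b" by (simp_all add: a_def b_def vv mult.assoc[symmetric])
  have ab: "cmod a < 1" "cmod b < 1" using m rv by (auto simp: a_def b_def norm_mult)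
  define n where "n = (cmod a)\<^sup>2"
  have n: "of_real n = a * cnj a" "n < 1" "0 \<le> n"
    using ab complex_norm_square[of a] by (simp_all add: n_def power_less_one_iff)
  have tt: "1 - complex_of_real t = of_real (1 - t)" "\<bar>t\<bar> = t" "\<bar>1 - t\<bar> = 1 - t" using m(5,6) by auto
  have "cmod \<gamma> \<le> t * cmod \<alpha> + (1 - t) * cmod \<beta>"
    using norm_triangle_ineq[of "of_real t * \<alpha>" "(1 - of_real t) * \<beta>"] m(5,6)
    by (simp only: \<gamma>_def norm_mult norm_of_real tt)
  also have "\<dots> < t * 1 + (1 - t) * 1"
    using m by (intro add_strict_mono mult_strict_left_mono) auto
  finally have "cmod \<gamma> < 1" by simp
  then have "\<alpha> * (1 - cnj \<gamma> * c) = \<gamma> - c"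
    using \<gamma> disk_aut_denominator_nz[of \<gamma> c] m(3) by (simp add: disk_aut_def)
  then have E1: "a * (1 - (of_real t * cnj a + (1 - of_real t) * cnj b) * of_real r) =
      of_real t * a + (1 - of_real t) * b - of_real r"
    unfolding \<gamma>_def rv(3) \<alpha> \<beta> using vv
    by (simp add: ) algebra
  have E2: "of_real r * v\<^sup>2 * (a - of_real r) = of_real p * (1 - cnj a * of_real r)"
  proof -
    have "c * (\<alpha> - c) = of_real p * (1 - cnj \<alpha> * c)"
      using e(1) disk_aut_denominator_nz[of \<alpha> c] m by (simp add: disk_aut_def field_simps)
    then show ?thesis unfolding rv(3) \<alpha> using vv by simp algebra
  qed
  have E3: "z * (1 - cnj b * of_real r) = u * of_real r * (b - of_real r)"
  proof -
    have "\<omega> * c * (\<beta> - c) = z * (1 - cnj \<beta> * c)"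
      using e(2) disk_aut_denominator_nz[of \<beta> c] m by (simp add: disk_aut_def field_simps)
    then show ?thesis unfolding rv(3) \<beta> rv(4)[symmetric] using vv by simp algebra
  qed
  have "cmod z < 1"
  proof -
    have "cmod z = cmod c * cmod (disk_aut \<beta> c)" using e(2) m(4) by (auto simp: norm_mult)
    also have "\<dots> < 1 * 1"
      using m cmod_disk_aut_less_1[of \<beta> c] by (intro mult_strict_mono') auto
    finally show ?thesis by simp
  qed
  have E4: "u * a * (b - a) * (1 - cnj z * of_real p) = (z - of_real p) * (1 - cnj b * a)"
  proof -
    have "1 - cnj \<beta> * \<alpha> \<noteq> 0" "1 - cnj z * of_real p \<noteq> 0"
      using disk_aut_denominator_nz m p \<open>cmod z < 1\<close> by auto
    then have "\<omega> * \<alpha> * (\<beta> - \<alpha>) * (1 - cnj z * of_real p) = (z - of_real p) * (1 - cnj \<beta> * \<alpha>)"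
      using e(3) by (simp add: disk_aut_def field_simps)
    then show ?thesis unfolding \<alpha> \<beta> rv(4)[symmetric] using vv by simp algebra
  qed
  define N where "N = b - a"
  define M where "M = 1 - cnj b * a"
  define \<rho> where "\<rho> = r * (1 - n) / (1 - t)"
  have \<rho>pos: "\<rho> > 0" using rv n m by (simp add: \<rho>_def)
  have N1: "N + a * of_real r * cnj N = of_real \<rho>"
  proof -
    have "(1 - of_real t) * (N + a * of_real r * cnj N) = of_real r * (1 - a * cnj a)"
      using E1 unfolding N_def by simp algebra
    then have "(1 - of_real t) * (N + a * of_real r * cnj N) = (1 - of_real t) * of_real \<rho>"
      using m(6) n(1) unfolding tt(1) \<rho>_def by simp
    moreover have "1 - complex_of_real t \<noteq> 0" using m(6) unfolding tt(1) by simp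
    ultimately show ?thesis by simp
  qed
  have N1': "cnj N + cnj a * of_real r * N = of_real \<rho>"
    using arg_cong[OF N1, of cnj] by simp
  have rn: "r\<^sup>2 * n < 1" 
    using n r1 rv(1) mult_strict_mono'[of "r\<^sup>2" 1 n 1] by (simp add: power_less_one_iff)
  define \<tau> where "\<tau> = \<rho> / (1 - r\<^sup>2 * n)"
  have \<tau>: "\<tau> > 0" "\<tau> * (1 - r\<^sup>2 * n) = \<rho>" using \<rho>pos rn by (auto simp: \<tau>_def)
  define A where "A = 1 - of_real r * a"
  have NA: "N = of_real \<tau> * A"
  proof -
    have "(1 - (of_real r)\<^sup>2 * (a * cnj a)) * N = of_real \<rho> * A"
    proof -
      have "(1 - (of_real r)\<^sup>2 * (a * cnj a)) * N =
          (N + a * of_real r * cnj N) - a * of_real r * (cnj N + cnj a * of_real r * N)" by algebra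
      also have "\<dots> = of_real \<rho> * A" unfolding N1 N1' A_def by algebra
      finally show ?thesis .
    qed
    moreover have "of_real \<rho> = of_real \<tau> * (1 - (of_real r)\<^sup>2 * (a * cnj a))"
      unfolding n(1)[symmetric] \<tau>(2)[symmetric] by simp
    ultimately have "(1 - (of_real r)\<^sup>2 * (a * cnj a)) * N = (1 - (of_real r)\<^sup>2 * (a * cnj a)) * (of_real \<tau> * A)"
      by simp
    moreover have "1 - (of_real r)\<^sup>2 * (a * cnj a) \<noteq> 0"
      using rn unfolding n(1)[symmetric] by (metis less_irrefl of_real_1 of_real_diff of_real_eq_0_iff of_real_mult of_real_power diff_gt_0_iff_gt)
    ultimately show ?thesis by simp
  qed
  have Bnz: "1 - of_real r * b \<noteq> 0"
    using disk_aut_denominator_nz[of "of_real r" b] r1 rv(1) ab by simp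
  have Anz: "A \<noteq> 0"
    using disk_aut_denominator_nz[of "of_real r" a] r1 rv(1) ab by (simp add: A_def)
  have BA: "1 - of_real r * b = A * (1 - of_real (r * \<tau>))"
    using NA unfolding N_def A_def by simp algebra
  have anr: "a \<noteq> of_real r"
  proof
    assume "a = of_real r"
    then have "of_real p * (1 - cnj a * of_real r) = 0" using E2 by simp
    then show False using p disk_aut_denominator_nz[of a "of_real r"] ab rv r1 by simp
  qed
  \<comment> \<open>cross-multiplying \<open>\<omega> \<alpha> m\<^sub>\<beta> \<alpha> = m\<^sub>z p\<close> makes both sides factor; the factors \<open>1 - r b\<close> and \<open>a - r\<close> cancel\<close>
  have key: "of_real r * v\<^sup>2 * (M - of_real r * N) = - u * (N - of_real r * M)"
  proof -
    have uu: "u * cnj u = 1" using u by (simp add: complex_norm_square[symmetric])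
    have E3': "cnj z * (1 - b * of_real r) = cnj u * of_real r * (cnj b - of_real r)"
      using arg_cong[OF E3, of cnj] by simp
    have "of_real p * (1 - cnj b * of_real r) * (1 - of_real r * a) * (M - of_real r * N)
        = u * (1 - b * of_real r) * (of_real r - a) * (N - of_real r * M)"
      using E3 E3' E4 uu unfolding M_def N_def by algebra
    moreover have "1 - b * of_real r = A * (1 - of_real (r * \<tau>))" using BA by (simp add: mult.commute)
    moreover have "1 - cnj b * of_real r = cnj A * (1 - of_real (r * \<tau>))"
      using arg_cong[OF BA, of cnj] by (simp add: mult.commute)
    ultimately have "A * (1 - of_real (r * \<tau>)) * (of_real p * cnj A * (M - of_real r * N)) =
        A * (1 - of_real (r * \<tau>)) * (u * (of_real r - a) * (N - of_real r * M))"
      unfolding A_def by algebra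
    then have "of_real p * cnj A * (M - of_real r * N) = u * (of_real r - a) * (N - of_real r * M)"
      using Bnz BA by simp
    moreover have "of_real r * v\<^sup>2 * (a - of_real r) = of_real p * cnj A"
      using E2 by (simp add: A_def mult.commute)
    ultimately have "(a - of_real r) * (of_real r * v\<^sup>2 * (M - of_real r * N)) =
       (a - of_real r) * (- u * (N - of_real r * M))" by algebra
    moreover have "a - of_real r \<noteq> 0" using anr by simp
    ultimately show ?thesis by (simp only: mult_cancel_left simp_thms not_False_eq_True)
  qed
  define \<rho>0 where "\<rho>0 = \<rho> - r * (1 - n)"
  have NM: "N - of_real r * M = of_real \<rho>0"
  proof -
    have "N - of_real r * M = (N + a * of_real r * cnj N) - of_real r * (1 - of_real n)"
      unfolding n(1) M_def N_def by (simp add: algebra_simps)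
    then show ?thesis unfolding N1 \<rho>0_def by simp
  qed
  define w where "w = v\<^sup>2"
  have ww: "w * cnj w = 1" "w \<noteq> 0" using vv by (auto simp: w_def power2_eq_square) algebra
  have uu: "u * cnj u = 1" "u \<noteq> 0" using u complex_norm_square[of u] by auto
  define \<kappa> where "\<kappa> = complex_of_real (1 - r\<^sup>2)"
  have r2: "0 < 1 - r\<^sup>2" using r1 rv(1) by (simp add: power_less_one_iff)
  have \<kappa>: "\<kappa> = 1 - (of_real r)\<^sup>2" "\<kappa> \<noteq> 0" "cnj \<kappa> = \<kappa>"
    using r2 unfolding \<kappa>_def by (simp, metis less_irrefl of_real_eq_0_iff, simp)
  have \<tau>0: "complex_of_real \<tau> \<noteq> 0" using \<tau> by simp
  have S1: "w * \<kappa> * of_real \<tau> * A = of_real \<rho>0 * (w - u)"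
    using key NM NA unfolding w_def[symmetric] \<kappa>(1) by algebra
  have S2: "u * cnj A = - w * A"
  proof -
    have "cnj w * \<kappa> * of_real \<tau> * cnj A = of_real \<rho>0 * (cnj w - cnj u)"
      using arg_cong[OF S1, of cnj] \<kappa>(3) by simp
    then have "(\<kappa> * of_real \<tau>) * (u * cnj A) = (\<kappa> * of_real \<tau>) * (- w * A)"
      using S1 ww(1) uu(1) by algebra
    moreover have "\<kappa> * of_real \<tau> \<noteq> 0" using \<kappa>(2) \<tau>0 by simp
    ultimately show ?thesis by (simp only: mult_cancel_left simp_thms not_False_eq_True)
  qed
  define d where "d = 1 - of_real p * u"
  have D: "cnj d = 1 - of_real p * cnj u" by (simp add: d_def)
  have AD: "A * cnj d = \<kappa>"
  proof -
    have "w * (\<kappa> - A) = of_real p * cnj A"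
      using E2 unfolding A_def w_def[symmetric] \<kappa>(1) by simp algebra
    then have "w * (u * (\<kappa> - A)) = w * (- of_real p * A)" using S2 by algebra
    then have "u * (\<kappa> - A) = - of_real p * A" using ww(2) by (simp only: mult_cancel_left simp_thms not_False_eq_True)
    then show ?thesis unfolding D using uu(1) by algebra
  qed
  have Ad: "cnj A * d = \<kappa>" using arg_cong[OF AD, of cnj] \<kappa>(3) by simp
  have dnz: "d \<noteq> 0" using Ad \<kappa>(2) by auto
  have wd: "w * d = - (u * cnj d)"
  proof -
    have "\<kappa> * (w * d) = \<kappa> * (- (u * cnj d))" using S2 AD Ad by algebra
    then show ?thesis using \<kappa>(2) by (simp only: mult_cancel_left simp_thms not_False_eq_True)
  qed
  define h where "h = d + cnj d"
  define hr where "hr = 2 * Re d"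
  have h: "h = of_real hr" by (simp add: h_def hr_def complex_add_cnj)
  define N2 where "N2 = (cmod d)\<^sup>2"
  have N2: "of_real N2 = d * cnj d" "0 < N2"
    using dnz complex_norm_square[of d] by (auto simp: N2_def)
  have T1: "\<kappa>\<^sup>2 * of_real \<tau> = of_real \<rho>0 * h"
  proof -
    have "(w * d) * (\<kappa>\<^sup>2 * of_real \<tau>) = (w * d) * (of_real \<rho>0 * h)"
      using S1 AD wd unfolding h_def by algebra
    then show ?thesis using ww dnz by simp
  qed
  have rnA: "of_real (r\<^sup>2 * n) = (1 - A) * (1 - cnj A)"
    unfolding of_real_mult n(1) by (simp add: A_def power2_eq_square)
  have T2: "of_real (1 - r\<^sup>2 * n) * of_real N2 = \<kappa> * (h - \<kappa>)"
  proof -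
    have "\<kappa> * (h - \<kappa>) = (A * cnj d) * d + (cnj A * d) * cnj d - (A * cnj d) * (cnj A * d)"
      unfolding AD Ad h_def by algebra
    also have "\<dots> = (1 - (1 - A) * (1 - cnj A)) * (d * cnj d)" by algebra
    finally show ?thesis unfolding of_real_diff rnA N2 by simp
  qed
  then have T2r: "(1 - r\<^sup>2 * n) * N2 = (1 - r\<^sup>2) * (hr - (1 - r\<^sup>2))"
    unfolding \<kappa>_def h by (simp only: of_real_eq_iff flip: of_real_mult of_real_diff)
  have "0 < (1 - r\<^sup>2 * n) * N2" using rn N2 by simp
  then have hk: "0 < hr - (1 - r\<^sup>2)" using T2r r2 by (simp add: zero_less_mult_iff)
  \<comment> \<open>the value forced by \<open>\<kappa> (1 + s) = s h\<close>\<close>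
  define s where "s = (1 - r\<^sup>2) / (hr - (1 - r\<^sup>2))"
  have s: "s > 0" "s * (hr - (1 - r\<^sup>2)) = 1 - r\<^sup>2" using hk r2 by (auto simp: s_def)
  have s1: "\<kappa> * of_real (1 + s) = of_real s * h"
  proof -
    have "(1 - r\<^sup>2) * (1 + s) = s * hr" using s(2) by (simp add: algebra_simps)
    then show ?thesis unfolding \<kappa>_def h by (simp only: of_real_eq_iff flip: of_real_mult of_real_diff)
  qed
  define g where "g = h - of_real s * d * cnj d"
  have G1: "(1 - of_real (r * \<tau>)) * g = d * cnj d"
  proof -
    have hnz: "h \<noteq> 0" unfolding h using hk r2 by (metis less_add_same_cancel1 less_trans of_real_eq_0_iff less_irrefl diff_add_cancel add.commute add_pos_pos)
    have s1nz: "complex_of_real (1 + s) \<noteq> 0" using s(1) by (metis add_pos_pos less_irrefl of_real_eq_0_iff zero_less_one)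
    have "of_real (r * \<rho>0) = of_real (r * \<tau>) * of_real (1 - r\<^sup>2 * n) - (of_real (1 - r\<^sup>2 * n) - \<kappa>)"
      unfolding \<rho>0_def \<tau>(2)[symmetric] \<kappa>_def of_real_mult[symmetric] of_real_diff[symmetric] of_real_eq_iff
      by (simp add: algebra_simps power2_eq_square)
    then have "\<kappa>\<^sup>2 * of_real (r * \<tau>) * of_real N2 = h * (of_real (r * \<tau>) * (\<kappa> * (h - \<kappa>)) - (\<kappa> * (h - \<kappa>) - \<kappa> * of_real N2))"
      using T1 T2 unfolding of_real_mult[of r] by algebra
    then have "\<kappa> * (\<kappa> * of_real (r * \<tau>) * of_real N2) = \<kappa> * (h * (of_real (r * \<tau>) * (h - \<kappa>) - (h - \<kappa> - of_real N2)))"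
      by algebra
    then have "\<kappa> * of_real (r * \<tau>) * of_real N2 = h * (of_real (r * \<tau>) * (h - \<kappa>) - (h - \<kappa> - of_real N2))"
      using \<kappa>(2) by simp
    moreover have "(h - \<kappa>) * of_real (1 + s) = h" using s1 by simp algebra
    ultimately have "h * ((1 - of_real (r * \<tau>)) * g) = h * (d * cnj d)"
      using s1 unfolding g_def N2 by algebra
    then show ?thesis using hnz by simp
  qed
  have gnz: "g \<noteq> 0" using G1 dnz by auto
  have Bg: "(1 - of_real r * b) * g = \<kappa> * d" using G1 AD unfolding BA by algebra
  have zz: "z = u * (1 - of_real s * d)"
  proof -
    have cg: "cnj g = g" by (simp add: g_def h)
    have Bg': "(1 - of_real r * cnj b) * g = \<kappa> * cnj d" using arg_cong[OF Bg, of cnj] \<kappa>(3) cg by simp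
    have "z * (\<kappa> * cnj d) = u * (of_real r * b - (of_real r)\<^sup>2) * g"
      using E3 Bg' by algebra
    also have "\<dots> = u * (\<kappa> * (g - d))" using Bg unfolding \<kappa>(1) by algebra
    also have "\<dots> = (u * (1 - of_real s * d)) * (\<kappa> * cnj d)" unfolding g_def h_def by algebra
    finally show ?thesis using \<kappa>(2) dnz by simp
  qed
  have "normal_form p u s z r v a b"
    unfolding normal_form_def Let_def d_def[symmetric] \<kappa>_def[symmetric] h_def[symmetric] g_def[symmetric]
    using rv r1 s ab s1 AD gnz Bg wd zz by (simp add: A_def w_def)
  then show thesis using rv \<alpha> \<beta> that by blast
qed

text \<open>
  The factors of the two Blaschke products of a disk, cleared of denominators, as polynomials in
  \<open>l = x / r\<close>.  In this variable the zero \<open>r\<close> sits at \<open>1\<close>, and only \<open>r\<^sup>2\<close> enters, as a rational function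
  of \<open>s\<close>, \<open>d\<close> and \<open>D\<close>.
\<close>

lemma normal_form_factors:
  fixes l :: complex
  assumes nf: "normal_form p u s z r v a b"
  defines "d \<equiv> 1 - of_real p * u"
  defines "D \<equiv> cnj d" and "S \<equiv> complex_of_real s"
  defines "h \<equiv> d + D"
  defines "q \<equiv> 1 + S - S * h" and "g \<equiv> h - S * d * D"
  shows "(1 + S) * D * (of_real r * (a - of_real r * l)) = D - S * d - D * q * l"
    and "(1 + S) * d * (1 - cnj a * (of_real r * l)) = (1 + S) * d + (S * D - d) * l"
    and "(1 + S) * g * (of_real r * l * (b - of_real r * l)) = l * ((1 + S) * g - S * h * d - g * q * l)"
    and "(1 + S) * g * (1 - cnj b * (of_real r * l)) = (1 + S) * g - ((1 + S) * g - S * h * D) * l"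
proof -
  define \<kappa> where "\<kappa> = complex_of_real (1 - r\<^sup>2)"
  define R where "R = complex_of_real r"
  have nf': "\<kappa> * (1 + S) = S * h" "(1 - R * a) * D = \<kappa>" "(1 - R * b) * g = \<kappa> * d"
    using nf unfolding normal_form_def Let_def d_def[symmetric] D_def[symmetric]
      h_def[symmetric] S_def[symmetric] g_def[symmetric] \<kappa>_def[symmetric] R_def[symmetric] by (auto simp: S_def)
  have R: "R\<^sup>2 = 1 - \<kappa>" "cnj R = R" by (simp_all add: R_def \<kappa>_def)
  have cnjs: "cnj D = d" "cnj d = D" "cnj g = g" "cnj \<kappa> = \<kappa>"
    by (simp_all add: D_def h_def g_def \<kappa>_def S_def algebra_simps)
  have a': "(1 - R * cnj a) * d = \<kappa>" using arg_cong[OF nf'(2), of cnj] by (simp add: cnjs R)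
  have b': "(1 - R * cnj b) * g = \<kappa> * D" using arg_cong[OF nf'(3), of cnj] by (simp add: cnjs R)
  have q: "q = (1 + S) * (1 - \<kappa>)" using nf'(1) by (simp add: q_def algebra_simps)
  have "(1 + S) * D * (R * (a - R * l)) = (1 + S) * (D - (1 - R * a) * D) - (1 + S) * R\<^sup>2 * D * l"
    by algebra
  also have "\<dots> = D - S * d - D * q * l"
    unfolding nf'(2) R q using nf'(1) unfolding h_def by algebra
  finally show "(1 + S) * D * (of_real r * (a - of_real r * l)) = D - S * d - D * q * l"
    unfolding R_def .
  have "(1 + S) * d * (1 - cnj a * (R * l)) = (1 + S) * d - (1 + S) * (d - (1 - R * cnj a) * d) * l"
    by algebra
  also have "\<dots> = (1 + S) * d + (S * D - d) * l"
    unfolding a' using nf'(1) unfolding h_def by algebra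
  finally show "(1 + S) * d * (1 - cnj a * (of_real r * l)) = (1 + S) * d + (S * D - d) * l"
    unfolding R_def .
  have "(1 + S) * g * (R * l * (b - R * l)) = (1 + S) * l * ((g - (1 - R * b) * g) - R\<^sup>2 * g * l)"
    by algebra
  also have "\<dots> = l * ((1 + S) * g - S * h * d - g * q * l)"
    unfolding nf'(3) R q using nf'(1) by algebra
  finally show "(1 + S) * g * (of_real r * l * (b - of_real r * l)) = l * ((1 + S) * g - S * h * d - g * q * l)"
    unfolding R_def .
  have "(1 + S) * g * (1 - cnj b * (R * l)) = (1 + S) * g - (1 + S) * (g - (1 - R * cnj b) * g) * l"
    by algebra
  also have "\<dots> = (1 + S) * g - ((1 + S) * g - S * h * D) * l"
    unfolding b' using nf'(1) by algebra
  finally show "(1 + S) * g * (1 - cnj b * (of_real r * l)) = (1 + S) * g - ((1 + S) * g - S * h * D) * l"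
    unfolding R_def .
qed

section \<open>The extremal function on the disks\<close>

text \<open>
  For the disk in normal form, \<open>N1 / D1\<close> and \<open>N2 / D2\<close> are its two coordinates divided by \<open>u\<close>.  The left-hand
  sides are \<open>D1 D2\<close> times numerator and denominator of \<open>F\<close>, up to powers of \<open>u\<close>.  Both contain the quadratic factor
  \<open>M\<close>, whose zeros are the two passages of the disk through \<open>(u, u)\<close>; what remains are the factors
  of \<open>m\<^sub>c m\<^sub>\<alpha>\<close>.
\<close>

lemma numerator_identity:
  fixes s d D l :: complex
  defines "h \<equiv> d + D" defines "q \<equiv> 1 + s - s * h" and "g \<equiv> h - s * d * D"
  defines "Den \<equiv> (1 + s) * g - ((1 + s) * g - s * h * D) * l"
    and "Num \<equiv> l * ((1 + s) * g - s * h * d - g * q * l)"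
    and "M \<equiv> (1 + s) * (d + (D - d) * l) - D * q * l\<^sup>2"
    and "D1 \<equiv> (1 + s) * d + (s * D - d) * l" and "N1 \<equiv> l * (D * q * l + s * d - D)"
  defines "D2 \<equiv> Den - (1 - s * D) * Num" and "N2 \<equiv> (1 - s * d) * Den - Num"
  shows "(1 - D) * (D1 * D2 - N1 * N2) - N1 * D2 - N2 * D1 + 2 * N1 * N2
      = - M * g * (1 + s) * (1 - l) * (D - s * d - D * q * l)"
    and "(1 - d) * (D1 * D2 - N1 * N2) - 2 * D1 * D2 + N1 * D2 + N2 * D1
      = - M * g * (1 + s - q * l) * D1"
    and "D1 - N1 = M"
  unfolding assms by algebra+

lemma extremal_fun_along_disc:
  assumes p: "0 < p" "p < 1" and u: "cmod u = 1" and nf: "normal_form p u s z r v a b"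
    and om: "\<omega> * v\<^sup>2 = u" and lam: "cmod \<mu> < 1" and z1z: "cmod z < 1"
  defines "z1 \<equiv> \<mu> * disk_aut (v * a) \<mu>"
    and "z2 \<equiv> disk_aut z (\<omega> * \<mu> * disk_aut (v * b) \<mu>)"
  shows "extremal_fun p u z1 z2 = - u * (disk_aut (of_real r * v) \<mu> * disk_aut (v * a) \<mu>)"
proof -
  define d where "d = 1 - of_real p * u"
  define D where "D = cnj d"
  define h where "h = d + D"
  define S where "S = complex_of_real s"
  define g where "g = h - S * d * D"
  define \<kappa> where "\<kappa> = complex_of_real (1 - r\<^sup>2)"
  have nf': "0 < r" "r < 1" "0 < s" "cmod v = 1" "cmod a < 1" "cmod b < 1"
    "\<kappa> * (1 + S) = S * h" "(1 - of_real r * a) * D = \<kappa>" "g \<noteq> 0" "(1 - of_real r * b) * g = \<kappa> * d"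
    "v\<^sup>2 * d = - (u * D)" "z = u * (1 - S * d)"
    using nf unfolding normal_form_def Let_def d_def[symmetric] D_def[symmetric]
      h_def[symmetric] S_def[symmetric] g_def[symmetric] \<kappa>_def[symmetric] by (auto simp: S_def)
  have uu: "u * cnj u = 1" "u \<noteq> 0" using u complex_norm_square[of u] by auto
  have vv: "v * cnj v = 1" "v \<noteq> 0" using nf'(4) complex_norm_square[of v] by auto
  have Dp: "of_real p = u * (1 - D)" "of_real p * u = 1 - d"
    using uu by (auto simp: D_def d_def)
  have rnz: "complex_of_real r \<noteq> 0" using nf' by simp
  have r2: "(of_real r)\<^sup>2 = 1 - \<kappa>" by (simp add: \<kappa>_def)
  have cnjs: "cnj D = d" "cnj d = D" "cnj h = h" "cnj g = g" "cnj \<kappa> = \<kappa>" "cnj S = S"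
    by (simp_all add: D_def h_def g_def \<kappa>_def S_def algebra_simps)
  have a': "(1 - of_real r * cnj a) * d = \<kappa>" using arg_cong[OF nf'(8), of cnj] by (simp add: cnjs)
  have b': "(1 - of_real r * cnj b) * g = \<kappa> * D" using arg_cong[OF nf'(10), of cnj] by (simp add: cnjs)
  have "1 + S = of_real (1 + s)" by (simp add: S_def)
  then have S1: "1 + S \<noteq> 0" using nf'(3) by (metis add_pos_pos less_irrefl of_real_eq_0_iff zero_less_one)
  have cmp: "cmod (of_real p * u) < 1" using p u by (simp add: norm_mult)
  have dnz: "d \<noteq> 0" using cmp by (auto simp: d_def)
  have Dnz: "D \<noteq> 0" using dnz by (simp add: D_def)
  define x where "x = cnj v * \<mu>"
  have lx: "\<mu> = v * x" using vv by (simp add: x_def flip: mult.assoc)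
  have x1: "cmod x < 1" using lam nf' by (simp add: x_def norm_mult)
  define l where "l = x / of_real r"
  have xl: "x = of_real r * l" using rnz by (simp add: l_def)
  define q where "q = 1 + S - S * h"
  have q: "q = (1 + S) * (1 - \<kappa>)" using nf'(7) by (simp add: q_def algebra_simps)
  define Den where "Den = (1 + S) * g - ((1 + S) * g - S * h * D) * l"
  define Num where "Num = l * ((1 + S) * g - S * h * d - g * q * l)"
  define M where "M = (1 + S) * (d + (D - d) * l) - D * q * l\<^sup>2"
  define D1 where "D1 = (1 + S) * d + (S * D - d) * l"
  define N1 where "N1 = l * (D * q * l + S * d - D)"
  define D2 where "D2 = Den - (1 - S * D) * Num"
  define N2 where "N2 = (1 - S * d) * Den - Num"
  note fac = normal_form_factors[OF nf, folded d_def, folded D_def S_def, folded h_def, folded q_def g_def, of l, folded xl]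
  have e1: "(1 + S) * D * (of_real r * (a - x)) = D - S * d - D * q * l"
    and e2: "(1 + S) * d * (1 - cnj a * x) = D1"
    and e3: "(1 + S) * g * (x * (b - x)) = Num"
    and e4: "(1 + S) * g * (1 - cnj b * x) = Den"
    using fac unfolding D1_def Num_def Den_def .
  have nz: "1 - cnj a * x \<noteq> 0" "1 - cnj b * x \<noteq> 0" "1 - of_real r * x \<noteq> 0"
    using disk_aut_denominator_nz[of a x] disk_aut_denominator_nz[of b x] 
      disk_aut_denominator_nz[of "of_real r" x] x1 nf' by auto
  have D1nz: "D1 \<noteq> 0" using e2 S1 dnz nz by auto
  have Dennz: "Den \<noteq> 0" using e4 S1 nf'(9) nz by auto
  have rotate: "disk_aut (v * y) \<mu> = v * ((y - x) / (1 - cnj y * x))" for y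
    unfolding disk_aut_def lx using vv by (simp add: algebra_simps) (simp flip: mult.assoc add: mult.commute)?
  have z1: "z1 * D1 = u * N1"
  proof -
    have "z1 = v\<^sup>2 * (x * ((a - x) / (1 - cnj a * x)))"
      unfolding z1_def rotate unfolding lx by (simp add: power2_eq_square)
    then have "z1 * (1 - cnj a * x) = v\<^sup>2 * (x * (a - x))" using nz by simp
    then have "z1 * D1 = v\<^sup>2 * d * (l * ((1 + S) * (of_real r * (a - x))))"
      using e2 unfolding xl by algebra
    also have "\<dots> = - u * l * ((1 + S) * D * (of_real r * (a - x)))" unfolding nf'(11) by algebra
    also have "\<dots> = u * N1" unfolding e1 N1_def by algebra
    finally show ?thesis .
  qed
  define y where "y = x * ((b - x) / (1 - cnj b * x))"
  have y: "y * Den = Num"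
  proof -
    have "y * (1 - cnj b * x) = x * (b - x)" using nz(2) by (simp add: y_def)
    then show ?thesis using e3 e4 by algebra
  qed
  have y1: "cmod y < 1"
  proof -
    have "cmod y = cmod x * cmod (disk_aut b x)" by (simp add: y_def disk_aut_def norm_mult norm_divide)
    also have "\<dots> < 1 * 1"
      using x1 cmod_disk_aut_less_1[OF nf'(6) x1] by (intro mult_strict_mono') auto
    finally show ?thesis by simp
  qed
  have zc: "cnj z = cnj u * (1 - S * D)" unfolding nf'(12) by (simp add: cnjs)
  have "1 - cnj z * (u * y) \<noteq> 0"
    by (rule disk_aut_denominator_nz[OF z1z]) (use u y1 in \<open>simp add: norm_mult\<close>)
  moreover have zuy: "1 - cnj z * (u * y) = 1 - (1 - S * D) * y" unfolding zc using uu(1) by algebra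
  ultimately have ynz: "1 - (1 - S * D) * y \<noteq> 0" by simp
  have D2: "D2 = Den * (1 - (1 - S * D) * y)" unfolding D2_def y[symmetric] by algebra
  then have D2nz: "D2 \<noteq> 0" using ynz Dennz by simp
  have z2: "z2 * D2 = u * N2"
  proof -
    have "\<omega> * \<mu> * disk_aut (v * b) \<mu> = \<omega> * v\<^sup>2 * y"
      unfolding rotate y_def unfolding lx by (simp add: power2_eq_square)
    then have "z2 = disk_aut z (u * y)" unfolding z2_def om by simp
    also have "\<dots> = u * ((1 - S * d) - y) / (1 - (1 - S * D) * y)"
      unfolding disk_aut_def zuy unfolding nf'(12) by (simp add: algebra_simps)
    finally have "z2 * (1 - (1 - S * D) * y) = u * ((1 - S * d) - y)" using ynz by simp
    then have "z2 * D2 = Den * (u * ((1 - S * d) - y))" unfolding D2 by algebra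
    also have "\<dots> = u * N2" unfolding N2_def y[symmetric] by algebra
    finally show ?thesis .
  qed
  note ids = numerator_identity[where s = S and d = d and D = D and l = l, folded h_def, folded q_def g_def,
      folded Den_def Num_def M_def D1_def N1_def, folded D2_def N2_def]
  have z1less: "cmod z1 < 1"
  proof -
    have "cmod z1 = cmod \<mu> * cmod (disk_aut (v * a) \<mu>)" by (simp add: z1_def norm_mult)
    also have "\<dots> < 1 * 1"
      using lam nf' cmod_disk_aut_less_1[of "v * a" \<mu>] by (intro mult_strict_mono') (auto simp: norm_mult)
    finally show ?thesis by simp
  qed
  \<comment> \<open>a zero of \<open>M\<close> would place \<open>z1\<close> at the boundary point \<open>u\<close>\<close>
  have Mnz: "M \<noteq> 0"
  proof
    assume "M = 0"
    then have "D1 * z1 = D1 * u" using ids(3) z1 by (simp add: mult.commute)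
    then have "z1 = u" using D1nz by simp
    then show False using z1less u by simp
  qed
  define nF where "nF = of_real p * u^2 - of_real p * z1 * z2 - u^2 * (z1 + z2) + 2 * u * z1 * z2"
  define dF where "dF = of_real p * u^2 - of_real p * z1 * z2 - 2 * u + z1 + z2"
  have "D1 * D2 * nF = u^3 * ((1 - D) * (D1 * D2 - N1 * N2) - N1 * D2 - N2 * D1 + 2 * N1 * N2)"
    unfolding nF_def Dp(1) using z1 z2 by algebra
  then have nF: "D1 * D2 * nF = u^3 * (- M * g * (1 + S) * (1 - l) * (D - S * d - D * q * l))"
    unfolding ids(1) .
  have "u * (D1 * D2 * dF) = u * (u * ((1 - d) * (D1 * D2 - N1 * N2) - 2 * D1 * D2 + N1 * D2 + N2 * D1))"
    unfolding dF_def using z1 z2 Dp(2) by algebra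
  then have dF: "D1 * D2 * dF = u * (- M * g * (1 + S - q * l) * D1)"
    unfolding ids(2) using uu(2) by (simp only: mult_cancel_left simp_thms not_False_eq_True)
  have ql: "1 + S - q * l = (1 + S) * (1 - of_real r * x)"
  proof -
    have "of_real r * x = (1 - \<kappa>) * l" unfolding xl r2[symmetric] by (simp add: power2_eq_square)
    then show ?thesis unfolding q by algebra
  qed
  have qlnz: "1 + S - q * l \<noteq> 0" unfolding ql using S1 nz by simp
  have "D1 * D2 * dF \<noteq> 0" unfolding dF using uu Mnz nf'(9) qlnz D1nz by simp
  then have "extremal_fun p u z1 z2 = (D1 * D2 * nF) / (D1 * D2 * dF)"
    unfolding extremal_fun_def nF_def dF_def by simp
  also have "\<dots> = u\<^sup>2 * ((1 + S) * (1 - l) * (D - S * d - D * q * l)) / ((1 + S - q * l) * D1)"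
  proof -
    have "(u * (- M * g)) * (u\<^sup>2 * ((1 + S) * (1 - l) * (D - S * d - D * q * l))) / ((u * (- M * g)) * ((1 + S - q * l) * D1))
       = u\<^sup>2 * ((1 + S) * (1 - l) * (D - S * d - D * q * l)) / ((1 + S - q * l) * D1)"
      using uu(2) Mnz nf'(9) by (intro mult_divide_mult_cancel_left) simp
    then show ?thesis unfolding nF dF by (simp add: algebra_simps power2_eq_square power3_eq_cube)
  qed
  also have "\<dots> = u\<^sup>2 * D * (of_real r * (1 - l) * (a - x)) / (d * (1 - of_real r * x) * (1 - cnj a * x))"
  proof -
    have "u\<^sup>2 * ((1 + S) * (1 - l) * (D - S * d - D * q * l)) = (1 + S)\<^sup>2 * (u\<^sup>2 * D * (of_real r * (1 - l) * (a - x)))"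
      unfolding e1[symmetric] by algebra
    moreover have "(1 + S - q * l) * D1 = (1 + S)\<^sup>2 * (d * (1 - of_real r * x) * (1 - cnj a * x))"
      unfolding ql e2[symmetric] by algebra
    moreover have "(1 + S)\<^sup>2 \<noteq> 0" using S1 by simp
    ultimately show ?thesis by (simp only: mult_divide_mult_cancel_left simp_thms not_False_eq_True)
  qed
  also have "\<dots> = - u * (disk_aut (of_real r * v) \<mu> * disk_aut (v * a) \<mu>)"
  proof -
    have "disk_aut (of_real r * v) \<mu> = v * ((of_real r - x) / (1 - of_real r * x))"
      using rotate[of "of_real r"] by (simp add: mult.commute)
    moreover have "of_real r - x = of_real r * (1 - l)" unfolding xl by algebra
    moreover have "- u * v\<^sup>2 = u\<^sup>2 * D / d" 
    proof -
      have "(- u * v\<^sup>2) * d = u\<^sup>2 * D" using nf'(11) by algebra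
      then show ?thesis using nonzero_eq_divide_eq[OF dnz] by blast
    qed
    moreover have "- u * (v * X * (v * Y)) = - u * v\<^sup>2 * (X * Y)" for X Y by algebra
    moreover have "u\<^sup>2 * D * (of_real r * (1 - l) * (a - x)) / (d * (1 - of_real r * x) * (1 - cnj a * x))
        = u\<^sup>2 * D / d * (of_real r * (1 - l) / (1 - of_real r * x) * ((a - x) / (1 - cnj a * x)))"
      by (simp only: times_divide_times_eq mult.assoc)
    ultimately show ?thesis unfolding rotate by (simp only:)
  qed
  finally show ?thesis .
qed

text \<open>
  The disk bound and the competitor \<open>log |F|\<close> coincide on the disk.  The poles are excluded because
  the right-hand side has the value \<open>ln 0 = 0\<close> there instead of \<open>-\<infinity>\<close>.
\<close>

lemma green_bidisk_on_disc:
  assumes p: "0 < p" "p < 1" and u: "cmod u = 1" and par: "disk_parameters p p u z \<alpha> \<beta> c \<omega> t"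
    and l: "cmod l < 1" and pt: "(z1, z2) = G_map z (phi_disk \<alpha> \<beta> \<omega> l)"
    and np: "(z1, z2) \<noteq> (of_real p, 0)" "(z1, z2) \<noteq> (0, of_real p)"
  shows "green_bidisk (z1, z2) (of_real p, 0) (0, of_real p) = ereal (ln (cmod (extremal_fun p u z1 z2)))"
proof -
  have m: "cmod \<alpha> < 1" "cmod \<beta> < 1" "cmod c < 1" "cmod \<omega> = 1"
    and e: "c * disk_aut \<alpha> c = of_real p" "\<omega> * c * disk_aut \<beta> c = z" "\<omega> * \<alpha> * disk_aut \<beta> \<alpha> = disk_aut z p"
    using par unfolding disk_parameters_def Let_def by auto
  have z1: "cmod z < 1"
  proof -
    have "cmod z = cmod c * cmod (disk_aut \<beta> c)" using e(2) m(4) by (auto simp: norm_mult)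
    also have "\<dots> < 1 * 1" using m cmod_disk_aut_less_1[of \<beta> c] by (intro mult_strict_mono') auto
    finally show ?thesis by simp
  qed
  define \<psi>1 where "\<psi>1 = (\<lambda>l. l * disk_aut \<alpha> l)"
  define \<psi>2 where "\<psi>2 = (\<lambda>l. disk_aut z (\<omega> * l * disk_aut \<beta> l))"
  have pt': "z1 = \<psi>1 l" "z2 = \<psi>2 l" using pt by (auto simp: G_map_def phi_disk_def \<psi>1_def \<psi>2_def)
  have blaschke: "cmod (k * l * disk_aut b l) < 1" if "cmod l < 1" "cmod b < 1" "cmod k = 1" for k l b
  proof -
    have "cmod (k * l * disk_aut b l) = cmod l * cmod (disk_aut b l)" using that by (simp add: norm_mult)
    also have "\<dots> < 1 * 1" using that cmod_disk_aut_less_1[of b l] by (intro mult_strict_mono') auto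
    finally show ?thesis by simp
  qed
  have into: "(\<psi>1 l, \<psi>2 l) \<in> bidisk" if "cmod l < 1" for l
    using blaschke[OF that m(1), of 1] cmod_disk_aut_less_1[OF z1 blaschke[OF that m(2,4)]]
    by (simp add: bidisk_def \<psi>1_def \<psi>2_def)
  have sub: "disk_aut b holomorphic_on ball 0 1" if "cmod b < 1" for b
    using disk_aut_holomorphic[OF that] by (rule holomorphic_on_subset) auto
  have hol1: "\<psi>1 holomorphic_on ball 0 1" unfolding \<psi>1_def by (intro holomorphic_intros sub m)
  have hol2: "\<psi>2 holomorphic_on ball 0 1" unfolding \<psi>2_def
  proof (rule holomorphic_on_compose_gen[OF _ sub[OF z1], unfolded o_def])
    show "(\<lambda>l. \<omega> * l * disk_aut \<beta> l) holomorphic_on ball 0 1" by (intro holomorphic_intros sub m)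
    show "(\<lambda>l. \<omega> * l * disk_aut \<beta> l) ` ball 0 1 \<subseteq> ball 0 1" using blaschke m by auto
  qed
  have Pc: "(of_real p, 0) = (\<psi>1 c, \<psi>2 c)"
    using e by (simp add: \<psi>1_def \<psi>2_def disk_aut_def)
  have Pa: "(0, of_real p) = (\<psi>1 \<alpha>, \<psi>2 \<alpha>)"
    using e(3) disk_aut_involution[OF z1, of "of_real p"] p by (simp add: \<psi>1_def \<psi>2_def) (simp add: disk_aut_def)
  have ca: "c \<noteq> \<alpha>" using e(1) p by (auto simp: disk_aut_def)
  have lc: "l \<noteq> c" "l \<noteq> \<alpha>" using np pt' Pc Pa by auto
  obtain s r v a b where nf: "normal_form p u s z r v a b"
    and n: "c = of_real r * v" "\<alpha> = v * a" "\<beta> = v * b" "\<omega> * v\<^sup>2 = u"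
    by (rule disk_parameters_normal_form[OF p u par]) blast
  have "extremal_fun p u z1 z2 = - u * (disk_aut c l * disk_aut \<alpha> l)"
    using extremal_fun_along_disc[OF p u nf n(4) l z1] unfolding pt' \<psi>1_def \<psi>2_def n by simp
  then have F: "cmod (extremal_fun p u z1 z2) = cmod (disk_aut c l * disk_aut \<alpha> l)"
    using u by (simp add: norm_mult)
  have Fnz: "extremal_fun p u z1 z2 \<noteq> 0"
    using F lc l m disk_aut_eq_0_iff[of c l] disk_aut_eq_0_iff[of \<alpha> l] by auto
  show ?thesis
  proof (rule antisym)
    show "green_bidisk (z1, z2) (of_real p, 0) (0, of_real p) \<le> ereal (ln (cmod (extremal_fun p u z1 z2)))"
      unfolding green_bidisk_def
    proof (rule Sup_least)
      fix x assume "x \<in> {f (z1, z2) |f. plurisubharmonic_on bidisk f \<and> (\<forall>y\<in>bidisk. f y < 0) \<and>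
          log_pole f (of_real p, 0) \<and> log_pole f (0, of_real p)}"
      then obtain f where f: "x = f (z1, z2)" "plurisubharmonic_on bidisk f" "\<And>y. y \<in> bidisk \<Longrightarrow> f y < 0"
        "log_pole f (of_real p, 0)" "log_pole f (0, of_real p)" by blast
      show "x \<le> ereal (ln (cmod (extremal_fun p u z1 z2)))"
        unfolding f(1) F unfolding pt'
        by (rule plurisubharmonic_disc_bound[OF f(2,3,4,5) hol1 hol2 into m(3,1) ca Pc Pa l lc])
    qed
    let ?f = "\<lambda>(z1, z2). elog (cmod (extremal_fun p u z1 z2))"
    have "?f (z1, z2) \<le> green_bidisk (z1, z2) (of_real p, 0) (0, of_real p)"
      unfolding green_bidisk_def
    proof (rule Sup_upper, intro CollectI exI[of _ ?f] conjI ballI refl)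
      show "plurisubharmonic_on bidisk ?f" by (rule log_extremal_plurisubharmonic[OF p u])
      show "log_pole ?f (of_real p, 0)" "log_pole ?f (0, of_real p)" by (rule log_extremal_poles[OF p u])+
      fix y assume y: "y \<in> bidisk"
      have "cmod (extremal_fun p u (fst y) (snd y)) < exp 0"
        using extremal_fun_bidisk(2)[OF p u, of "fst y" "snd y"] y by simp
      then have "elog (cmod (extremal_fun p u (fst y) (snd y))) < ereal 0" unfolding elog_less_iff .
      then show "?f y < 0" by (simp add: case_prod_beta zero_ereal_def)
    qed
    then show "ereal (ln (cmod (extremal_fun p u z1 z2))) \<le> green_bidisk (z1, z2) (of_real p, 0) (0, of_real p)"
      using Fnz by (simp add: elog_def)
  qed
qed

section \<open>The line of admissible points\<close>

text \<open>
  With \<open>x = z / u\<close> the equation reads \<open>d (1 - cnj x) = D (1 - x)\<close>, that is, \<open>(1 - x) / d\<close> is real.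
  Its sign comes from \<open>|x| < 1\<close>, since \<open>Re d > 0\<close>.
\<close>

lemma line_parameter:
  assumes p: "0 < p" "p < 1" and u: "cmod u = 1" and z: "cmod z < 1"
    and line: "cnj z * of_real p * u^4 - cnj z * u^3 - of_real p * u^3 + of_real p * u - of_real p * z + u * z = 0"
  obtains s where "0 < s" "z = u * (1 - of_real s * (1 - of_real p * u))"
proof -
  define d where "d = 1 - of_real p * u"
  have uu: "u * cnj u = 1" "u \<noteq> 0" using u complex_norm_square[of u] by auto
  have D: "cnj d = 1 - of_real p * cnj u" by (simp add: d_def)
  have "cmod (of_real p * u) < 1" using p u by (simp add: norm_mult)
  then have dnz: "d \<noteq> 0" by (auto simp: d_def)
  define x where "x = cnj u * z"
  have zx: "z = u * x" unfolding x_def using uu(1) by algebra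
  have zx': "cnj z = cnj u * cnj x" unfolding x_def complex_cnj_mult complex_cnj_cnj using uu(1) by algebra
  have "u\<^sup>2 * (d * (1 - cnj x)) = u\<^sup>2 * (cnj d * (1 - x))"
    using line unfolding zx' unfolding zx D unfolding d_def using uu(1) by algebra
  then have "d * (1 - cnj x) = cnj d * (1 - x)" using uu(2) by simp
  then have "cnj ((1 - x) / d) = (1 - x) / d" using dnz by (simp add: field_simps)
  then have "(1 - x) / d \<in> \<real>" by (simp add: Reals_cnj_iff)
  then obtain s where s: "(1 - x) / d = of_real s" by (auto elim: Reals_cases)
  then have xs: "x = 1 - of_real s * d" using dnz by (simp add: field_simps)
  have "(cmod x)\<^sup>2 < 1" using z u zx by (simp add: norm_mult power_less_one_iff)
  moreover have "(cmod x)\<^sup>2 = 1 - 2 * s * Re d + s\<^sup>2 * (cmod d)\<^sup>2"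
    unfolding xs cmod_power2 by (simp add: power2_eq_square algebra_simps)
  ultimately have "s\<^sup>2 * (cmod d)\<^sup>2 < 2 * (s * Re d)" by simp
  moreover have "0 \<le> s\<^sup>2 * (cmod d)\<^sup>2" by simp
  ultimately have "0 < s * Re d" by linarith
  moreover have "0 < Re d" using \<open>cmod (of_real p * u) < 1\<close> complex_Re_le_cmod[of "of_real p * u"] by (simp add: d_def)
  ultimately have "0 < s" by (simp add: zero_less_mult_iff)
  then show thesis using that[of s] xs zx by (simp add: d_def)
qed

lemma radius_on_line:
  assumes p: "0 < p" "p < 1" and u: "cmod u = 1" and s: "0 < s"
  defines "d \<equiv> 1 - of_real p * u"
  assumes z: "z = u * (1 - of_real s * d)"
  shows "(of_real p * u^2 * z - of_real p * u + of_real p * z - u * z) / (u * (of_real p * u^2 - 2 * u + z))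
    = of_real (1 - 2 * s * Re d / (1 + s))"
proof -
  have uu: "u * cnj u = 1" "u \<noteq> 0" using u complex_norm_square[of u] by auto
  have "cmod (of_real p * u) < 1" using p u by (simp add: norm_mult)
  then have dnz: "d \<noteq> 0" by (auto simp: d_def)
  have s1: "1 + complex_of_real s \<noteq> 0" using s by (metis add_pos_pos less_irrefl of_real_1 of_real_add of_real_eq_0_iff zero_less_one)
  have h: "complex_of_real (2 * Re d) = d + cnj d" by (simp add: complex_add_cnj)
  have D: "cnj d = 1 - of_real p * cnj u" by (simp add: d_def)
  have den: "u * (of_real p * u^2 - 2 * u + z) = - (u\<^sup>2 * d) * (1 + of_real s)"
    unfolding z unfolding d_def by algebra
  have num: "of_real p * u^2 * z - of_real p * u + of_real p * z - u * z
     = - (u\<^sup>2 * d) * (1 + of_real s - of_real s * (d + cnj d))"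
    unfolding z D unfolding d_def using uu(1) by algebra
  have "(of_real p * u^2 * z - of_real p * u + of_real p * z - u * z) / (u * (of_real p * u^2 - 2 * u + z))
    = (1 + of_real s - of_real s * (d + cnj d)) / (1 + of_real s)"
    unfolding den num using uu(2) dnz by (intro mult_divide_mult_cancel_left) simp
  also have "\<dots> = 1 - of_real s * (d + cnj d) / (1 + of_real s)" using s1 by (simp add: diff_divide_distrib)
  also have "\<dots> = of_real (1 - 2 * s * Re d / (1 + s))" by (simp flip: h add: mult_ac)
  finally show ?thesis .
qed

lemma cmod_less_1_if_scaled:
  assumes "0 < r" "0 < r\<^sup>2 - (cmod (1 - w))\<^sup>2" "of_real r * a = 1 - w"
  shows "cmod a < 1"
proof -
  have "r * cmod a = cmod (1 - w)"
    using assms(1) unfolding assms(3)[symmetric] by (simp add: norm_mult)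
  then have "(r * cmod a)\<^sup>2 < r\<^sup>2" using assms(2) by simp
  then have "r * cmod a < r * 1"
    unfolding mult_1_right by (rule power_less_imp_less_base) (rule less_imp_le[OF assms(1)])
  then show ?thesis by (rule mult_less_cancel_left_pos[OF assms(1), THEN iffD1])
qed

text \<open>
  The normal form forces \<open>r\<close>, \<open>a\<close>, \<open>b\<close> and, up to sign, \<open>v\<close>; the point is that \<open>a\<close> and \<open>b\<close>
  lie in the disk.  Because \<open>p\<^sup>2 = 1 - 2 Re d + |d|\<^sup>2\<close>, the bound \<open>p\<^sup>2 < r\<^sup>2\<close> is equivalent to
  \<open>(1 + s) |d|\<^sup>2 < 2 Re d\<close>, and both \<open>r\<^sup>2 (1 - |a|\<^sup>2)\<close> and \<open>r\<^sup>2 (1 - |b|\<^sup>2)\<close> are positive multiples of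
  the difference of its two sides.
\<close>

lemma normal_form_exists:
  assumes p: "0 < p" "p < 1" and u: "cmod u = 1" and s: "0 < s"
  defines "d \<equiv> 1 - of_real p * u"
  assumes z: "z = u * (1 - of_real s * d)" and rad: "p\<^sup>2 < 1 - 2 * s * Re d / (1 + s)"
  obtains r v a b where "normal_form p u s z r v a b" "(1 + s) * (cmod d)\<^sup>2 < 2 * Re d"
proof -
  define D where "D = cnj d"
  define N2 where "N2 = (cmod d)\<^sup>2"
  define hr where "hr = 2 * Re d"
  have uu: "u * cnj u = 1" "u \<noteq> 0" using u complex_norm_square[of u] by auto
  have "cmod (of_real p * u) < 1" using p u by (simp add: norm_mult)
  then have dnz: "d \<noteq> 0" by (auto simp: d_def)
  have N2: "0 < N2" "complex_of_real N2 = d * D" using dnz complex_norm_square[of d] by (auto simp: N2_def D_def)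
  have hr: "complex_of_real hr = d + D" by (simp add: hr_def D_def complex_add_cnj)
  have hpos: "0 < hr" using \<open>cmod (of_real p * u) < 1\<close> complex_Re_le_cmod[of "of_real p * u"] by (simp add: hr_def d_def)
  define \<kappa> where "\<kappa> = s * hr / (1 + s)"
  have \<kappa>: "0 < \<kappa>" "\<kappa> * (1 + s) = s * hr" using s hpos by (auto simp: \<kappa>_def)
  have pN: "p\<^sup>2 = 1 - hr + N2"
  proof -
    have "(Re u)\<^sup>2 + (Im u)\<^sup>2 = 1" using u cmod_power2[of u] by simp
    then show ?thesis unfolding hr_def N2_def d_def cmod_power2 by (simp add: power2_eq_square) algebra
  qed
  have "p\<^sup>2 < 1 - \<kappa>" using rad by (simp add: \<kappa>_def hr_def mult_ac)
  then have k1: "\<kappa> < 1" using zero_le_power2[of p] by linarith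
  have "N2 < hr - \<kappa>" using \<open>p\<^sup>2 < 1 - \<kappa>\<close> pN by simp
  moreover have hk: "(hr - \<kappa>) * (1 + s) = hr" using \<kappa>(2) by (simp add: algebra_simps)
  ultimately have key: "(1 + s) * N2 < hr" using s by (metis add_pos_pos mult.commute mult_strict_left_mono zero_less_one)
  define gr where "gr = hr - s * N2"
  have gr: "0 < gr" using key N2 by (simp add: gr_def algebra_simps)
  have gr': "complex_of_real gr = d + D - of_real s * d * D" by (simp add: gr_def hr N2)
  define r where "r = sqrt (1 - \<kappa>)"
  have r: "0 < r" "r < 1" "r\<^sup>2 = 1 - \<kappa>" using k1 \<kappa> by (auto simp: r_def)
  define v where "v = csqrt (- (u * D) / d)"
  have v2: "v\<^sup>2 = - (u * D) / d" by (simp add: v_def)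
  have "cmod (v\<^sup>2) = 1" unfolding v2 using dnz u by (simp add: norm_mult norm_divide D_def)
  then have v: "cmod v = 1" by (simp add: norm_power power2_eq_1_iff) (metis norm_ge_zero neg_0_le_iff_le not_one_le_zero)
  define a where "a = (1 - of_real \<kappa> / D) / of_real r"
  define b where "b = (1 - of_real \<kappa> * d / of_real gr) / of_real r"
  have rnz: "complex_of_real r \<noteq> 0" using r by simp
  have Dnz: "D \<noteq> 0" using dnz by (simp add: D_def)
  have ra: "of_real r * a = 1 - of_real \<kappa> / D" "of_real r * b = 1 - of_real \<kappa> * d / of_real gr"
    using rnz by (auto simp: a_def b_def)
  have sqd: "(cmod (1 - w))\<^sup>2 = 1 - 2 * Re w + (cmod w)\<^sup>2" for w
    unfolding cmod_power2 by (simp add: power2_eq_square algebra_simps)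
  have scaled: "Re (of_real y * d) = y * (hr / 2)" "(cmod (of_real y * d))\<^sup>2 = y\<^sup>2 * N2" for y
    by (simp_all add: hr_def N2_def norm_mult power_mult_distrib)
  have a1: "cmod a < 1"
  proof (rule cmod_less_1_if_scaled[OF r(1) _ ra(1)])
    have "of_real \<kappa> / D = of_real (\<kappa> / N2) * d" using dnz Dnz by (simp add: N2)
    then have "Re (of_real \<kappa> / D) = \<kappa> / N2 * (hr / 2)" "(cmod (of_real \<kappa> / D))\<^sup>2 = (\<kappa> / N2)\<^sup>2 * N2"
      by (simp_all only: scaled)
    then have "r\<^sup>2 - (cmod (1 - of_real \<kappa> / D))\<^sup>2 = \<kappa> / N2 * (hr - \<kappa> - N2)"
      unfolding sqd r(3) using N2(1) by (simp add: field_simps power2_eq_square)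
    moreover have "0 < \<kappa> / N2 * (hr - \<kappa> - N2)" using \<kappa> N2(1) \<open>N2 < hr - \<kappa>\<close> by simp
    ultimately show "0 < r\<^sup>2 - (cmod (1 - of_real \<kappa> / D))\<^sup>2" by simp
  qed
  have b1: "cmod b < 1"
  proof (rule cmod_less_1_if_scaled[OF r(1) _ ra(2)])
    have "of_real \<kappa> * d / of_real gr = of_real (\<kappa> / gr) * d" by simp
    then have "Re (of_real \<kappa> * d / of_real gr) = \<kappa> / gr * (hr / 2)" "(cmod (of_real \<kappa> * d / of_real gr))\<^sup>2 = (\<kappa> / gr)\<^sup>2 * N2"
      by (simp_all only: scaled)
    then have "r\<^sup>2 - (cmod (1 - of_real \<kappa> * d / of_real gr))\<^sup>2 = \<kappa> / gr\<^sup>2 * (hr * gr - gr\<^sup>2 - \<kappa> * N2)"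
      unfolding sqd r(3) using gr by (simp add: field_simps power2_eq_square)
    also have "hr * gr - gr\<^sup>2 - \<kappa> * N2 = N2 * (s * gr - \<kappa>)" unfolding gr_def by (simp add: power2_eq_square algebra_simps)
    also have "s * gr - \<kappa> = s * s * (hr - \<kappa> - N2)"
      using \<kappa>(2) hk unfolding gr_def by algebra
    finally have "r\<^sup>2 - (cmod (1 - of_real \<kappa> * d / of_real gr))\<^sup>2 = \<kappa> / gr\<^sup>2 * (N2 * (s * s * (hr - \<kappa> - N2)))" .
    moreover have "0 < \<kappa> / gr\<^sup>2 * (N2 * (s * s * (hr - \<kappa> - N2)))" using \<kappa> N2(1) gr s \<open>N2 < hr - \<kappa>\<close> by simp
    ultimately show "0 < r\<^sup>2 - (cmod (1 - of_real \<kappa> * d / of_real gr))\<^sup>2" by simp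
  qed
  have "normal_form p u s z r v a b"
    unfolding normal_form_def Let_def d_def[symmetric] D_def[symmetric] gr'[symmetric] r(3)
  proof (intro conjI r(1,2) s v a1 b1 z)
    show "complex_of_real (1 - (1 - \<kappa>)) * of_real (1 + s) = of_real s * (d + D)"
      unfolding hr[symmetric] of_real_mult[symmetric] of_real_eq_iff using \<kappa>(2) by simp
    show "(1 - of_real r * a) * D = of_real (1 - (1 - \<kappa>))" using Dnz by (simp add: ra)
    show "complex_of_real gr \<noteq> 0" using gr by simp
    then show "(1 - of_real r * b) * of_real gr = of_real (1 - (1 - \<kappa>)) * d" by (simp add: ra)
    show "v\<^sup>2 * d = - (u * D)" using dnz by (simp add: v2)
  qed
  then show thesis using that key by (simp add: N2_def hr_def)
qed

text \<open>
  Converse of \<open>disk_parameters_normal_form\<close>.  The weight \<open>t = s |d|\<^sup>2 / (2 Re d)\<close> is the solution of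
  \<open>(1 - t) (N + a r cnj N) = r (1 - |a|\<^sup>2)\<close> with \<open>N = b - a\<close>; it satisfies \<open>(1 - t) h = g\<close>.
\<close>

lemma normal_form_disk_parameters:
  assumes p: "0 < p" "p < 1" and u: "cmod u = 1" and nf: "normal_form p u s z r v a b"
  defines "d \<equiv> 1 - of_real p * u"
  assumes key: "(1 + s) * (cmod d)\<^sup>2 < 2 * Re d" and z1: "cmod z < 1"
  shows "disk_parameters p p u z (v * a) (v * b) (of_real r * v) (u / v\<^sup>2) (s * (cmod d)\<^sup>2 / (2 * Re d))"
proof -
  define D where "D = cnj d"
  define h where "h = d + D"
  define S where "S = complex_of_real s"
  define g where "g = h - S * d * D"
  define \<kappa> where "\<kappa> = complex_of_real (1 - r\<^sup>2)"
  have nf': "0 < r" "r < 1" "0 < s" "cmod v = 1" "cmod a < 1" "cmod b < 1"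
    "\<kappa> * (1 + S) = S * h" "(1 - of_real r * a) * D = \<kappa>" "g \<noteq> 0" "(1 - of_real r * b) * g = \<kappa> * d"
    "v\<^sup>2 * d = - (u * D)" "z = u * (1 - S * d)"
    using nf unfolding normal_form_def Let_def d_def[symmetric] D_def[symmetric]
      h_def[symmetric] S_def[symmetric] g_def[symmetric] \<kappa>_def[symmetric] by (auto simp: S_def)
  have uu: "u * cnj u = 1" "u \<noteq> 0" using u complex_norm_square[of u] by auto
  have vv: "v * cnj v = 1" "v \<noteq> 0" using nf'(4) complex_norm_square[of v] by auto
  define R where "R = complex_of_real r"
  define P where "P = complex_of_real p"
  have R: "R \<noteq> 0" "R\<^sup>2 = 1 - \<kappa>" "cnj R = R" using nf'(1) by (simp_all add: R_def \<kappa>_def)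
  note nf'' = nf'(7,8,9,10,11,12)[folded R_def]
  have dD: "D = 1 - P * cnj u" "d = 1 - P * u" by (auto simp: d_def D_def P_def)
  have cmp: "cmod (of_real p * u) < 1" using p u by (simp add: norm_mult)
  have dnz: "d \<noteq> 0" using cmp by (auto simp: d_def)
  have Dnz: "D \<noteq> 0" using dnz by (simp add: D_def)
  have dpos: "0 < Re d" using cmp complex_Re_le_cmod[of "of_real p * u"] by (simp add: d_def)
  have hr: "h = of_real (2 * Re d)" by (simp add: h_def D_def complex_add_cnj)
  have cnjs: "cnj D = d" "cnj d = D" "cnj h = h" "cnj g = g" "cnj \<kappa> = \<kappa>" "cnj S = S"
    by (simp_all add: D_def h_def g_def \<kappa>_def S_def algebra_simps)
  have a': "(1 - R * cnj a) * d = \<kappa>" using arg_cong[OF nf''(2), of cnj] by (simp add: cnjs R)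
  have b': "(1 - R * cnj b) * g = \<kappa> * D" using arg_cong[OF nf''(4), of cnj] by (simp add: cnjs R)
  have ra0: "D * (R * a) = D - \<kappa>" unfolding nf''(2)[symmetric] by algebra
  have S1: "1 + S = of_real (1 + s)" by (simp add: S_def)
  have S1nz: "1 + S \<noteq> 0" unfolding S1 of_real_eq_0_iff using nf'(3) by simp
  define t where "t = s * (cmod d)\<^sup>2 / (2 * Re d)"
  have "(1 + s) * (cmod d)\<^sup>2 = (cmod d)\<^sup>2 + s * (cmod d)\<^sup>2" by (simp add: algebra_simps)
  then have "s * (cmod d)\<^sup>2 < 2 * Re d" using key zero_le_power2[of "cmod d"] by linarith
  then have t: "0 < t" "t < 1" using nf'(3) dpos dnz by (auto simp: t_def)
  have th: "(1 - of_real t) * h = g"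
  proof -
    have "t * (2 * Re d) = s * (cmod d)\<^sup>2" using dpos by (simp add: t_def)
    then have "of_real t * h = S * (d * D)"
      unfolding hr S_def D_def complex_norm_square[symmetric] of_real_mult[symmetric] by simp
    then show ?thesis unfolding g_def by algebra
  qed
  have hnz: "h \<noteq> 0" unfolding hr using dpos by simp
  define g0 where "g0 = of_real t * a + (1 - of_real t) * b"
  have g01: "cmod g0 < 1"
  proof -
    have tt: "1 - complex_of_real t = of_real (1 - t)" "\<bar>t\<bar> = t" "\<bar>1 - t\<bar> = 1 - t" using t by auto
    have "cmod g0 \<le> t * cmod a + (1 - t) * cmod b"
      using norm_triangle_ineq[of "of_real t * a" "(1 - of_real t) * b"]
      by (simp only: g0_def norm_mult norm_of_real tt)
    also have "\<dots> < t * 1 + (1 - t) * 1"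
      using t nf' by (intro add_strict_mono mult_strict_left_mono) auto
    finally show ?thesis by simp
  qed
  have E1: "a * (1 - cnj g0 * R) = g0 - R"
  proof -
    have rd1: "D * (R * a) = D - \<kappa>" unfolding nf''(2)[symmetric] by algebra
    have rd2: "d * (R * cnj a) = d - \<kappa>" unfolding a'[symmetric] by algebra
    note rd = rd1 rd2
    have X: "(1 + S) * (h * (h - \<kappa> - d * D) - (h - \<kappa>) * (g - d * D)) = 0"
      using nf''(1) unfolding g_def by algebra
    have "(d * D) * (h * (R\<^sup>2 - (R * a) * (R * cnj a)) - g * ((R * b - R * a) + (R * a) * (R * cnj b - R * cnj a)))
      = h * (d * D * R\<^sup>2 - (D * (R * a)) * (d * (R * cnj a)))
        - (d * (D * ((1 - R * a) * g) - D * ((1 - R * b) * g)) + (D * (R * a)) * (d * ((1 - R * cnj a) * g) - d * ((1 - R * cnj b) * g)))"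
      by algebra
    also have "\<dots> = h * (d * D * (1 - \<kappa>) - (D - \<kappa>) * (d - \<kappa>)) - (d * (\<kappa> * g - D * (\<kappa> * d)) + (D - \<kappa>) * (\<kappa> * g - d * (\<kappa> * D)))"
    proof -
      have k1: "D * ((1 - R * a) * g) = \<kappa> * g" unfolding nf''(2)[symmetric] by algebra
      have k2: "d * ((1 - R * cnj a) * g) = \<kappa> * g" unfolding a'[symmetric] by algebra
      show ?thesis by (simp only: rd k1 k2 nf''(4) b' R(2))
    qed
    also have "\<dots> = \<kappa> * (h * (h - \<kappa> - d * D) - (h - \<kappa>) * (g - d * D))"
      unfolding h_def by algebra
    also have "\<dots> = 0" using X S1nz by simp
    finally have Y: "h * (R\<^sup>2 - (R * a) * (R * cnj a)) - g * ((R * b - R * a) + (R * a) * (R * cnj b - R * cnj a)) = 0"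
      using dnz Dnz by simp
    have "(h * R) * (a * (1 - cnj g0 * R) - (g0 - R)) =
        h * (R\<^sup>2 - (R * a) * (R * cnj a)) - ((1 - of_real t) * h) * ((R * b - R * a) + (R * a) * (R * cnj b - R * cnj a))"
      unfolding g0_def by (simp add: ) algebra
    also have "\<dots> = 0" unfolding th by (rule Y)
    finally have "a * (1 - cnj g0 * R) - (g0 - R) = 0" using hnz R(1) by simp
    then show ?thesis by simp
  qed
  have P1: "disk_aut (v * g0) (R * v) = v * a"
  proof -
    have "1 - cnj g0 * R \<noteq> 0"
      using disk_aut_denominator_nz[OF g01, of R] nf' by (simp add: R_def)
    moreover have den: "1 - cnj (v * g0) * (R * v) = 1 - cnj g0 * R"
      unfolding complex_cnj_mult using vv(1) by algebra
    moreover have num: "v * g0 - R * v = v * a * (1 - cnj g0 * R)" unfolding mult.assoc E1 by algebra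
    ultimately show ?thesis unfolding disk_aut_def den num by simp
  qed
  have nza: "1 - cnj a * R \<noteq> 0" and nzb: "1 - cnj b * R \<noteq> 0" and nzab: "1 - cnj b * a \<noteq> 0"
    using disk_aut_denominator_nz[of a R] disk_aut_denominator_nz[of b R] disk_aut_denominator_nz[of b a] nf' by (auto simp: R_def)
  have P2: "(R * v) * disk_aut (v * a) (R * v) = P"
  proof -
    have "d * ((R * v) * (v * a - R * v)) = v\<^sup>2 * d * (R * a - R\<^sup>2)" by algebra
    also have "\<dots> = - u * (D * (R * a) - D * R\<^sup>2)" unfolding nf''(5) by algebra
    also have "\<dots> = - u * \<kappa> * (D - 1)" unfolding R(2) ra0 by algebra
    also have "\<dots> = P * \<kappa>" unfolding dD(1) using uu(1) by algebra
    also have "\<dots> = d * (P * (1 - cnj a * R))" unfolding a'[symmetric] by algebra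
    finally have num: "(R * v) * (v * a - R * v) = P * (1 - cnj a * R)"
      using dnz by (simp only: mult_cancel_left simp_thms)
    have den: "1 - cnj (v * a) * (R * v) = 1 - cnj a * R" unfolding complex_cnj_mult using vv(1) by algebra
    show ?thesis unfolding disk_aut_def den times_divide_eq_right num using nza by simp
  qed
  have P3: "(u / v\<^sup>2) * (R * v) * disk_aut (v * b) (R * v) = z"
  proof -
    have "g * (u * (R * b - R\<^sup>2)) = g * (z * (1 - cnj b * R))"
    proof -
      have "g * (u * (R * b - R\<^sup>2)) = u * (g * (1 - R\<^sup>2) - (1 - R * b) * g)" by algebra
      also have "\<dots> = u * \<kappa> * (g - d)" unfolding nf''(4) R(2) by algebra
      also have "\<dots> = z * ((1 - R * cnj b) * g)" unfolding b' unfolding nf''(6) g_def h_def by algebra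
      finally show ?thesis by (simp add: mult_ac)
    qed
    then have e: "u * (R * b - R\<^sup>2) = z * (1 - cnj b * R)" using nf''(3) by (simp only: mult_cancel_left simp_thms)
    have den: "1 - cnj (v * b) * (R * v) = 1 - cnj b * R" unfolding complex_cnj_mult using vv(1) by algebra
    have num: "(u / v\<^sup>2) * (R * v) * (v * b - R * v) = z * (1 - cnj b * R)"
      unfolding e[symmetric] using vv(2) by (simp add: power2_eq_square right_diff_distrib mult_ac)
    show ?thesis unfolding disk_aut_def den times_divide_eq_right num using nzb by simp
  qed
  have P4: "(u / v\<^sup>2) * (v * a) * disk_aut (v * b) (v * a) = disk_aut z P"
  proof -
    have nzz: "1 - cnj z * P \<noteq> 0" using disk_aut_denominator_nz[OF z1, of P] p by (simp add: P_def)
    have zc: "cnj z = cnj u * (1 - S * D)" unfolding nf''(6) by (simp add: cnjs)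
    have ra: "D * (R * a) = D - \<kappa>" unfolding nf''(2)[symmetric] by algebra
    have zP: "z - P = u * (D - S * d)" unfolding nf''(6) dD(1) using uu(1) by algebra
    have zP': "1 - cnj z * P = D * (1 + S - S * D)" unfolding zc dD(1) by algebra
    have "(D\<^sup>2 * g * R\<^sup>2) * (u * a * (b - a) * (1 - cnj z * P))
       = u * (D * (R * a)) * (D * ((1 - R * a) * g) - D * ((1 - R * b) * g)) * (1 - cnj z * P)" by algebra
    also have "\<dots> = u * (D - \<kappa>) * (\<kappa> * g - D * (\<kappa> * d)) * (D * (1 + S - S * D))"
    proof -
      have k1: "D * ((1 - R * a) * g) = \<kappa> * g" unfolding nf''(2)[symmetric] by algebra
      show ?thesis by (simp only: ra k1 nf''(4) zP')
    qed
    finally have L: "(D\<^sup>2 * g * R\<^sup>2) * (u * a * (b - a) * (1 - cnj z * P)) = u * (D - \<kappa>) * (\<kappa> * g - D * (\<kappa> * d)) * (D * (1 + S - S * D))" .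
    have "(D\<^sup>2 * g * R\<^sup>2) * ((z - P) * (1 - cnj b * a)) = (z - P) * D * (D * g * R\<^sup>2 - (D * (R * a)) * (g - (1 - R * cnj b) * g))"
      by algebra
    also have "\<dots> = u * (D - S * d) * D * (D * g * (1 - \<kappa>) - (D - \<kappa>) * (g - \<kappa> * D))"
      unfolding ra b' R(2) zP ..
    finally have Rr: "(D\<^sup>2 * g * R\<^sup>2) * ((z - P) * (1 - cnj b * a)) = u * (D - S * d) * D * (D * g * (1 - \<kappa>) - (D - \<kappa>) * (g - \<kappa> * D))" .
    have i1: "(1 + S) * (D - \<kappa>) = D - S * d" using nf''(1) unfolding h_def by algebra
    have i2: "(1 + S) * (D * g * (1 - \<kappa>) - (D - \<kappa>) * (g - \<kappa> * D)) = (\<kappa> * g - D * (\<kappa> * d)) * (1 + S - S * D)"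
      using nf''(1) unfolding g_def h_def by algebra
    have "(1 + S) * (u * (D - \<kappa>) * (\<kappa> * g - D * (\<kappa> * d)) * (D * (1 + S - S * D)))
       = (1 + S) * (u * (D - S * d) * D * (D * g * (1 - \<kappa>) - (D - \<kappa>) * (g - \<kappa> * D)))"
      using i1 i2 by algebra
    then have "(D\<^sup>2 * g * R\<^sup>2) * (u * a * (b - a) * (1 - cnj z * P)) = (D\<^sup>2 * g * R\<^sup>2) * ((z - P) * (1 - cnj b * a))"
      unfolding L Rr using S1nz by (simp only: mult_cancel_left simp_thms)
    moreover have nz2: "D\<^sup>2 * g * R\<^sup>2 \<noteq> 0" using Dnz nf''(3) R(1) by simp
    ultimately have e: "u * a * (b - a) * (1 - cnj z * P) = (z - P) * (1 - cnj b * a)"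
      using nz2 by (simp only: mult_cancel_left simp_thms)
    have den: "1 - cnj (v * b) * (v * a) = 1 - cnj b * a" unfolding complex_cnj_mult using vv(1) by algebra
    have num: "(u / v\<^sup>2) * (v * a) * (v * b - v * a) = u * a * (b - a)"
      using vv(2) by (simp add: power2_eq_square right_diff_distrib mult_ac)
    show ?thesis unfolding disk_aut_def den times_divide_eq_right num
      by (rule frac_eq_eq[OF nzab nzz, THEN iffD2, OF e])
  qed
  have vg: "of_real t * (v * a) + (1 - of_real t) * (v * b) = v * g0" unfolding g0_def by algebra
  show ?thesis
    unfolding disk_parameters_def Let_def t_def[symmetric] vg
    using P1 P2 P3 P4 nf'(1-6) u t vv(2)
    by (auto simp: R_def P_def norm_mult norm_divide norm_power intro!: exI[of _ r] exI[of _ v])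
qed

text \<open>
  For \<open>q = p\<close> the quadratic equation defining \<open>A(u)\<close> is a product of two real lines, one of which is
  the line considered here.  On it the expressions \<open>R\<close> and \<open>T\<close> reduce to \<open>r\<^sup>2\<close> and to the weight \<open>t\<close> of
  the disk.  A real \<open>z\<close> would make \<open>R\<close> vanish.  For \<open>u = 1\<close> and \<open>u = -1\<close> the line is the real axis and
  the bound \<open>p\<^sup>2 < r\<^sup>2\<close> gives the end point \<open>-p\<close> of the interval.
\<close>

lemma point_on_line_in_A_set:
  assumes p: "0 < p" "p < 1" and u: "cmod u = 1" and s: "0 < s"
  defines "d \<equiv> 1 - of_real p * u"
  assumes z: "z = u * (1 - of_real s * d)" and z1: "cmod z < 1"
    and rad: "max (p\<^sup>2) ((cmod z)\<^sup>2) < 1 - 2 * s * Re d / (1 + s)"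
  shows "z \<in> A_set p p u"
proof -
  define D where "D = cnj d"
  define S where "S = complex_of_real s"
  define P where "P = complex_of_real p"
  have uu: "u * cnj u = 1" "u \<noteq> 0" using u complex_norm_square[of u] by auto
  have "cmod (of_real p * u) < 1" using p u by (simp add: norm_mult)
  then have dnz: "d \<noteq> 0" and dpos: "0 < Re d"
    using complex_Re_le_cmod[of "of_real p * u"] by (auto simp: d_def)
  have Dnz: "D \<noteq> 0" using dnz by (simp add: D_def)
  have Pnz: "P \<noteq> 0" using p by (simp add: P_def)
  have Snz: "S \<noteq> 0" using s by (simp add: S_def)
  have S1: "1 + S = of_real (1 + s)" by (simp add: S_def)
  have S1nz: "1 + S \<noteq> 0" unfolding S1 of_real_eq_0_iff using s by simp
  have dD: "d = 1 - P * u" "D = 1 - P * cnj u" by (auto simp: d_def D_def P_def)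
  have z': "z = u * (1 - S * d)" "cnj z = cnj u * (1 - S * D)" unfolding z S_def D_def by simp_all
  have rad': "(1 + s) * p\<^sup>2 < 1 + s - 2 * s * Re d"
  proof -
    have "p\<^sup>2 < 1 - 2 * s * Re d / (1 + s)" using rad by simp
    then have "p\<^sup>2 < (1 + s - 2 * s * Re d) / (1 + s)" using s by (simp add: diff_divide_distrib)
    then show ?thesis using s by (simp add: pos_less_divide_eq mult.commute)
  qed
  have rad1: "2 * s * Re d / (1 + s) > 0" using s dpos by simp
  consider "u = 1" | "u = -1" | "u \<noteq> 1" "u \<noteq> -1" by blast
  then show ?thesis
  proof cases
    case 1
    have zr: "z = of_real (1 - s * (1 - p))" using z by (simp add: 1 d_def)
    have "- 1 < 1 - s * (1 - p)" "1 - s * (1 - p) < 1" using z1 unfolding zr norm_of_real by auto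
    moreover have "- p < 1 - s * (1 - p)"
    proof -
      have "(1 + s) * p\<^sup>2 < 1 + s - 2 * s * (1 - p)" using rad' by (simp add: d_def 1)
      then have "0 < (1 - p) * (1 + p - s * (1 - p))" by (simp add: power2_eq_square algebra_simps)
      then show ?thesis using p by (simp add: zero_less_mult_iff)
    qed
    ultimately have "1 - s * (1 - p) \<in> {x. -1 < x \<and> x < 1 \<and> -p < x \<and> x < min 1 (p/p)}" using p by simp
    then have "z \<in> complex_of_real ` {x. -1 < x \<and> x < 1 \<and> -p < x \<and> x < min 1 (p/p)}" unfolding zr by (rule imageI)
    moreover have "A_set p p 1 = complex_of_real ` {x. -1 < x \<and> x < 1 \<and> -p < x \<and> x < min 1 (p/p)}"
      unfolding A_set_def by (rule if_P) simp
    ultimately show ?thesis unfolding 1 by (simp only:)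
  next
    case 2
    have zr: "z = of_real (- 1 + s * (1 + p))" using z by (simp add: 2 d_def)
    have "- 1 < - 1 + s * (1 + p)" "- 1 + s * (1 + p) < 1" using z1 unfolding zr norm_of_real by auto
    moreover have "- 1 + s * (1 + p) < - p"
    proof -
      have "(1 + s) * p\<^sup>2 < 1 + s - 2 * s * (1 + p)" using rad' by (simp add: d_def 2)
      then have "0 < (1 + p) * (1 - p - s * (1 + p))" by (simp add: power2_eq_square algebra_simps)
      then show ?thesis using p by (simp add: zero_less_mult_iff)
    qed
    ultimately have "- 1 + s * (1 + p) \<in> {x. -1 < x \<and> x < 1 \<and> max (-1) (-p/p) < x \<and> x < -p}" using p by simp
    then have "z \<in> complex_of_real ` {x. -1 < x \<and> x < 1 \<and> max (-1) (-p/p) < x \<and> x < -p}" unfolding zr by (rule imageI)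
    moreover have "A_set p p (-1) = complex_of_real ` {x. -1 < x \<and> x < 1 \<and> max (-1) (-p/p) < x \<and> x < -p}"
      unfolding A_set_def by (rule trans[OF if_not_P if_P]) simp_all
    ultimately show ?thesis unfolding 2 by (simp only:)
  next
    case 3
    have u2: "u\<^sup>2 - 1 \<noteq> 0" using 3 by (metis eq_iff_diff_eq_0 power2_eq_1_iff)
    define h where "h = d + D"
    have h: "h = of_real (2 * Re d)" by (simp add: h_def D_def complex_add_cnj)
    have hnz: "h \<noteq> 0" unfolding h using dpos by simp
    have n: "complex_of_real ((cmod z)\<^sup>2) = z * cnj z" by (rule complex_norm_square)
    have zbz: "u * (cnj z - z) = - (u\<^sup>2 - 1) * (1 + S - S * h)"
      unfolding z'(2) unfolding z'(1) h_def dD using uu(1) by algebra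
    have zbz': "cnj z * u\<^sup>2 - z = - S * P * (u\<^sup>2 - 1)"
      unfolding z'(2) unfolding z'(1) dD using uu(1) by algebra
    have nonreal: "z \<notin> complex_of_real ` {-1<..<1}"
    proof
      assume "z \<in> complex_of_real ` {-1<..<1}"
      then have "cnj z - z = 0" by auto
      then have "1 + S - S * h = 0" using zbz u2 by simp
      then have "of_real (1 + s - 2 * s * Re d) = (0 :: complex)" by (simp add: S_def h mult_ac)
      then have "1 + s - 2 * s * Re d = 0" unfolding of_real_eq_0_iff .
      then show False using rad' s p zero_le_power2[of p] by (metis add_nonneg_nonneg less_eq_real_def mult_nonneg_nonneg not_less zero_le_one)
    qed
    have curve: "(u - z) * (cnj z * u - 1) * (u^2 - 1)^2 * P^2 - (u - P) * (cnj z * u^2 - z)^2 * (P * u - 1) = 0"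
      unfolding zbz' unfolding z'(2) unfolding z'(1) dD using uu(1) by algebra
    have uz1: "u - z = u * S * d" unfolding z'(1) by algebra
    have uz2: "cnj z * u - 1 = - S * D" unfolding z'(2) using uu(1) by algebra
    note uz = uz1 uz2
    have R: "R_expr P u z = of_real (1 - 2 * s * Re d / (1 + s))"
    proof -
      have den: "cnj z*P^2*u^2 - z * cnj z*P*u^2 + cnj z*u^2 - P*u^2 - 2*cnj z*P*u + 2*P*u*z + P*(z * cnj z) - P^2*z + P - z
          = - (S * (1 + S) * (u\<^sup>2 - 1) * P * d * D)"
        unfolding z'(2) unfolding z'(1) dD using uu(1) by algebra
      have "u * ((u - P) * (cnj z - z) * (cnj z * u^2 - z) * (u * P - 1)) =
          u * ((- (S * P * d * D * (u\<^sup>2 - 1)\<^sup>2)) * (1 + S - S * h))"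
      proof -
        have uP: "u - P = u * D" unfolding dD using uu(1) by algebra
        have uP': "u * P - 1 = - d" unfolding dD by algebra
        show ?thesis unfolding zbz' uP uP' using zbz by algebra
      qed
      then have num: "(u - P) * (cnj z - z) * (cnj z * u^2 - z) * (u * P - 1) =
          (- (S * P * d * D * (u\<^sup>2 - 1)\<^sup>2)) * (1 + S - S * h)"
        using uu(2) by (simp only: mult_cancel_left simp_thms)
      have "R_expr P u z = ((- (S * P * d * D * (u\<^sup>2 - 1)\<^sup>2)) * (1 + S - S * h)) / ((- (S * P * d * D * (u\<^sup>2 - 1)\<^sup>2)) * (1 + S))"
        unfolding R_expr_def Let_def n num den by (simp add: power2_eq_square mult_ac)
      also have "\<dots> = (1 + S - S * h) / (1 + S)"
        using u2 Snz Pnz dnz Dnz by (intro mult_divide_mult_cancel_left) simp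
      also have "\<dots> = of_real ((1 + s - 2 * s * Re d) / (1 + s))"
        unfolding S1 h of_real_divide by (simp add: S_def mult_ac)
      also have "(1 + s - 2 * s * Re d) / (1 + s) = 1 - 2 * s * Re d / (1 + s)" using s by (simp add: diff_divide_distrib)
      finally show ?thesis .
    qed
    have T: "T_expr P u z = of_real (s * (cmod d)\<^sup>2 / (2 * Re d))"
    proof -
      have den: "Q_expr P u z = S\<^sup>2 * (u\<^sup>2 - 1) * P * u * d * D * h"
        unfolding Q_expr_def Let_def n unfolding z'(2) unfolding z'(1) h_def dD using uu(1) by algebra
      have num: "cnj z*P*u^2 - u^2 - cnj z*u + u*z - P*z + 1 = - S * (u\<^sup>2 - 1) * d * D"
        unfolding z'(2) unfolding z'(1) dD using uu(1) by algebra
      have "T_expr P u z = ((S\<^sup>2 * (u\<^sup>2 - 1) * P * u * d * D) * (S * d * D)) / ((S\<^sup>2 * (u\<^sup>2 - 1) * P * u * d * D) * h)"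
        unfolding T_expr_def Let_def den num uz by (simp add: power2_eq_square mult_ac)
      also have "\<dots> = S * d * D / h"
        using u2 Snz Pnz dnz Dnz uu(2) by (intro mult_divide_mult_cancel_left) simp
      also have "\<dots> = of_real (s * (cmod d)\<^sup>2 / (2 * Re d))"
        unfolding of_real_divide of_real_mult[of s] complex_norm_square h S_def D_def by simp
      finally show ?thesis .
    qed
    have "(1 + s) * (cmod d)\<^sup>2 < 2 * Re d"
      using normal_form_exists[OF p u s z[unfolded d_def]] rad unfolding d_def by (metis max_less_iff_conj)
    moreover have "(1 + s) * (cmod d)\<^sup>2 = (cmod d)\<^sup>2 + s * (cmod d)\<^sup>2" by (simp add: algebra_simps)
    ultimately have "s * (cmod d)\<^sup>2 < 2 * Re d" using zero_le_power2[of "cmod d"] by linarith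
    then have "s * (cmod d)\<^sup>2 / (2 * Re d) \<in> {0<..<1}" using s dnz dpos by simp
    then have T': "T_expr P u z \<in> complex_of_real ` {0<..<1}" unfolding T by (rule imageI)
    have "1 - 2 * s * Re d / (1 + s) \<in> {max ((cmod z)\<^sup>2) (p\<^sup>2)<..<1}" using rad rad1 by auto
    then have R': "R_expr P u z \<in> complex_of_real ` {max ((cmod z)\<^sup>2) (p\<^sup>2)<..<1}" unfolding R by (rule imageI)
    show ?thesis
      unfolding A_set_def using 3 z1 nonreal curve T' R' p unfolding P_def by simp
  qed
qed

section \<open>Points of the bidisk on a given disk\<close>

text \<open>
  Here \<open>w1\<close> and \<open>w2\<close> are the coordinates of a point divided by \<open>u\<close>, and \<open>Y1 / Y2\<close> is the image of \<open>w2\<close>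
  under the automorphism \<open>m\<^sub>z\<close>, rotated by \<open>u\<close>.  The two coordinates of the disk lead to quadratic
  equations for \<open>l\<close> with coefficients \<open>B1, C1\<close> and \<open>B2, C2\<close>, brought to the common leading coefficient
  \<open>q D g Y2\<close>.  The left-hand side is \<open>d\<close> times their resultant, divided by that coefficient; the last factor on the right is
  \<open>A - z B\<close> up to a power of \<open>u\<close> and a sign.
\<close>

lemma resultant_identity:
  fixes s d D w1 w2 :: complex
  defines "h \<equiv> d + D" and "q \<equiv> 1 + s - s * (d + D)" and "g \<equiv> d + D - s * d * D"
    and "Y1 \<equiv> 1 - s * d - w2" and "Y2 \<equiv> 1 - (1 - s * D) * w2"
    and "e \<equiv> 1 - d" and "f \<equiv> 1 - D"
  defines "B1 \<equiv> s * d - D - (s * D - d) * w1" and "C1 \<equiv> - (1 + s) * d * w1"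
    and "B2 \<equiv> (s * h * d - (1 + s) * g) * Y2 - Y1 * ((1 + s) * g - s * h * D)"
    and "C2 \<equiv> Y1 * ((1 + s) * g)"
  shows "d * ((C1 * g * Y2 - D * C2)\<^sup>2 * (q * D * g * Y2)
       + B1 * g * Y2 * (C1 * g * Y2 - D * C2) * (D * B2 - B1 * g * Y2)
       + C1 * g * Y2 * (D * B2 - B1 * g * Y2)\<^sup>2) =
     s\<^sup>2 * (1 + s) * h * D * g^3 * Y2 * (d * D * (1 + s) - h) *
     (e^2*(w1*w2) - e^2*(w1*w2)*(w1+w2) - e*f*(w1+w2) + e*((w1+w2)^2 - 4*(w1*w2)) + e^2*(w1*w2)^2
       - ((w1+w2)^2 - 4*(w1*w2)) + 3*e*f*(w1*w2) + f*(w1+w2) - 4*f*(w1*w2) + f*(w1*w2)*(w1+w2) - e*f*(w1*w2)^2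
      + (1 - s * d) * (e*f - e*(w1+w2) + 3*e*(w1*w2) - f + (w1+w2) - 4*(w1*w2) - 2*e*f*(w1*w2) + 3*f*(w1*w2)
         - e*(w1*w2)^2 + (w1*w2)*(w1+w2) + e*f*(w1*w2)^2 - f*(w1*w2)*(w1+w2)))"
  unfolding assms by algebra

text \<open>
  If the linear coefficients differ, the difference of the two equations determines \<open>l\<close>, and the
  resultant condition says that it solves them.  Otherwise the equations coincide.
\<close>

lemma common_root:
  fixes Q B C B' C' :: complex
  assumes Q: "Q \<noteq> 0" and res: "(C - C')\<^sup>2 * Q + B * (C - C') * (B' - B) + C * (B' - B)\<^sup>2 = 0"
  obtains l where "Q * l\<^sup>2 + B * l + C = 0" "Q * l\<^sup>2 + B' * l + C' = 0"
proof (cases "B' = B")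
  case True
  then have "C' = C" using res Q by simp
  define w where "w = csqrt (B\<^sup>2 - 4 * Q * C)"
  have "w\<^sup>2 = B\<^sup>2 - 4 * Q * C" by (simp add: w_def)
  define x where "x = (w - B) / (2 * Q)"
  have x: "2 * Q * x = w - B" using Q by (simp add: x_def)
  have "4 * Q * (Q * x\<^sup>2 + B * x + C) = (2 * Q * x)\<^sup>2 + 2 * B * (2 * Q * x) + 4 * Q * C" by algebra
  also have "\<dots> = 0" unfolding x using \<open>w\<^sup>2 = B\<^sup>2 - 4 * Q * C\<close> by algebra
  finally have "Q * x\<^sup>2 + B * x + C = 0" using Q by simp
  then show thesis using that True \<open>C' = C\<close> by blast
next
  case False
  define l where "l = (C - C') / (B' - B)"
  have l: "l * (B' - B) = C - C'" using False by (simp add: l_def)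
  have "(B' - B)\<^sup>2 * (Q * l\<^sup>2 + B * l + C) = 0"
    using res unfolding l[symmetric] by algebra
  then have 1: "Q * l\<^sup>2 + B * l + C = 0" using False by simp
  moreover have "Q * l\<^sup>2 + B' * l + C' = 0" using 1 l by algebra
  ultimately show thesis by (rule that)
qed

text \<open>
  A Blaschke product of degree two has modulus at least \<open>1\<close> outside the disk.  The equation is stated
  without division, as it arises from the quadratic; a common zero of its two sides is also covered.
\<close>

lemma blaschke_preimage_in_disc:
  assumes a: "cmod a < 1" and y: "cmod y < 1" and eq: "x * (a - x) = y * (1 - cnj a * x)"
  shows "cmod x < 1"
proof (rule ccontr)
  assume "\<not> cmod x < 1"
  then have x: "1 \<le> cmod x" by simp
  have "(1 - (cmod a)\<^sup>2) * (1 - (cmod x)\<^sup>2) \<le> 0"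
    using a x by (intro mult_nonneg_nonpos) (auto simp: power_le_one one_le_power)
  then have "(cmod (1 - cnj a * x))\<^sup>2 \<le> (cmod (a - x))\<^sup>2" using disk_aut_cmod_sq_diff[of a x] by linarith
  then have le: "cmod (1 - cnj a * x) \<le> cmod (a - x)" by (rule power2_le_imp_le) simp
  have "a - x \<noteq> 0" using a x by auto
  then have pos: "0 < cmod (a - x)" by simp
  have "cmod (a - x) \<le> cmod x * cmod (a - x)" using x pos by simp
  also have "\<dots> = cmod y * cmod (1 - cnj a * x)" using eq by (metis norm_mult)
  also have "\<dots> \<le> cmod y * cmod (a - x)" using le by (intro mult_left_mono) auto
  also have "\<dots> < 1 * cmod (a - x)" using y pos by (intro mult_strict_right_mono)
  finally show False by simp
qed

text \<open>
  The criterion makes the resultant vanish, so both quadratics have a common root \<open>l\<close>.  The first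
  coordinate then forces \<open>\<mu> = v r l\<close> into the disk, and there both equations can be divided by their
  denominators.
\<close>

lemma point_in_disc_of_conic:
  assumes p: "0 < p" "p < 1" and u: "cmod u = 1" and nf: "normal_form p u s z r v a b"
    and z1z: "cmod z < 1" and pt: "(z1, z2) \<in> bidisk"
    and B: "B_den (of_real p) u z1 z2 \<noteq> 0" and zAB: "z = A_num (of_real p) u z1 z2 / B_den (of_real p) u z1 z2"
  obtains \<mu> where "cmod \<mu> < 1" "z1 = \<mu> * disk_aut (v * a) \<mu>"
    "z2 = disk_aut z (u / v\<^sup>2 * \<mu> * disk_aut (v * b) \<mu>)"
proof -
  define d where "d = 1 - of_real p * u"
  define D where "D = cnj d"
  define h where "h = d + D"
  define S where "S = complex_of_real s"
  define g where "g = h - S * d * D"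
  define \<kappa> where "\<kappa> = complex_of_real (1 - r\<^sup>2)"
  have nf': "0 < r" "r < 1" "0 < s" "cmod v = 1" "cmod a < 1" "cmod b < 1"
    "\<kappa> * (1 + S) = S * h" "(1 - of_real r * a) * D = \<kappa>" "g \<noteq> 0" "(1 - of_real r * b) * g = \<kappa> * d"
    "v\<^sup>2 * d = - (u * D)" "z = u * (1 - S * d)"
    using nf unfolding normal_form_def Let_def d_def[symmetric] D_def[symmetric]
      h_def[symmetric] S_def[symmetric] g_def[symmetric] \<kappa>_def[symmetric] by (auto simp: S_def)
  have uu: "u * cnj u = 1" "u \<noteq> 0" using u complex_norm_square[of u] by auto
  have vv: "v * cnj v = 1" "v \<noteq> 0" using nf'(4) complex_norm_square[of v] by auto
  have cmp: "cmod (of_real p * u) < 1" using p u by (simp add: norm_mult)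
  have dnz: "d \<noteq> 0" using cmp by (auto simp: d_def)
  have Dnz: "D \<noteq> 0" using dnz by (simp add: D_def)
  have cnjs: "cnj D = d" "cnj d = D" "cnj h = h" "cnj g = g" "cnj S = S"
    by (simp_all add: D_def h_def g_def S_def algebra_simps)
  have S1: "1 + S = of_real (1 + s)" by (simp add: S_def)
  have S1nz: "1 + S \<noteq> 0" unfolding S1 of_real_eq_0_iff using nf'(3) by simp
  define q where "q = 1 + S - S * h"
  have "r\<^sup>2 \<noteq> 0" using nf'(1) by simp
  then have "1 - \<kappa> \<noteq> 0" by (simp add: \<kappa>_def)
  moreover have "q = (1 + S) * (1 - \<kappa>)" using nf'(7) by (simp add: q_def algebra_simps)
  ultimately have qnz: "q \<noteq> 0" using S1nz by simp
  define w1 where "w1 = cnj u * z1"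
  define w2 where "w2 = cnj u * z2"
  have zw1: "z1 = u * w1" unfolding w1_def using uu(1) by algebra
  have zw2: "z2 = u * w2" unfolding w2_def using uu(1) by algebra
  note zw = zw1 zw2
  have w: "cmod w1 < 1" "cmod w2 < 1" using pt u by (auto simp: w1_def w2_def bidisk_def norm_mult)
  define Y1 where "Y1 = 1 - S * d - w2"
  define Y2 where "Y2 = 1 - (1 - S * D) * w2"
  define B1 where "B1 = S * d - D - (S * D - d) * w1"
  define C1 where "C1 = - (1 + S) * d * w1"
  define B2 where "B2 = (S * h * d - (1 + S) * g) * Y2 - Y1 * ((1 + S) * g - S * h * D)"
  define C2 where "C2 = Y1 * ((1 + S) * g)"
  define e where "e = 1 - d"
  define f where "f = 1 - D"
  define Acal where "Acal = e^2*(w1*w2) - e^2*(w1*w2)*(w1+w2) - e*f*(w1+w2) + e*((w1+w2)^2 - 4*(w1*w2)) + e^2*(w1*w2)^2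
       - ((w1+w2)^2 - 4*(w1*w2)) + 3*e*f*(w1*w2) + f*(w1+w2) - 4*f*(w1*w2) + f*(w1*w2)*(w1+w2) - e*f*(w1*w2)^2"
  define Bcal where "Bcal = e*f - e*(w1+w2) + 3*e*(w1*w2) - f + (w1+w2) - 4*(w1*w2) - 2*e*f*(w1*w2) + 3*f*(w1*w2)
         - e*(w1*w2)^2 + (w1*w2)*(w1+w2) + e*f*(w1*w2)^2 - f*(w1*w2)*(w1+w2)"
  have pf: "of_real p = u * f" "e = u\<^sup>2 * f"
  proof -
    show "of_real p = u * f" unfolding f_def D_def d_def using uu by simp
    then show "e = u\<^sup>2 * f" unfolding e_def d_def by (simp add: power2_eq_square mult_ac)
  qed
  have An: "A_num (of_real p) u z1 z2 = - (u^5) * Acal"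
    unfolding A_num_def Acal_def pf zw by algebra
  have Bd: "B_den (of_real p) u z1 z2 = u^4 * Bcal"
    unfolding B_den_def Bcal_def pf zw by algebra
  have "z * B_den (of_real p) u z1 z2 = A_num (of_real p) u z1 z2" using zAB B by simp
  then have "u^5 * (Acal + (1 - S * d) * Bcal) = 0" unfolding An Bd nf'(12) by algebra
  then have conic: "Acal + (1 - S * d) * Bcal = 0" using uu(2) by simp
  have zc: "cnj z = cnj u * (1 - S * D)" unfolding nf'(12) by (simp add: cnjs)
  have Y2nz: "Y2 \<noteq> 0"
  proof -
    have "1 - cnj z * z2 \<noteq> 0" by (rule disk_aut_denominator_nz[OF z1z]) (use pt in \<open>auto simp: bidisk_def\<close>)
    moreover have "1 - cnj z * z2 = Y2" unfolding zc zw Y2_def using uu(1) by algebra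
    ultimately show ?thesis by simp
  qed
  have "d * ((C1 * g * Y2 - D * C2)\<^sup>2 * (q * D * g * Y2)
       + B1 * g * Y2 * (C1 * g * Y2 - D * C2) * (D * B2 - B1 * g * Y2)
       + C1 * g * Y2 * (D * B2 - B1 * g * Y2)\<^sup>2) = 0"
    using resultant_identity[where s = S and d = d and D = D and ?w1.0 = w1 and ?w2.0 = w2, folded h_def,
        folded q_def g_def Y1_def Y2_def e_def f_def, folded B1_def C1_def B2_def C2_def, folded Acal_def Bcal_def]
    unfolding conic by simp
  then have res: "(C1 * g * Y2 - D * C2)\<^sup>2 * (q * D * g * Y2)
       + B1 * g * Y2 * (C1 * g * Y2 - D * C2) * (D * B2 - B1 * g * Y2)
       + C1 * g * Y2 * (D * B2 - B1 * g * Y2)\<^sup>2 = 0" using dnz by simp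
  have "q * D * g * Y2 \<noteq> 0" using qnz Dnz nf'(9) Y2nz by simp
  then obtain l where l: "q * D * g * Y2 * l\<^sup>2 + B1 * g * Y2 * l + C1 * g * Y2 = 0"
      "q * D * g * Y2 * l\<^sup>2 + D * B2 * l + D * C2 = 0"
    using res by (rule common_root) blast
  have "g * Y2 * (q * D * l\<^sup>2 + B1 * l + C1) = 0" using l(1) by algebra
  then have l1: "q * D * l\<^sup>2 + B1 * l + C1 = 0" using nf'(9) Y2nz by simp
  have "D * (q * g * Y2 * l\<^sup>2 + B2 * l + C2) = 0" using l(2) by algebra
  then have l2: "q * g * Y2 * l\<^sup>2 + B2 * l + C2 = 0" using Dnz by simp
  define x where "x = of_real r * l"
  note fac = normal_form_factors[OF nf, folded d_def, folded D_def S_def, folded h_def, folded q_def g_def, of l, folded x_def]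
  have "(1 + S) * d * (v\<^sup>2 * (x * (a - x))) = (1 + S) * d * (z1 * (1 - cnj a * x))"
  proof -
    have "(1 + S) * d * (v\<^sup>2 * (x * (a - x))) = - u * (l * ((1 + S) * D * (of_real r * (a - x))))"
      using nf'(11) unfolding x_def by algebra
    also have "\<dots> = - u * (l * (D - S * d - D * q * l))" unfolding fac(1) ..
    also have "\<dots> = z1 * ((1 + S) * d + (S * D - d) * l)"
      unfolding zw using l1 unfolding B1_def C1_def by algebra
    also have "\<dots> = (1 + S) * d * (z1 * (1 - cnj a * x))" unfolding fac(2)[symmetric] by algebra
    finally show ?thesis .
  qed
  then have e1: "v\<^sup>2 * (x * (a - x)) = z1 * (1 - cnj a * x)" using S1nz dnz by simp
  define y1 where "y1 = z1 / v\<^sup>2"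
  have y1: "cmod y1 < 1" using pt nf'(4) by (simp add: y1_def bidisk_def norm_divide norm_power)
  have e1': "x * (a - x) = y1 * (1 - cnj a * x)" using e1 vv(2) by (simp add: y1_def field_simps)
  have x1: "cmod x < 1" by (rule blaschke_preimage_in_disc[OF nf'(5) y1 e1'])
  have nz: "1 - cnj a * x \<noteq> 0" "1 - cnj b * x \<noteq> 0"
    using disk_aut_denominator_nz[of a x] disk_aut_denominator_nz[of b x] x1 nf' by auto
  have "(1 + S) * g * (Y2 * (x * (b - x))) = (1 + S) * g * (Y1 * (1 - cnj b * x))"
  proof -
    have "(1 + S) * g * (Y2 * (x * (b - x))) = Y2 * ((1 + S) * g * (x * (b - x)))" by algebra
    also have "\<dots> = Y2 * (l * ((1 + S) * g - S * h * d - g * q * l))" unfolding fac(3) ..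
    also have "\<dots> = Y1 * ((1 + S) * g - ((1 + S) * g - S * h * D) * l)"
      using l2 unfolding B2_def C2_def by algebra
    also have "\<dots> = (1 + S) * g * (Y1 * (1 - cnj b * x))" unfolding fac(4)[symmetric] by algebra
    finally show ?thesis .
  qed
  then have e2: "Y2 * (x * (b - x)) = Y1 * (1 - cnj b * x)" using S1nz nf'(9) by simp
  define y where "y = x * ((b - x) / (1 - cnj b * x))"
  have y: "Y2 * y = Y1" using e2 nz(2) by (simp add: y_def field_simps)
  define \<mu> where "\<mu> = v * x"
  have rotate: "disk_aut (v * y) \<mu> = v * ((y - x) / (1 - cnj y * x))" for y
  proof -
    have "1 - cnj (v * y) * \<mu> = 1 - cnj y * x" unfolding \<mu>_def complex_cnj_mult using vv(1) by algebra
    moreover have "v * y - \<mu> = v * (y - x)" unfolding \<mu>_def by algebra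
    ultimately show ?thesis unfolding disk_aut_def by simp
  qed
  show thesis
  proof (rule that[of \<mu>])
    show "cmod \<mu> < 1" using x1 nf'(4) by (simp add: \<mu>_def norm_mult)
    show "z1 = \<mu> * disk_aut (v * a) \<mu>"
    proof -
      have "\<mu> * disk_aut (v * a) \<mu> = v\<^sup>2 * (x * (a - x)) / (1 - cnj a * x)"
        unfolding rotate unfolding \<mu>_def by (simp add: power2_eq_square)
      also have "\<dots> = z1" unfolding e1 using nz(1) by simp
      finally show ?thesis ..
    qed
    have "u / v\<^sup>2 * \<mu> * disk_aut (v * b) \<mu> = u * y"
      unfolding rotate y_def unfolding \<mu>_def using vv(2) by (simp add: power2_eq_square)
    moreover have "disk_aut z (u * y) = z2"
    proof -
      define n where "n = 1 - (1 - S * d) * (1 - S * D)"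
      have "of_real ((cmod z)\<^sup>2) = (1 - S * d) * (1 - S * D)"
        unfolding complex_norm_square zc unfolding nf'(12) using uu(1) by algebra
      moreover have "(cmod z)\<^sup>2 \<noteq> 1" using z1z by (metis less_irrefl norm_ge_zero power2_eq_1_iff not_one_le_zero neg_0_le_iff_le)
      ultimately have nnz: "n \<noteq> 0" unfolding n_def by (metis eq_iff_diff_eq_0 of_real_eq_1_iff)
      have "Y2 * (1 - cnj z * (u * y)) = Y2 - (1 - S * D) * (Y2 * y)" unfolding zc using uu(1) by algebra
      also have "\<dots> = n" unfolding y unfolding n_def Y1_def Y2_def by algebra
      finally have dn: "Y2 * (1 - cnj z * (u * y)) = n" .
      have "Y2 * (z - u * y) = u * ((1 - S * d) * Y2 - Y2 * y)" unfolding nf'(12) by algebra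
      also have "\<dots> = z2 * n" unfolding y unfolding n_def Y1_def Y2_def zw by algebra
      finally have nn: "Y2 * (z - u * y) = z2 * n" .
      have "disk_aut z (u * y) = (Y2 * (z - u * y)) / (Y2 * (1 - cnj z * (u * y)))"
        unfolding disk_aut_def using Y2nz by simp
      also have "\<dots> = z2" unfolding dn nn using nnz by simp
      finally show ?thesis .
    qed
    ultimately show "z2 = disk_aut z (u / v\<^sup>2 * \<mu> * disk_aut (v * b) \<mu>)" by simp
  qed
qed

section \<open>The Green function on the hypersurface\<close>

theorem theorem6p3:
  fixes p :: real and z1 z2 u :: complex
  assumes "0 < p" and "p < 1"
    and "(z1, z2) \<in> region2 p p"
    and "cmod u = 1"
  shows "let P = complex_of_real p in
    ((\<exists>z::complex. cmod z < 1 \<and>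
         cnj z * P * u^4 - cnj z * u^3 - P * u^3 + P * u - P * z + u * z = 0 \<and>
         (P * u^2 * z - P * u + P * z - u * z) / (u * (P * u^2 - 2 * u + z))
            \<in> complex_of_real ` {max (p^2) ((cmod z)^2)<..<1} \<and>
         ((u - z) * (P - u)) / (u * (P * u^2 + P - 2 * u)) \<in> complex_of_real ` {0<..<1} \<and>
         B_den P u z1 z2 \<noteq> 0 \<and> z = A_num P u z1 z2 / B_den P u z1 z2)
       \<longrightarrow> (z1, z2) \<in> S_set p p u) \<and>
     ((z1, z2) \<in> S_set p p u \<longrightarrow>
       green_bidisk (z1, z2) (P, 0) (0, P) =
         ereal (ln (cmod ((P * u^2 - P * z1 * z2 - u^2 * (z1 + z2) + 2 * u * z1 * z2) /
                          (P * u^2 - P * z1 * z2 - 2 * u + z1 + z2)))))"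
proof -
  note p = assms(1,2) and u = assms(4)
  have pt: "(z1, z2) \<in> bidisk" and nr3: "(z1, z2) \<notin> region3 p p" using assms(3) by (auto simp: region2_def)
  have member: "(z1, z2) \<in> S_set p p u"
    if z: "cmod z < 1"
      "cnj z * of_real p * u^4 - cnj z * u^3 - of_real p * u^3 + of_real p * u - of_real p * z + u * z = 0"
      "(of_real p * u^2 * z - of_real p * u + of_real p * z - u * z) / (u * (of_real p * u^2 - 2 * u + z))
            \<in> complex_of_real ` {max (p^2) ((cmod z)^2)<..<1}"
      "B_den (of_real p) u z1 z2 \<noteq> 0" "z = A_num (of_real p) u z1 z2 / B_den (of_real p) u z1 z2" for z
  proof -
    obtain s where s: "0 < s" "z = u * (1 - of_real s * (1 - of_real p * u))"
      by (rule line_parameter[OF p u z(1,2)]) blast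
    have rad: "max (p\<^sup>2) ((cmod z)\<^sup>2) < 1 - 2 * s * Re (1 - of_real p * u) / (1 + s)"
      using z(3) unfolding radius_on_line[OF p u s] by (auto simp only: image_iff of_real_eq_iff greaterThanLessThan_iff)
    then have rad': "p\<^sup>2 < 1 - 2 * s * Re (1 - of_real p * u) / (1 + s)" by simp
    obtain r v a b where nf: "normal_form p u s z r v a b"
      and key: "(1 + s) * (cmod (1 - of_real p * u))\<^sup>2 < 2 * Re (1 - of_real p * u)"
      by (rule normal_form_exists[OF p u s rad']) blast
    note par = normal_form_disk_parameters[OF p u nf key z(1)]
    have zA: "z \<in> A_set p p u" by (rule point_on_line_in_A_set[OF p u s z(1) rad])
    obtain \<mu> where \<mu>: "cmod \<mu> < 1" "z1 = \<mu> * disk_aut (v * a) \<mu>"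
      "z2 = disk_aut z (u / v\<^sup>2 * \<mu> * disk_aut (v * b) \<mu>)"
      by (rule point_in_disc_of_conic[OF p u nf z(1) pt z(4,5)]) blast
    have "(z1, z2) = G_map z (phi_disk (v * a) (v * b) (u / v\<^sup>2) \<mu>)"
      using \<mu>(2,3) by (simp add: G_map_def phi_disk_def)
    then have in_disc: "(z1, z2) \<in> G_map z ` phi_disk (v * a) (v * b) (u / v\<^sup>2) ` ball 0 1"
      using \<mu>(1) by auto
    show ?thesis unfolding S_set_def
    proof (rule UN_I[OF zA], rule UnionI[OF _ in_disc])
      show "G_map z ` phi_disk (v * a) (v * b) (u / v\<^sup>2) ` ball 0 1 \<in>
          {G_map z ` phi_disk \<alpha> \<beta> \<omega> ` ball 0 1 |\<alpha> \<beta> c \<omega> t. disk_parameters p p u z \<alpha> \<beta> c \<omega> t}"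
        by (intro CollectI exI conjI, rule refl, rule par)
    qed
  qed
  have green: "green_bidisk (z1, z2) (of_real p, 0) (0, of_real p) = ereal (ln (cmod (extremal_fun p u z1 z2)))"
    if S: "(z1, z2) \<in> S_set p p u"
  proof -
    obtain z \<alpha> \<beta> c \<omega> t l where par: "disk_parameters p p u z \<alpha> \<beta> c \<omega> t" and l: "cmod l < 1"
      and eq: "(z1, z2) = G_map z (phi_disk \<alpha> \<beta> \<omega> l)"
      using S unfolding S_set_def by auto
    have "(z1, z2) \<noteq> (of_real p, 0)" "(z1, z2) \<noteq> (0, of_real p)"
      using nr3 pt by (auto simp: region3_def disk_aut_def)
    then show ?thesis by (rule green_bidisk_on_disc[OF p u par l eq])
  qed
  show ?thesis unfolding Let_def using member green unfolding extremal_fun_def by blast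
qed

end
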